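(* Let $m>0$ and $0\le a\le m$, let $r_+(a):=m+\sqrt{m^2-a^2}$, and let $r>r_+(a)$. Let $S$ be the surface of constant $t$ and constant $r$ in the Kerr spacetime with parameters $(m,a)$ in Boyer–Lindquist coordinates. Let $K(a,r,\theta)$ be the Gaussian curvature of $S$, $k(a,r,\theta)$ the mean curvature of $S$ in the slice of constant $t$, and $k_0(a,r,\theta)$ the mean curvature of the isometric embedding $\bar S$ of $S$ into $\mathbb{R}^3$. (1) $K(a,r,\theta)>0$ for every $\theta\in[0,\pi]$ if and only if $r>r_k(a)$. Here $r_k(a)$ is the unique real root of the cubic polynomial $r^3+a^2r-6a^2m$ in the variable $r$, that is, $$r_k(a)=-\frac{a^2}{\sqrt[3]{3}\,\sqrt[3]{27a^2m+\sqrt3\sqrt{243a^4m^2+a^6}}}+\frac{\sqrt[3]{27a^2m+\sqrt3\sqrt{243a^4m^2+a^6}}}{\sqrt[3]{9}}$$ (with $r_k(0)=0$). (2) $k_0(a,r,\theta)-k(a,r,\theta)>0$ for every $\theta\in[0,\pi]$ if and only if $r>\sqrt3\,a$. (The left-hand condition is understood to include that the isometric embedding $\bar S$ into $\mathbb{R}^3$ exists, so that $k_0$ is defined.)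
   Context: The Kerr metric in Boyer–Lindquist coordinates $(t,r,\theta,\phi)$ is $$g=F\,dt^2+2G\,dt\,d\phi+H\,d\phi^2+R^2\,dr^2+\Sigma^2\,d\theta^2,$$ where $$\Delta=r^2-2mr+a^2,\quad \Sigma^2=r^2+a^2\cos^2\theta,\quad R^2\Delta=\Sigma^2,$$ $$F=-\frac{\Delta-a^2\sin^2\theta}{\Sigma^2},\quad G=-\frac{2mar\sin^2\theta}{\Sigma^2},\quad H\Sigma^2=\sin^2\theta\big((r^2+a^2)^2-\Delta a^2\sin^2\theta\big),$$ with $R,\Sigma>0$. The constant radius surface $S=S(t_0,r_0)=\{t=t_0,\ r=r_0\}$ is a sphere with induced metric $H\,d\phi^2+\Sigma^2\,d\theta^2$, $\theta\in[0,\pi]$; the values of $K$, $k$, $k_0$ at the poles $\theta=0,\pi$ are obtained by continuity. The mean curvature $k$ is the trace of the second fundamental form of $S$ in the hypersurface $t=t_0$ (with metric $H\,d\phi^2+R^2\,dr^2+\Sigma^2\,d\theta^2$) with respect to the unit normal in the direction of increasing $r$. Explicitly, with subscripts denoting partial derivatives, $$k=\frac{(H\Sigma^2)_r}{2H\Sigma^2R}.$$ The mean curvature $k_0$ is the trace of the second fundamental form, with respect to the outward unit normal, of the axially symmetric isometric embedding $\bar S$ of $S$ into Euclidean $\mathbb{R}^3$, if such an embedding exists. The sign convention is that a round sphere has positive mean curvature. Explicitly, $$k_0=\frac{H_\theta(\Sigma^2)_\theta+4\Sigma^4-2H_{\theta\theta}\Sigma^2}{2\Sigma^3\sqrt{4H\Sigma^2-H_\theta^2}}.$$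 *)

theory Defs
  imports "HOL-Analysis.Analysis"
begin

section \<open>Differential geometry in coordinates\<close>

definition partial_deriv :: "'n::finite \<Rightarrow> (real^'n \<Rightarrow> 'b::real_normed_vector) \<Rightarrow> real^'n \<Rightarrow> 'b"
  where "partial_deriv i f x = vector_derivative (\<lambda>s. f (x + s *\<^sub>R axis i 1)) (at 0)"

primrec C_k_on :: "nat \<Rightarrow> (real^'n::finite) set \<Rightarrow> (real^'n \<Rightarrow> 'b::real_normed_vector) \<Rightarrow> bool"
  where
    "C_k_on 0 U f \<longleftrightarrow> continuous_on U f"
  | "C_k_on (Suc k) U f \<longleftrightarrow>
       (\<forall>x\<in>U. f differentiable (at x)) \<and> (\<forall>i. C_k_on k U (partial_deriv i f))"

text \<open>A metric on a coordinate domain is the field \<open>g\<close> of its Gram matrices;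
  the metric induced by \<open>X\<close> has the entries \<open>g(\<partial>\<^sub>i X, \<partial>\<^sub>j X)\<close>.\<close>

definition induced_metric ::
  "(real^'m::finite \<Rightarrow> real^'m^'m) \<Rightarrow> (real^'n::finite \<Rightarrow> real^'m) \<Rightarrow> real^'n \<Rightarrow> real^'n^'n"
  where "induced_metric g X p =
    (\<chi> i j. partial_deriv i X p \<bullet> (g (X p) *v partial_deriv j X p))"

text \<open>\<open>christoffel g k i j\<close> is the symbol with upper index \<open>k\<close> and lower indices \<open>i, j\<close>.\<close>

definition christoffel ::
  "(real^'n::finite \<Rightarrow> real^'n^'n) \<Rightarrow> 'n \<Rightarrow> 'n \<Rightarrow> 'n \<Rightarrow> real^'n \<Rightarrow> real"
  where "christoffel g k i j x =
    (\<Sum>l\<in>UNIV. matrix_inv (g x) $ k $ l *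
       (partial_deriv i (\<lambda>y. g y $ j $ l) x + partial_deriv j (\<lambda>y. g y $ i $ l) x
        - partial_deriv l (\<lambda>y. g y $ i $ j) x)) / 2"

text \<open>\<open>riemann g l k i j\<close> is the \<open>l\<close>-component of \<open>R(\<partial>\<^sub>i, \<partial>\<^sub>j)\<partial>\<^sub>k\<close>, where
  \<open>R(X, Y) = \<nabla>\<^sub>X \<nabla>\<^sub>Y - \<nabla>\<^sub>Y \<nabla>\<^sub>X - \<nabla>\<^sub>[\<^sub>X\<^sub>,\<^sub>Y\<^sub>]\<close>.\<close>

definition riemann ::
  "(real^'n::finite \<Rightarrow> real^'n^'n) \<Rightarrow> 'n \<Rightarrow> 'n \<Rightarrow> 'n \<Rightarrow> 'n \<Rightarrow> real^'n \<Rightarrow> real"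
  where "riemann g l k i j x =
    partial_deriv i (christoffel g l j k) x - partial_deriv j (christoffel g l i k) x
    + (\<Sum>n\<in>UNIV. christoffel g l i n x * christoffel g n j k x
                - christoffel g l j n x * christoffel g n i k x)"

text \<open>\<open>K = g(R(\<partial>\<^sub>1, \<partial>\<^sub>2)\<partial>\<^sub>2, \<partial>\<^sub>1) / det g\<close>.\<close>

definition gauss_curvature :: "(real^2 \<Rightarrow> real^2^2) \<Rightarrow> real^2 \<Rightarrow> real"
  where "gauss_curvature g x =
    (\<Sum>l\<in>UNIV. g x $ 1 $ l * riemann g l 2 1 2 x) / det (g x)"

text \<open>For a parametrised hypersurface \<open>X\<close> in \<open>(\<real>\<^sup>m, g)\<close> with unit normal field \<open>N\<close> along \<open>X\<close>,
  the second fundamental form is \<open>- g(\<nabla>\<^sub>i \<partial>\<^sub>j X, N) = g(\<nabla>\<^sub>i N, \<partial>\<^sub>j X)\<close>. With this sign a round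
  sphere in Euclidean space has positive mean curvature for its outward normal. The mean curvature
  is the trace (not half the trace).\<close>

definition covariant_hessian ::
  "(real^'m::finite \<Rightarrow> real^'m^'m) \<Rightarrow> (real^'n::finite \<Rightarrow> real^'m) \<Rightarrow> 'n \<Rightarrow> 'n \<Rightarrow> real^'n \<Rightarrow> real^'m"
  where "covariant_hessian g X i j p =
    partial_deriv i (partial_deriv j X) p +
    (\<chi> k. \<Sum>l\<in>UNIV. \<Sum>n\<in>UNIV.
       christoffel g k l n (X p) * partial_deriv i X p $ l * partial_deriv j X p $ n)"

definition second_fundamental_form ::
  "(real^'m::finite \<Rightarrow> real^'m^'m) \<Rightarrow> (real^'n::finite \<Rightarrow> real^'m) \<Rightarrow> (real^'n \<Rightarrow> real^'m)
    \<Rightarrow> real^'n \<Rightarrow> real^'n^'n"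
  where "second_fundamental_form g X N p =
    (\<chi> i j. - (covariant_hessian g X i j p \<bullet> (g (X p) *v N p)))"

definition mean_curvature ::
  "(real^'m::finite \<Rightarrow> real^'m^'m) \<Rightarrow> (real^'n::finite \<Rightarrow> real^'m) \<Rightarrow> (real^'n \<Rightarrow> real^'m)
    \<Rightarrow> real^'n \<Rightarrow> real"
  where "mean_curvature g X N p =
    trace (matrix_inv (induced_metric g X p) ** second_fundamental_form g X N p)"

abbreviation euclidean_metric :: "real^'n::finite \<Rightarrow> real^'n^'n"
  where "euclidean_metric \<equiv> \<lambda>_. mat 1"

text \<open>Functions of the polar angle are given on \<open>(0, \<pi>)\<close>, where spherical coordinates are regular;
  their values at the poles are limits.\<close>

definition extend_to_poles :: "(real \<Rightarrow> real) \<Rightarrow> real \<Rightarrow> real"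
  where "extend_to_poles f \<theta> =
    (if \<theta> = 0 \<or> \<theta> = pi then Lim (at \<theta> within {0<..<pi}) f else f \<theta>)"


section \<open>The Kerr metric and its constant radius surfaces\<close>

definition kerr_Delta :: "real \<Rightarrow> real \<Rightarrow> real \<Rightarrow> real"
  where "kerr_Delta m a r = r\<^sup>2 - 2 * m * r + a\<^sup>2"

definition kerr_Sigma2 :: "real \<Rightarrow> real \<Rightarrow> real \<Rightarrow> real"
  where "kerr_Sigma2 a r \<theta> = r\<^sup>2 + a\<^sup>2 * (cos \<theta>)\<^sup>2"

definition kerr_R :: "real \<Rightarrow> real \<Rightarrow> real \<Rightarrow> real \<Rightarrow> real"
  where "kerr_R m a r \<theta> = sqrt (kerr_Sigma2 a r \<theta> / kerr_Delta m a r)"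

definition kerr_F :: "real \<Rightarrow> real \<Rightarrow> real \<Rightarrow> real \<Rightarrow> real"
  where "kerr_F m a r \<theta> = - (kerr_Delta m a r - a\<^sup>2 * (sin \<theta>)\<^sup>2) / kerr_Sigma2 a r \<theta>"

definition kerr_G :: "real \<Rightarrow> real \<Rightarrow> real \<Rightarrow> real \<Rightarrow> real"
  where "kerr_G m a r \<theta> = - (2 * m * a * r * (sin \<theta>)\<^sup>2) / kerr_Sigma2 a r \<theta>"

definition kerr_H :: "real \<Rightarrow> real \<Rightarrow> real \<Rightarrow> real \<Rightarrow> real"
  where "kerr_H m a r \<theta> =
    (sin \<theta>)\<^sup>2 * ((r\<^sup>2 + a\<^sup>2)\<^sup>2 - kerr_Delta m a r * a\<^sup>2 * (sin \<theta>)\<^sup>2) / kerr_Sigma2 a r \<theta>"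

text \<open>The coordinates are \<open>(t, r, \<theta>, \<phi>)\<close> on spacetime, \<open>(r, \<theta>, \<phi>)\<close> on a slice of constant \<open>t\<close>, and
  \<open>(\<theta>, \<phi>)\<close> on a surface of constant \<open>t\<close> and \<open>r\<close>.\<close>

definition kerr_metric :: "real \<Rightarrow> real \<Rightarrow> real^4 \<Rightarrow> real^4^4"
  where "kerr_metric m a x = (let r = x $ 2; \<theta> = x $ 3 in vector
    [vector [kerr_F m a r \<theta>, 0, 0, kerr_G m a r \<theta>],
     vector [0, (kerr_R m a r \<theta>)\<^sup>2, 0, 0],
     vector [0, 0, kerr_Sigma2 a r \<theta>, 0],
     vector [kerr_G m a r \<theta>, 0, 0, kerr_H m a r \<theta>]])"

definition time_slice :: "real \<Rightarrow> real^3 \<Rightarrow> real^4"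
  where "time_slice t y = vector [t, y $ 1, y $ 2, y $ 3]"

definition radius_surface :: "real \<Rightarrow> real^2 \<Rightarrow> real^3"
  where "radius_surface r p = vector [r, p $ 1, p $ 2]"

definition slice_metric :: "real \<Rightarrow> real \<Rightarrow> real \<Rightarrow> real^3 \<Rightarrow> real^3^3"
  where "slice_metric m a t = induced_metric (kerr_metric m a) (time_slice t)"

definition surface_metric :: "real \<Rightarrow> real \<Rightarrow> real \<Rightarrow> real \<Rightarrow> real^2 \<Rightarrow> real^2^2"
  where "surface_metric m a t r = induced_metric (slice_metric m a t) (radius_surface r)"

text \<open>By axial symmetry \<open>K\<close>, \<open>k\<close> and \<open>k\<^sub>0\<close> do not depend on \<open>\<phi>\<close>; they are evaluated at \<open>\<phi> = 0\<close>.\<close>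

definition surface_K :: "real \<Rightarrow> real \<Rightarrow> real \<Rightarrow> real \<Rightarrow> real \<Rightarrow> real"
  where "surface_K m a t r =
    extend_to_poles (\<lambda>\<theta>. gauss_curvature (surface_metric m a t r) (vector [\<theta>, 0]))"

text \<open>The unit normal of the surface in the slice, in the direction of increasing \<open>r\<close>,
  is \<open>R\<^sup>-\<^sup>1 \<partial>\<^sub>r\<close>.\<close>

definition surface_normal :: "real \<Rightarrow> real \<Rightarrow> real \<Rightarrow> real^2 \<Rightarrow> real^3"
  where "surface_normal m a r p = vector [1 / kerr_R m a r (p $ 1), 0, 0]"

definition surface_k :: "real \<Rightarrow> real \<Rightarrow> real \<Rightarrow> real \<Rightarrow> real \<Rightarrow> real"
  where "surface_k m a t r =
    extend_to_poles (\<lambda>\<theta>. mean_curvature (slice_metric m a t) (radius_surface r)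
      (surface_normal m a r) (vector [\<theta>, 0]))"


section \<open>Axially symmetric isometric embeddings into Euclidean space\<close>

definition spherical_coords :: "real^2 \<Rightarrow> real^3"
  where "spherical_coords p =
    vector [sin (p $ 1) * cos (p $ 2), sin (p $ 1) * sin (p $ 2), cos (p $ 1)]"

definition rotate_axis :: "real \<Rightarrow> real^3 \<Rightarrow> real^3"
  where "rotate_axis \<alpha> x =
    vector [cos \<alpha> * x $ 1 - sin \<alpha> * x $ 2, sin \<alpha> * x $ 1 + cos \<alpha> * x $ 2, x $ 3]"

text \<open>The surface is a sphere on which \<open>(\<theta>, \<phi>)\<close> are spherical coordinates, so an embedding of it
  is a map \<open>e\<close> on the unit sphere; smoothness (including at the poles) is that of an extension to
  a neighbourhood. The isometry condition for the metric \<open>\<gamma>\<close> is imposed where \<open>(\<theta>, \<phi>)\<close> are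
  regular coordinates and holds at the poles by continuity.\<close>

definition axisymmetric_isometric_embedding ::
  "(real^2 \<Rightarrow> real^2^2) \<Rightarrow> (real^3 \<Rightarrow> real^3) \<Rightarrow> bool"
  where "axisymmetric_isometric_embedding \<gamma> e \<longleftrightarrow>
    (\<exists>U. open U \<and> sphere 0 1 \<subseteq> U \<and> (\<forall>k. C_k_on k U e)) \<and>
    inj_on e (sphere 0 1) \<and>
    (\<forall>\<alpha>. \<forall>q\<in>sphere 0 1. e (rotate_axis \<alpha> q) = rotate_axis \<alpha> (e q)) \<and>
    (\<forall>\<theta>\<in>{0<..<pi}. \<forall>\<phi>.
       induced_metric euclidean_metric (e \<circ> spherical_coords) (vector [\<theta>, \<phi>])
         = \<gamma> (vector [\<theta>, \<phi>]))"

text \<open>Outward means pointing into the unbounded component of the complement of the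
  embedded sphere. Orthogonality at the poles follows from continuity.\<close>

definition outward_unit_normal :: "(real^3 \<Rightarrow> real^3) \<Rightarrow> (real^3 \<Rightarrow> real^3) \<Rightarrow> bool"
  where "outward_unit_normal e \<nu> \<longleftrightarrow>
    continuous_on (sphere 0 1) \<nu> \<and>
    (\<forall>q\<in>sphere 0 1. norm (\<nu> q) = 1 \<and>
       (\<forall>\<^sub>F s in at_right 0. e q + s *\<^sub>R \<nu> q \<in> outside (e ` sphere 0 1))) \<and>
    (\<forall>\<theta>\<in>{0<..<pi}. \<forall>\<phi> i.
       partial_deriv i (e \<circ> spherical_coords) (vector [\<theta>, \<phi>])
         \<bullet> \<nu> (spherical_coords (vector [\<theta>, \<phi>])) = 0)"

definition embedding_k0 :: "(real^3 \<Rightarrow> real^3) \<Rightarrow> (real^3 \<Rightarrow> real^3) \<Rightarrow> real \<Rightarrow> real"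
  where "embedding_k0 e \<nu> =
    extend_to_poles (\<lambda>\<theta>. mean_curvature euclidean_metric (e \<circ> spherical_coords)
      (\<nu> \<circ> spherical_coords) (vector [\<theta>, 0]))"


section \<open>The horizon radius and the root of the cubic\<close>

definition kerr_r_plus :: "real \<Rightarrow> real \<Rightarrow> real"
  where "kerr_r_plus m a = m + sqrt (m\<^sup>2 - a\<^sup>2)"

text \<open>For \<open>a = 0\<close> the convention \<open>0 / 0 = 0\<close> gives the intended value \<open>0\<close>.\<close>

definition kerr_r_k :: "real \<Rightarrow> real \<Rightarrow> real"
  where "kerr_r_k m a =
    (let c = root 3 (27 * a\<^sup>2 * m + sqrt 3 * sqrt (243 * a^4 * m\<^sup>2 + a^6))
     in - a\<^sup>2 / (root 3 3 * c) + c / root 3 9)"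

end

(*
  Write y = sin^2 theta. The induced metric is E d theta^2 +
    H d phi^2 with E and H rational in y, so
  K and the squares of the principal curvatures are rational in y. For any axially symmetric
  isometric embedding the curvature kappa along the parallels satisfies
  kappa^2 = W / (E^3 P^2) with a polynomial W, and k_0 kappa = kappa^2 + K by the Gauss equation;
  hence k_0 >= 2 sqrt K, with equality at the (umbilical) poles.
  At a pole 4 K - k^2 has the sign of r^2 - 3 a^2 (and K that of r^3 + a^2 r - 6 a^2 m), which gives
  necessity. Conversely, if r^2 > 3 a^2 then 4 K > k^2 everywhere and W > 0, so that the profile
  curve of the embedding can be integrated. All polynomial inequalities in y in [0, 1] are read off
  from Bernstein coefficients.
*)
theory Submission
  imports Defs
begin

section \<open>Coordinate geometry of diagonal metrics\<close>

text \<open>The constant \<open>sqrt 3\<close> comes from one factorisation. At a pole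
  \<open>K = pole_num / B ^ 3\<close> and \<open>k^2 = 4 * r^2 * D / B ^ 3\<close>, while
  \<open>pole_num - r^2 * D = (r^2 - 3 * \<alpha>) * (B - D)\<close> and
  \<open>B - D = 2 * m * r\<close> is positive. For an embedding given in the abstract, the metric
  fixes only the square of kappa. Both signs lead to k_0 <= 2 sqrt K at the pole, but the limit
  exists only because the sign is constant near it; this, like the division by kappa, rests on W > 0
  there. In the borderline case \<open>pole_num = 0\<close>, where W and K both vanish at the pole,
  the limit is found from the first order in y. For sufficiency the sign matters: a surface of
  revolution with kappa > 0 is written down, and its normal is shown to point outward. The
  constraints on (m, a, r) are traded for parameters that range freely: \<delta> = r^2 - 3 \<alpha>
  and \<tau> = D / (r^2 - \<alpha>), where a <= m < r yields \<tau> < 1. Each Bernstein coefficient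
  then expands into monomials in \<alpha>, \<delta>, \<tau> and 1 - \<tau> whose coefficients are
  all positive.\<close>

lemma partial_deriv_eqI:
  "((\<lambda>s. f (x + s *\<^sub>R axis i 1)) has_vector_derivative D) (at 0) \<Longrightarrow> partial_deriv i f x = D"
  unfolding partial_deriv_def by (rule vector_derivative_at)

lemma partial_deriv_cong:
  assumes "\<forall>\<^sub>F y in nhds x. f y = g y"
  shows "partial_deriv i f x = partial_deriv i g x"
proof -
  have "((\<lambda>s::real. x + s *\<^sub>R axis i 1) \<longlongrightarrow> x + 0 *\<^sub>R axis i 1) (nhds 0)"
    by (intro tendsto_intros) (auto simp: filterlim_ident)
  then have "\<forall>\<^sub>F s in nhds (0::real). f (x + s *\<^sub>R axis i 1) = g (x + s *\<^sub>R axis i 1)"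
    using eventually_compose_filterlim[OF assms] by simp
  then show ?thesis
    unfolding partial_deriv_def by (intro vector_derivative_cong_eq) (auto elim: eventually_mono)
qed

lemma eventually_nth_in:
  fixes x :: "real^'n::finite"
  assumes "open S" "x $ i \<in> S"
  shows "\<forall>\<^sub>F z in nhds x. z $ i \<in> S"
proof -
  have "((\<lambda>z::real^'n. z $ i) \<longlongrightarrow> x $ i) (nhds x)"
    by (intro tendsto_intros) (auto simp: filterlim_ident)
  from topological_tendstoD[OF this assms] show ?thesis .
qed

lemma partial_deriv_const [simp]: "partial_deriv i (\<lambda>_. c) x = 0"
  by (intro partial_deriv_eqI) (auto intro!: derivative_eq_intros)

lemma partial_deriv_coord:
  assumes "(f has_vector_derivative D) (at (x $ j))"
  shows "partial_deriv i (\<lambda>y. f (y $ j)) x = (if i = j then D else 0)"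
proof (rule partial_deriv_eqI)
  have "((\<lambda>s. x $ j + s * axis i 1 $ j) has_vector_derivative (axis i 1 $ j)) (at 0)"
    by (auto intro!: derivative_eq_intros)
  moreover have "(f has_vector_derivative D) (at (x $ j + 0 * axis i 1 $ j))"
    using assms by simp
  ultimately have "((f \<circ> (\<lambda>s. x $ j + s * axis i 1 $ j)) has_vector_derivative (axis i 1 $ j)
    *\<^sub>R D) (at 0)"
    by (rule vector_diff_chain_at)
  then show "((\<lambda>s. f ((x + s *\<^sub>R axis i 1) $ j)) has_vector_derivative (if i = j then D else 0))
    (at 0)"
    by (auto simp: o_def axis_def)
qed

lemma differentiable_imp_partial:
  assumes "f differentiable (at x)"
  shows "(f has_derivative (\<lambda>h. \<Sum>i\<in>UNIV. (h $ i) *\<^sub>R partial_deriv i f x)) (at x)"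
proof -
  obtain f' where f': "(f has_derivative f') (at x)" using assms by (auto simp: differentiable_def)
  then interpret bounded_linear f' by (rule has_derivative_bounded_linear)
  have p: "partial_deriv i f x = f' (axis i 1)" for i
  proof (rule partial_deriv_eqI)
    have 1: "((\<lambda>s. x + s *\<^sub>R axis i 1) has_vector_derivative (axis i 1)) (at 0)"
      by (auto intro!: derivative_eq_intros)
    have "(f has_derivative f') (at (x + 0 *\<^sub>R axis i 1))" using f' by simp
    from vector_derivative_diff_chain_within[OF 1, of f f'] this
    show "((\<lambda>s. f (x + s *\<^sub>R axis i 1)) has_vector_derivative f' (axis i 1)) (at 0)"
      by (simp add: o_def has_derivative_at_withinI)
  qed
  have "f' h = (\<Sum>i\<in>UNIV. (h $ i) *\<^sub>R partial_deriv i f x)" for h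
  proof -
    have "h = (\<Sum>i\<in>UNIV. (h $ i) *\<^sub>R axis i 1)"
      by (simp add: vec_eq_iff axis_def if_distrib cong: if_cong)
    then have "f' h = f' (\<Sum>i\<in>UNIV. (h $ i) *\<^sub>R axis i 1)" by simp
    then show ?thesis by (simp add: sum scaleR p)
  qed
  then show ?thesis using f' by (metis (no_types, lifting) ext)
qed

definition diag_matrix :: "('n::finite \<Rightarrow> real) \<Rightarrow> real^'n^'n"
  where "diag_matrix d = (\<chi> i j. if i = j then d i else 0)"

lemma diag_matrix_nth [simp]: "diag_matrix d $ i $ j = (if i = j then d i else 0)"
  by (simp add: diag_matrix_def)

lemma diag_matrix_mult_vec [simp]: "(diag_matrix d *v x) $ i = d i * x $ i"
  by (simp add: matrix_vector_mult_def diag_matrix_def if_distrib[of "\<lambda>z. z * _"] cong: if_cong)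

lemma matrix_inv_unique:
  assumes "A ** B = mat 1" "B ** A = mat 1"
  shows "matrix_inv A = B"
proof -
  have inv: "A ** matrix_inv A = mat 1"
    unfolding matrix_inv_def
    using someI[where P = "\<lambda>A'. A ** A' = mat 1 \<and> A' ** A = mat 1"] assms by blast
  have "matrix_inv A = (B ** A) ** matrix_inv A" by (simp add: assms)
  also have "\<dots> = B" by (simp add: matrix_mul_assoc[symmetric] inv)
  finally show ?thesis .
qed

lemma matrix_inv_diag:
  assumes "\<And>i. d i \<noteq> 0"
  shows "matrix_inv (diag_matrix d) = diag_matrix (\<lambda>i. 1 / d i)"
  by (rule matrix_inv_unique)
     (auto simp: vec_eq_iff matrix_matrix_mult_def mat_def if_distrib[of "\<lambda>z. z * _"]
       assms cong: if_cong)

text \<open>The inverse metric at \<open>x\<close> is diagonal too, so the sum over \<open>l\<close>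
  collapses to \<open>l = k\<close>. Diagonality is assumed at \<open>x\<close> only; the partial
  derivatives are those of the given entries.\<close>

lemma christoffel_diag:
  assumes "g x = diag_matrix d" "\<And>i. d i \<noteq> 0"
  shows "christoffel g k i j x =
    (partial_deriv i (\<lambda>y. g y $ j $ k) x + partial_deriv j (\<lambda>y. g y $ i $ k) x
      - partial_deriv k (\<lambda>y. g y $ i $ j) x) / (2 * d k)"
  by (simp add: christoffel_def assms matrix_inv_diag if_distrib[of "\<lambda>z. z * _"] cong: if_cong)

lemma christoffel_euclidean [simp]: "christoffel euclidean_metric k i j x = 0"
  by (simp add: christoffel_def)

text \<open>For \<open>E du^2 + H dv^2\<close> with coefficients depending on \<open>u\<close>
  alone, every derivative in direction 2 vanishes and few Christoffel symbols survive. Since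
  \<open>g\<close> is diagonal, only the component \<open>l = 1\<close> of the curvature tensor
  enters.\<close>

lemma gauss_curvature_revolution:
  fixes g :: "real^2 \<Rightarrow> real^2^2"
  assumes S: "open S" "x $ 1 \<in> S"
    and g: "\<And>y. y $ 1 \<in> S \<Longrightarrow> g y = diag_matrix (\<lambda>i. if i = 1 then E (y $ 1) else H (y $ 1))"
    and pos: "\<And>u. u \<in> S \<Longrightarrow> E u > 0" "\<And>u. u \<in> S \<Longrightarrow> H u > 0"
    and E': "\<And>u. u \<in> S \<Longrightarrow> (E has_real_derivative E' u) (at u)"
    and H': "\<And>u. u \<in> S \<Longrightarrow> (H has_real_derivative H' u) (at u)"
    and H'': "(H' has_real_derivative H'') (at (x $ 1))"
  shows "gauss_curvature g x =
    (let e = E (x $ 1); e' = E' (x $ 1); h = H (x $ 1); h' = H' (x $ 1)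
     in (- H'' / (2 * e) + h' * e' / (4 * e\<^sup>2) + h'\<^sup>2 / (4 * e * h)) / h)"
proof -
  note ev = eventually_nth_in[OF S(1), of _ 1]
  have evcomp: "partial_deriv l (\<lambda>z. g z $ i $ j) y =
      partial_deriv l (\<lambda>z. if i = j then if i = 1 then E (z $ 1) else H (z $ 1) else 0) y"
    if "y $ 1 \<in> S" for y l i j
    by (rule partial_deriv_cong) (rule eventually_mono[OF ev[OF that]], simp add: g)
  have tangent: "partial_deriv l (\<lambda>z. g z $ i $ j) y =
      (if l = 1 \<and> i = j then if i = 1 then E' (y $ 1) else H' (y $ 1) else 0)"
    if "y $ 1 \<in> S" for y l i j
    unfolding evcomp[OF that]
    using partial_deriv_coord[of E "E' (y $ 1)" y 1 l] partial_deriv_coord[of H "H' (y $ 1)" y 1 l]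
      E'[OF that] H'[OF that]
    by (cases "i = j"; cases "i = 1") (simp_all add: has_real_derivative_iff_has_vector_derivative)
  have chr: "christoffel g k i j y =
    (partial_deriv i (\<lambda>z. g z $ j $ k) y + partial_deriv j (\<lambda>z. g z $ i $ k) y
      - partial_deriv k (\<lambda>z. g z $ i $ j) y) / (2 * (if k = 1 then E (y $ 1) else H (y $ 1)))"
    if "y $ 1 \<in> S" for y k i j
    using pos[of "y $ 1"] that by (subst christoffel_diag[OF g])
      (auto simp: less_imp_neq[THEN not_sym])
  \<comment> \<open>These two symbols are needed on all of \<open>S\<close>, because the curvature
    tensor differentiates them; the remaining ones are needed only at \<open>x\<close>.\<close>
  have c122: "christoffel g 1 2 2 y = - H' (y $ 1) / (2 * E (y $ 1))" if "y $ 1 \<in> S" for y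
    by (simp add: chr tangent that)
  have c112: "christoffel g 1 1 2 y = 0" if "y $ 1 \<in> S" for y
    by (simp add: chr tangent that)
  have E0: "E (x $ 1) \<noteq> 0" "H (x $ 1) \<noteq> 0" using pos(1)[OF S(2)] pos(2)[OF S(2)] by simp_all
  have "((\<lambda>u. - H' u / (2 * E u)) has_real_derivative
      (- H'' * (2 * E (x $ 1)) + H' (x $ 1) * (2 * E' (x $ 1))) / (2 * E (x $ 1))\<^sup>2) (at (x $ 1))"
    using DERIV_divide[OF DERIV_minus[OF H''] DERIV_cmult[OF E'[OF S(2)], of 2]] E0
    by (simp add: power2_eq_square)
  then have d122: "partial_deriv 1 (christoffel g 1 2 2) x
      = (- H'' * (2 * E (x $ 1)) + H' (x $ 1) * (2 * E' (x $ 1))) / (2 * E (x $ 1))\<^sup>2"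
    using trans[OF partial_deriv_cong[OF eventually_mono[OF ev[OF S(2)] c122]]
      partial_deriv_coord[where f = "\<lambda>u. - H' u / (2 * E u)" and j = 1], where i1 = 1]
    by (simp add: has_real_derivative_iff_has_vector_derivative)
  have d112: "partial_deriv 2 (christoffel g 1 1 2) x = 0"
    by (rule trans[OF partial_deriv_cong[OF eventually_mono[OF ev[OF S(2)] c112]]
      partial_deriv_const])
  have c: "christoffel g 1 1 1 x = E' (x $ 1) / (2 * E (x $ 1))"
    "christoffel g 1 2 1 x = 0"  "christoffel g 2 2 2 x = 0"
    "christoffel g 2 1 2 x = H' (x $ 1) / (2 * H (x $ 1))"
    by (simp_all add: chr tangent S(2))
  show ?thesis
    unfolding gauss_curvature_def riemann_def sum_2 d122 d112 c c122[OF S(2)] c112[OF S(2)]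
      det_2 g[OF S(2)]
    using E0 by (simp add: Let_def field_simps power2_eq_square)
qed

section \<open>The constant radius surface in the Kerr slice\<close>

lemma vector_4 [simp]:
  "(vector [x, y, z, w] :: 'a::zero^4) $ 1 = x"
  "(vector [x, y, z, w] :: 'a^4) $ 2 = y"
  "(vector [x, y, z, w] :: 'a^4) $ 3 = z"
  "(vector [x, y, z, w] :: 'a^4) $ 4 = w"
  unfolding vector_def by simp_all

lemma partial_deriv_affine:
  assumes "\<And>s. f (x + s *\<^sub>R axis i 1) = f x + s *\<^sub>R v"
  shows "partial_deriv i f x = v"
  by (rule partial_deriv_eqI) (auto simp: assms intro!: derivative_eq_intros)

lemma partial_deriv_time_slice:
  "partial_deriv i (time_slice t) y = vector [0, axis i 1 $ 1, axis i 1 $ 2, axis i 1 $ 3]"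
  by (rule partial_deriv_affine) (simp add: time_slice_def vec_eq_iff forall_4)

lemma partial_deriv_radius_surface:
  "partial_deriv i (radius_surface r) p = vector [0, axis i 1 $ 1, axis i 1 $ 2]"
  by (rule partial_deriv_affine) (simp add: radius_surface_def vec_eq_iff forall_3)

lemma second_partial_radius_surface:
  "partial_deriv j (partial_deriv i (radius_surface r)) p = 0"
proof -
  have "partial_deriv i (radius_surface r) = (\<lambda>_. vector [0, axis i 1 $ 1, axis i 1 $ 2])"
    by (rule ext) (rule partial_deriv_radius_surface)
  then show ?thesis by simp
qed

lemma slice_metric_diag:
  "slice_metric m a t y = diag_matrix (\<lambda>i. if i = 1 then (kerr_R m a (y $ 1) (y $ 2))\<^sup>2
     else if i = 2 then kerr_Sigma2 a (y $ 1) (y $ 2) else kerr_H m a (y $ 1) (y $ 2))"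
  unfolding slice_metric_def induced_metric_def
  by (simp add: vec_eq_iff forall_3 partial_deriv_time_slice inner_vec_def matrix_vector_mult_def
      sum_4 kerr_metric_def Let_def time_slice_def axis_def)

lemma surface_metric_diag:
  "surface_metric m a t r p =
    diag_matrix (\<lambda>i. if i = 1 then kerr_Sigma2 a r (p $ 1) else kerr_H m a r (p $ 1))"
  unfolding surface_metric_def induced_metric_def slice_metric_diag
  by (simp add: vec_eq_iff forall_2 partial_deriv_radius_surface inner_vec_def
      sum_3 radius_surface_def axis_def)

lemma trace_matrix_inv_diag_mult:
  assumes "\<And>i. d i \<noteq> 0"
  shows "trace (matrix_inv (diag_matrix d) ** A) = (\<Sum>i\<in>UNIV. A $ i $ i / d i)"
  by (simp add: matrix_inv_diag assms trace_def matrix_matrix_mult_def if_distrib[of "\<lambda>z. z *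
    _"] cong: if_cong)

text \<open>The parametrisation is affine, so the covariant Hessian consists of Christoffel terms,
  and the normal \<open>R^-1 \<partial>_r\<close> selects those with upper index \<open>r\<close>.
  Lowering that index with \<open>R^2\<close> leaves \<open>\<partial>_r g_ii / (2 R)\<close> as the
  diagonal of the second fundamental form.\<close>

lemma mean_curvature_radius_surface:
  fixes p :: "real^2"
  assumes R: "kerr_R m a r (p $ 1) > 0"
    and pos: "kerr_Sigma2 a r (p $ 1) > 0" "kerr_H m a r (p $ 1) > 0"
    and S': "((\<lambda>\<rho>. kerr_Sigma2 a \<rho> (p $ 1)) has_real_derivative S') (at r)"
    and H': "((\<lambda>\<rho>. kerr_H m a \<rho> (p $ 1)) has_real_derivative H') (at r)"
  shows "mean_curvature (slice_metric m a t) (radius_surface r) (surface_normal m a r) p =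
    (S' / kerr_Sigma2 a r (p $ 1) + H' / kerr_H m a r (p $ 1)) / (2 * kerr_R m a r (p $ 1))"
proof -
  let ?x = "radius_surface r p"
  have x: "?x $ 1 = r" "?x $ 2 = p $ 1" by (simp_all add: radius_surface_def)
  have chain: "partial_deriv 1 (\<lambda>y. f (y $ 1) (y $ 2)) ?x = D"
    if "((\<lambda>\<rho>. f \<rho> (p $ 1)) has_real_derivative D) (at r)" for f :: "real \<Rightarrow> real \<Rightarrow> real" and D
  proof (rule partial_deriv_eqI)
    have "((\<lambda>s. f (r + s) (p $ 1)) has_real_derivative D) (at 0)"
      using that DERIV_shift[of "\<lambda>\<rho>. f \<rho> (p $ 1)" D 0 r] by (simp add: add.commute)
    then show "((\<lambda>s. f ((?x + s *\<^sub>R axis 1 1) $ 1) ((?x + s *\<^sub>R axis 1 1) $ 2))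
      has_vector_derivative D) (at 0)"
      by (simp add: x axis_def has_real_derivative_iff_has_vector_derivative)
  qed
  have chr: "christoffel (slice_metric m a t) 1 i j ?x =
    (partial_deriv i (\<lambda>y. slice_metric m a t y $ j $ 1) ?x +
      partial_deriv j (\<lambda>y. slice_metric m a t y $ i $ 1) ?x
      - partial_deriv 1 (\<lambda>y. slice_metric m a t y $ i $ j) ?x) / (2 * (kerr_R m a r (p $ 1))\<^sup>2)"
        for i j
    using R pos by (subst christoffel_diag[OF slice_metric_diag]) (auto simp: x)
  have c: "christoffel (slice_metric m a t) 1 2 2 ?x = - S' / (2 * (kerr_R m a r (p $ 1))\<^sup>2)"
    "christoffel (slice_metric m a t) 1 3 3 ?x = - H' / (2 * (kerr_R m a r (p $ 1))\<^sup>2)"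
    using chain[of "kerr_Sigma2 a", OF S'] chain[of "kerr_H m a", OF H']
      by (simp_all add: chr slice_metric_diag)
  \<comment> \<open>The indices 1 and 2 of the surface, for \<theta> and \<phi>, are the indices 2
    and 3 of the slice.\<close>
  have hess: "covariant_hessian (slice_metric m a t) (radius_surface r) i i p $ 1
      = (if i = 1 then - S' else - H') / (2 * (kerr_R m a r (p $ 1))\<^sup>2)" for i
    using c by (cases i rule: exhaust_2[THEN disjE])
       (auto simp: covariant_hessian_def second_partial_radius_surface
         partial_deriv_radius_surface sum_3 axis_def)
  have sff: "second_fundamental_form (slice_metric m a t) (radius_surface r)
    (surface_normal m a r) p $ i $ i
      = (if i = 1 then S' else H') / (2 * kerr_R m a r (p $ 1))" for i
    using R by (simp add: second_fundamental_form_def inner_vec_def sum_3 slice_metric_diag hess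
        surface_normal_def x power2_eq_square)
  have "mean_curvature (slice_metric m a t) (radius_surface r) (surface_normal m a r) p =
    trace (matrix_inv (surface_metric m a t r p) **
      second_fundamental_form (slice_metric m a t) (radius_surface r) (surface_normal m a r) p)"
    by (simp add: mean_curvature_def surface_metric_def)
  also have "\<dots> = (S' / kerr_Sigma2 a r (p $ 1) + H' / kerr_H m a r (p $ 1))
    / (2 * kerr_R m a r (p $ 1))"
    unfolding surface_metric_diag using pos R
    by (subst trace_matrix_inv_diag_mult) (auto simp: sum_2 sff field_simps)
  finally show ?thesis .
qed

section \<open>Surfaces of revolution\<close>

lemma has_vector_derivative_vec_iff:
  fixes f :: "real \<Rightarrow> real^'n::finite"
  shows "(f has_vector_derivative D) (at x) \<longleftrightarrow> (\<forall>i. ((\<lambda>s. f s $ i) has_real_derivative D $ i)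
    (at x))"
proof -
  have "(f has_vector_derivative D) (at x) \<longleftrightarrow>
      (\<forall>i. ((\<lambda>s. f s $ i) has_derivative (\<lambda>h. (h *\<^sub>R D) $ i)) (at x))"
    unfolding has_vector_derivative_def
    by (subst has_derivative_componentwise_within) (auto simp: Basis_vec_def inner_axis)
  then show ?thesis
    by (simp add: has_field_derivative_def mult.commute[of _ "D $ _"])
qed

text \<open>Derivative of \<open>rotate_axis \<alpha> x\<close> in \<open>\<alpha>\<close> at 0: a
  quarter turn of the horizontal part with the axial part dropped. Hence \<open>rot90 (c u)\<close>
  is tangent to the parallel through \<open>c u\<close>, and \<open>rot90 (rot90 (c u))\<close> is
  its second derivative.\<close>

definition rot90 :: "real^3 \<Rightarrow> real^3"
  where "rot90 x = vector [- x $ 2, x $ 1, 0]"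

lemma rotate_axis_nth [simp]:
  "rotate_axis \<alpha> x $ 1 = cos \<alpha> * x $ 1 - sin \<alpha> * x $ 2"
  "rotate_axis \<alpha> x $ 2 = sin \<alpha> * x $ 1 + cos \<alpha> * x $ 2"
  "rotate_axis \<alpha> x $ 3 = x $ 3"
  by (simp_all add: rotate_axis_def)

lemma rot90_nth [simp]: "rot90 x $ 1 = - x $ 2" "rot90 x $ 2 = x $ 1" "rot90 x $ 3 = 0"
  by (simp_all add: rot90_def)

lemma rotate_axis_0 [simp]: "rotate_axis 0 x = x"
  by (simp add: vec_eq_iff forall_3)

lemma inner_rotate_axis [simp]: "rotate_axis \<alpha> x \<bullet> rotate_axis \<alpha> y = x \<bullet> y"
proof -
  have "rotate_axis \<alpha> x \<bullet> rotate_axis \<alpha> y =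
      ((cos \<alpha>)\<^sup>2 + (sin \<alpha>)\<^sup>2) * (x $ 1 * y $ 1 + x $ 2 * y $ 2) + x $ 3 * y $ 3"
    unfolding inner_vec_def sum_3 rotate_axis_nth inner_real_def by algebra
  then show ?thesis by (simp add: inner_vec_def sum_3)
qed

lemma partial_deriv_revolution:
  fixes c :: "real \<Rightarrow> real^3"
  assumes "(c has_vector_derivative D) (at (p $ 1))"
  shows "partial_deriv (1::2) (\<lambda>p. rotate_axis (p $ 2) (c (p $ 1))) p = rotate_axis (p $ 2) D"
proof (rule partial_deriv_eqI)
  have "((\<lambda>s. c (p $ 1 + s)) has_vector_derivative D) (at 0)"
    using assms unfolding has_vector_derivative_vec_iff
    by (auto simp: DERIV_shift[of _ _ 0 "p $ 1", simplified] add.commute)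
  then show "((\<lambda>s. rotate_axis ((p + s *\<^sub>R axis 1 1) $ 2) (c ((p + s *\<^sub>R axis 1 1) $ 1)))
      has_vector_derivative rotate_axis (p $ 2) D) (at 0)"
    unfolding has_vector_derivative_vec_iff
    by (auto simp: forall_3 axis_def intro!: derivative_eq_intros)
qed

lemma partial_deriv_revolution_angle:
  fixes c :: "real \<Rightarrow> real^3"
  shows "partial_deriv (2::2) (\<lambda>p. rotate_axis (p $ 2) (c (p $ 1))) p = rotate_axis (p $ 2)
    (rot90 (c (p $ 1)))"
  by (rule partial_deriv_eqI) (auto simp: forall_3 has_vector_derivative_vec_iff axis_def
    intro!: derivative_eq_intros)

lemma induced_metric_revolution:
  fixes c :: "real \<Rightarrow> real^3" and p :: "real^2"
  assumes "(c has_vector_derivative D) (at (p $ 1))"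
  defines "u \<equiv> \<lambda>i::2. if i = 1 then D else rot90 (c (p $ 1))"
  shows "induced_metric euclidean_metric (\<lambda>p. rotate_axis (p $ 2) (c (p $ 1))) p =
    (\<chi> i j. u i \<bullet> u j)"
  by (simp add: induced_metric_def vec_eq_iff forall_2 u_def
      partial_deriv_revolution[OF assms(1)] partial_deriv_revolution_angle)

text \<open>As the induced metric is diagonal, the trace uses only the two pure second derivatives
  of the parametrisation; the mixed one does not occur.\<close>

lemma mean_curvature_revolution:
  fixes c c' :: "real \<Rightarrow> real^3" and p :: "real^2"
  assumes S: "open S" "p $ 1 \<in> S"
    and c': "\<And>u. u \<in> S \<Longrightarrow> (c has_vector_derivative c' u) (at u)"
    and c'': "(c' has_vector_derivative c'') (at (p $ 1))"
    and met: "induced_metric euclidean_metric (\<lambda>p. rotate_axis (p $ 2) (c (p $ 1))) p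
      = diag_matrix (\<lambda>i. if i = 1 then e else h)"
    and pos: "e > 0" "h > 0"
  shows "mean_curvature euclidean_metric (\<lambda>p. rotate_axis (p $ 2) (c (p $ 1))) N p =
    - (rotate_axis (p $ 2) c'' \<bullet> N p) / e
    - (rotate_axis (p $ 2) (rot90 (rot90 (c (p $ 1)))) \<bullet> N p) / h"
proof -
  let ?X = "\<lambda>p::real^2. rotate_axis (p $ 2) (c (p $ 1))"
  note ev = eventually_nth_in[OF S]
  have "partial_deriv 1 (partial_deriv 1 ?X) p = partial_deriv 1 (\<lambda>p. rotate_axis (p $ 2)
    (c' (p $ 1))) p"
    by (rule partial_deriv_cong, rule eventually_mono[OF ev])
      (simp add: partial_deriv_revolution c')
  also have "\<dots> = rotate_axis (p $ 2) c''" by (rule partial_deriv_revolution[OF c''])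
  finally have 1: "partial_deriv 1 (partial_deriv 1 ?X) p = rotate_axis (p $ 2) c''" .
  have "partial_deriv 2 ?X = (\<lambda>p. rotate_axis (p $ 2) ((\<lambda>u. rot90 (c u)) (p $ 1)))"
    by (rule ext) (simp add: partial_deriv_revolution_angle)
  then have 2: "partial_deriv 2 (partial_deriv 2 ?X) p = rotate_axis (p $ 2)
    (rot90 (rot90 (c (p $ 1))))"
    by (simp only: partial_deriv_revolution_angle[where c = "\<lambda>u. rot90 (c u)"])
  have sff: "second_fundamental_form euclidean_metric ?X N p $ i $ i =
    - (partial_deriv i (partial_deriv i ?X) p \<bullet> N p)" for i
    by (simp add: second_fundamental_form_def covariant_hessian_def zero_vec_def[symmetric])
  show ?thesis
    unfolding mean_curvature_def met using pos
    by (subst trace_matrix_inv_diag_mult) (auto simp: sum_2 sff 1 2)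
qed

text \<open>Pointwise content of an axially symmetric isometric immersion, stated for plain reals:
  \<open>c\<close>, \<open>d\<close>, \<open>dd\<close> are the profile curve and its two
  derivatives, \<open>n\<close> the normal, \<open>e\<close> and \<open>h\<close> the metric
  coefficients. Orthogonality of meridians and parallels makes the horizontal parts of
  \<open>d\<close> and \<open>n\<close> multiples of \<open>(c1, c2)\<close>, so the problem becomes
  planar. The last claim is the Gauss equation: the mean curvature times \<open>\<kappa>\<close> is
  \<open>\<kappa>\<^sup>2\<close> plus the intrinsic curvature.\<close>

lemma revolution_curvature_identities:
  fixes c1 c2 d1 d2 d3 dd1 dd2 dd3 n1 n2 n3 e e' h h' h'' :: real
  assumes h: "c1\<^sup>2 + c2\<^sup>2 = h" "h > 0" and e: "d1\<^sup>2 + d2\<^sup>2 + d3\<^sup>2 = e" "e > 0"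
    and h': "c1 * d1 + c2 * d2 = h' / 2"
    and h'': "d1\<^sup>2 + d2\<^sup>2 + c1 * dd1 + c2 * dd2 = h'' / 2"
    and e': "d1 * dd1 + d2 * dd2 + d3 * dd3 = e' / 2"
    and cd: "c1 * d2 = c2 * d1"
    and n: "n1\<^sup>2 + n2\<^sup>2 + n3\<^sup>2 = 1" "n2 * c1 = n1 * c2" "n1 * d1 + n2 * d2 + n3 * d3 = 0"
  defines "\<kappa> \<equiv> (n1 * c1 + n2 * c2) / h"
  shows "e - h'\<^sup>2 / (4 * h) = d3\<^sup>2"
    and "\<kappa>\<^sup>2 * h * e = d3\<^sup>2"
    and "d3 \<noteq> 0 \<Longrightarrow> (- (n1 * dd1 + n2 * dd2 + n3 * dd3) / e + \<kappa>) * \<kappa> =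
      \<kappa>\<^sup>2 + (- h'' / (2 * e) + h' * e' / (4 * e\<^sup>2) + h'\<^sup>2 / (4 * e * h)) / h"
proof -
  \<comment> \<open>Logarithmic derivative of the profile radius \<open>sqrt h\<close>.\<close>
  define \<mu> where "\<mu> = h' / (2 * h)"
  have h'\<mu>: "h' = 2 * h * \<mu>" using h by (simp add: \<mu>_def)
  have d1: "d1 = \<mu> * c1"
  proof -
    have "h * d1 = c1 * (c1 * d1 + c2 * d2)" using h(1)[symmetric] cd by algebra
    then show ?thesis using h(2) by (simp add: h' h'\<mu>)
  qed
  have d2: "d2 = \<mu> * c2"
  proof -
    have "h * d2 = c2 * (c1 * d1 + c2 * d2)" using h(1)[symmetric] cd by algebra
    then show ?thesis using h(2) by (simp add: h' h'\<mu>)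
  qed
  have n1: "n1 = \<kappa> * c1"
  proof -
    have "h * n1 = c1 * (n1 * c1 + n2 * c2)" using h(1)[symmetric] n(2) by algebra
    then show ?thesis using h(2) by (simp add: \<kappa>_def field_simps)
  qed
  have n2: "n2 = \<kappa> * c2"
  proof -
    have "h * n2 = c2 * (n1 * c1 + n2 * c2)" using h(1)[symmetric] n(2) by algebra
    then show ?thesis using h(2) by (simp add: \<kappa>_def field_simps)
  qed
  have e3: "d3\<^sup>2 = e - \<mu>\<^sup>2 * h"
    unfolding e(1)[symmetric] h(1)[symmetric] d1 d2 by (simp add: algebra_simps power2_eq_square)
  show "e - h'\<^sup>2 / (4 * h) = d3\<^sup>2"
    unfolding e3 h'\<mu> using h(2) by (simp add: power2_eq_square)
  have n3: "n3 * d3 = - \<kappa> * \<mu> * h" "n3\<^sup>2 = 1 - \<kappa>\<^sup>2 * h"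
    using n(1,3) h(1) unfolding n1 n2 d1 d2 by algebra+
  show *: "\<kappa>\<^sup>2 * h * e = d3\<^sup>2"
  proof -
    \<comment> \<open>Orthogonality of normal and tangent, squared, eliminates \<open>n3\<close> and
      \<open>d3\<close>; after that the terms
      \<open>\<kappa>\<^sup>2 * \<mu>\<^sup>2 * h\<^sup>2\<close> on the two sides cancel.\<close>
    have "(\<kappa> * \<mu> * h)\<^sup>2 = (1 - \<kappa>\<^sup>2 * h) * (e - \<mu>\<^sup>2 * h)"
      using n3 e3 by algebra
    then show ?thesis unfolding e3 by algebra
  qed
  define Q where "Q = c1 * dd1 + c2 * dd2"
  have Q: "Q = h'' / 2 - \<mu>\<^sup>2 * h"
    using h'' h(1) unfolding d1 d2 Q_def by algebra
  have D: "d3 * dd3 = e' / 2 - \<mu> * Q"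
    using e' unfolding d1 d2 Q_def by algebra
  assume nz: "d3 \<noteq> 0"
  \<comment> \<open>\<open>n3\<close> and \<open>dd3\<close> are known only through their products
    with \<open>d3\<close>. So the equation is first multiplied by \<open>d3\<^sup>2\<close>, which
    is cancelled afterwards.\<close>
  have "d3\<^sup>2 * (\<kappa> * n3 * dd3) = - \<kappa>\<^sup>2 * \<mu> * h * (d3 * dd3)"
    using n3(1) by algebra
  then have "d3\<^sup>2 * (e * (\<kappa> * n3 * dd3)) = d3\<^sup>2 * (- \<mu> * (d3 * dd3))"
    using * by algebra
  then have t: "e * (\<kappa> * n3 * dd3) = - \<mu> * (e' / 2 - \<mu> * Q)"
    unfolding D using nz by (simp only: mult_cancel_left power_eq_0_iff) simp
  have "\<kappa>\<^sup>2 * h * e = e - \<mu>\<^sup>2 * h" using * e3 by simp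
  then have "h * e * ((n1 * dd1 + n2 * dd2 + n3 * dd3) * \<kappa>) = (e - \<mu>\<^sup>2 * h)
    * Q - h * \<mu> * (e' / 2 - \<mu> * Q)"
    using t unfolding n1 n2 Q_def by algebra
  then have "h * e * ((n1 * dd1 + n2 * dd2 + n3 * dd3) * \<kappa>) = e * Q - h * \<mu> * e' / 2"
    by (simp add: algebra_simps power2_eq_square)
  then have **: "(n1 * dd1 + n2 * dd2 + n3 * dd3) * \<kappa> = (e * Q - h * \<mu> * e' / 2) / (h * e)"
    using h(2) e(2) by (simp add: field_simps)
  have "(- (n1 * dd1 + n2 * dd2 + n3 * dd3) / e + \<kappa>) * \<kappa> =
      \<kappa>\<^sup>2 - ((n1 * dd1 + n2 * dd2 + n3 * dd3) * \<kappa>) / e"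
  proof -
    have "(- z / e + \<kappa>) * \<kappa> = \<kappa>\<^sup>2 - (z * \<kappa>) / e" for z :: real
      by (simp add: algebra_simps power2_eq_square)
    then show ?thesis .
  qed
  also have "\<dots> = \<kappa>\<^sup>2 + (- h'' / (2 * e) + h' * e' / (4 * e\<^sup>2) + h'\<^sup>2 / (4 * e * h)) / h"
    unfolding ** h'\<mu> Q using h(2) e(2) by (simp add: field_simps power2_eq_square)
  finally show "(- (n1 * dd1 + n2 * dd2 + n3 * dd3) / e + \<kappa>) * \<kappa> =
      \<kappa>\<^sup>2 + (- h'' / (2 * e) + h' * e' / (4 * e\<^sup>2) + h'\<^sup>2 / (4 * e * h)) / h" .
qed

section \<open>Polynomial inequalities\<close>

text \<open>Below \<open>\<alpha> = a\<^sup>2\<close>, \<open>B = r\<^sup>2 + a\<^sup>2\<close>, \<open>D = \<Delta>\<close> and \<open>y = sin\<^sup>2 \<theta>\<close>. Then \<open>\<Sigma>\<^sup>2 = E\<close>,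
  \<open>H = y P / E\<close>, \<open>dH/dy = H1 / E\<^sup>2\<close>, \<open>K = K_num / (E\<^sup>3 P\<^sup>2)\<close> and
  \<open>\<Sigma>\<^sup>2 - H\<^sub>\<theta>\<^sup>2 / (4 H) = y W / (E\<^sup>3 P)\<close>, which is the square of the height derivative of an
  embedded profile curve. The sign of \<open>G\<close> is that of \<open>4 K - k\<^sup>2\<close>.\<close>

definition surf_E :: "real \<Rightarrow> real \<Rightarrow> real \<Rightarrow> real"
  where "surf_E \<alpha> B y = B - \<alpha> * y"

definition surf_P :: "real \<Rightarrow> real \<Rightarrow> real \<Rightarrow> real \<Rightarrow> real"
  where "surf_P \<alpha> B D y = B\<^sup>2 - D * \<alpha> * y"

definition surf_H1 :: "real \<Rightarrow> real \<Rightarrow> real \<Rightarrow> real \<Rightarrow> real"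
  where "surf_H1 \<alpha> B D y =
    B * (surf_E \<alpha> B y)\<^sup>2 + \<alpha> * (B - D) * y * (surf_E \<alpha> B y + B)"

definition surf_W :: "real \<Rightarrow> real \<Rightarrow> real \<Rightarrow> real \<Rightarrow> real"
  where "surf_W \<alpha> B D y = (surf_H1 \<alpha> B D y)\<^sup>2 - \<alpha> * D * (surf_E \<alpha> B y) ^ 4
    - \<alpha> * (B - D) * (surf_E \<alpha> B y + B) * (surf_H1 \<alpha> B D y + B * (surf_E \<alpha> B y)\<^sup>2)"

definition surf_K_num :: "real \<Rightarrow> real \<Rightarrow> real \<Rightarrow> real \<Rightarrow> real"
  where "surf_K_num \<alpha> B D y =
    surf_H1 \<alpha> B D y * (surf_P \<alpha> B D y * surf_E \<alpha> B y + (1 - y) * (\<alpha> * (B - D)) * B)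
    - (1 - y) * surf_P \<alpha> B D y * (4 * (\<alpha> * (B - D)) * B\<^sup>2 + \<alpha> * surf_H1 \<alpha> B D y)"

definition surf_G :: "real \<Rightarrow> real \<Rightarrow> real \<Rightarrow> real \<Rightarrow> real"
  where "surf_G \<alpha> B D y = 16 * (B - \<alpha>) * surf_K_num \<alpha> B D y
    - (4 * (B - \<alpha>) * B - (B - 2 * \<alpha> + D) * \<alpha> * y)\<^sup>2 * D * (surf_E \<alpha> B y)\<^sup>2"

text \<open>For a left-nested sum these rules ask for a positive first summand and nonnegative
  others. Accordingly each expansion below begins with a monomial that is positive for all
  admissible parameters; the other summands may vanish.\<close>

lemmas sum_prod_pos = add_pos_nonneg add_nonneg_nonneg mult_pos_pos mult_nonneg_nonneg
  zero_less_power zero_le_power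

lemmas surf_defs = surf_K_num_def surf_W_def surf_H1_def surf_P_def surf_E_def

text \<open>Origin of \<open>surf_W\<close>: the squared height derivative is
  \<open>(E^4 P - (1 - y) H1^2) / (E^3 P)\<close>. Its numerator vanishes at \<open>y = 0\<close>,
  where both terms are \<open>B^6\<close>, and \<open>surf_W\<close> is the polynomial quotient by
  \<open>y\<close>. The same identity later gives the normal its unit length.\<close>

lemma surf_W_identity:
  "y * surf_W \<alpha> B D y + (1 - y) * (surf_H1 \<alpha> B D y)\<^sup>2 = (surf_E \<alpha> B y) ^ 4 * surf_P \<alpha> B D y"
  unfolding surf_defs by algebra

text \<open>Likewise \<open>surf_K_num\<close> is the numerator of the intrinsic curvature formula
  after division by \<open>y\<close>. The extracted factor cancels the zero of \<open>H\<close> at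
  the poles, which makes the resulting expression for K regular there.\<close>

lemma surf_K_num_identity:
  "y * surf_K_num \<alpha> B D y =
    surf_H1 \<alpha> B D y * ((1 - y) * surf_H1 \<alpha> B D y - (1 - 2 * y) * surf_E \<alpha> B y * surf_P \<alpha> B D y)
    - (1 - y) * y * surf_P \<alpha> B D y * (4 * (\<alpha> * (B - D)) * B\<^sup>2 + \<alpha> * surf_H1 \<alpha> B D y)"
  unfolding surf_defs by algebra

text \<open>In the next lemmas \<open>c0, c1, \<dots>\<close> are, up to powers of \<open>B\<close>, the Bernstein coefficients in \<open>y\<close>.
  Here \<open>\<delta> = r\<^sup>2 - 3 \<alpha>\<close>, and \<open>D < 2 \<alpha> + \<delta> = r\<^sup>2 - \<alpha>\<close> because \<open>a \<le> m < r\<close>.\<close>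

lemma surf_K_num_pos_far:
  fixes \<alpha> \<delta> \<tau> y :: real
  assumes a: "0 \<le> \<alpha>" "0 < \<delta>" "0 \<le> \<tau>" "\<tau> < 1" and y: "0 \<le> y" "y \<le> 1"
  shows "0 < surf_K_num \<alpha> (4 * \<alpha> + \<delta>) ((2 * \<alpha> + \<delta>) * \<tau>) y"
proof -
  define B where "B = 4 * \<alpha> + \<delta>"
  define D where "D = (2 * \<alpha> + \<delta>) * \<tau>"
  have B: "0 < B" using a by (simp add: B_def)
  have t: "0 < 1 - \<tau>" using a by simp
  note nn = less_imp_le[OF a(2)] less_imp_le[OF t]
  define c0 where "c0 = 3 * \<alpha> * D + B ^ 2 - 4 * \<alpha> * B"
  define c1 where "c1 = 5 * \<alpha> ^ 2 * B * D + 3 * \<alpha> * B ^ 2 * D + 3 * B ^ 4 - 2 * \<alpha> ^ 2 * D ^ 2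
      - 9 * \<alpha> * B ^ 3"
  define c2 where "c2 = 9 * \<alpha> ^ 2 * B ^ 2 * D + 3 * B ^ 5 - 3 * \<alpha> ^ 3 * D ^ 2 - 6 * \<alpha> * B ^ 4
      - 3 * \<alpha> * B ^ 3 * D"
  define c3 where "c3 = \<alpha> ^ 4 * D ^ 2 + 4 * \<alpha> ^ 2 * B ^ 3 * D + 2 * \<alpha> ^ 2 * B ^ 2 * D ^ 2 + B ^ 6
      - \<alpha> ^ 3 * B ^ 2 * D - 3 * \<alpha> ^ 3 * B * D ^ 2 - \<alpha> * B ^ 5
      - 3 * \<alpha> * B ^ 4 * D"
  \<comment> \<open>Each coefficient is made homogeneous in \<open>\<tau>\<close> and
    \<open>1 - \<tau>\<close>, its degree being that in \<open>D\<close>; in this basis no negative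
    coefficient is left.\<close>
  have "c0 = \<delta> ^ 2 * (1 - \<tau>) + 6 * \<alpha> ^ 2 * \<tau> + 7 * \<alpha> * \<delta> * \<tau>
      + 4 * \<alpha> * \<delta> * (1 - \<tau>) + \<delta> ^ 2 * \<tau>"
    unfolding c0_def B_def D_def by algebra
  also have "0 < \<dots>"
    by (intro sum_prod_pos) (use a t nn in simp_all)
  finally have p0: "0 < c0" by simp
  have "c1 = 3 * \<delta> ^ 4 * (1 - \<tau>) ^ 2 + 320 * \<alpha> ^ 4 * \<tau> ^ 2
      + 520 * \<alpha> ^ 4 * \<tau> * (1 - \<tau>) + 192 * \<alpha> ^ 4 * (1 - \<tau>) ^ 2
      + 454 * \<alpha> ^ 3 * \<delta> * \<tau> ^ 2
      + 798 * \<alpha> ^ 3 * \<delta> * \<tau> * (1 - \<tau>)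
      + 336 * \<alpha> ^ 3 * \<delta> * (1 - \<tau>) ^ 2
      + 213 * \<alpha> ^ 2 * \<delta> ^ 2 * \<tau> ^ 2
      + 395 * \<alpha> ^ 2 * \<delta> ^ 2 * \<tau> * (1 - \<tau>)
      + 180 * \<alpha> ^ 2 * \<delta> ^ 2 * (1 - \<tau>) ^ 2
      + 42 * \<alpha> * \<delta> ^ 3 * \<tau> ^ 2
      + 81 * \<alpha> * \<delta> ^ 3 * \<tau> * (1 - \<tau>)
      + 39 * \<alpha> * \<delta> ^ 3 * (1 - \<tau>) ^ 2 + 3 * \<delta> ^ 4 * \<tau> ^ 2
      + 6 * \<delta> ^ 4 * \<tau> * (1 - \<tau>)"
    unfolding c1_def B_def D_def by algebra
  also have "0 < \<dots>"
    by (intro sum_prod_pos) (use a t nn in simp_all)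
  finally have p1: "0 < c1" by simp
  have "c2 = 3 * \<delta> ^ 5 * (1 - \<tau>) ^ 2 + 1428 * \<alpha> ^ 5 * \<tau> ^ 2
      + 2976 * \<alpha> ^ 5 * \<tau> * (1 - \<tau>) + 1536 * \<alpha> ^ 5 * (1 - \<tau>) ^ 2
      + 2100 * \<alpha> ^ 4 * \<delta> * \<tau> ^ 2
      + 4416 * \<alpha> ^ 4 * \<delta> * \<tau> * (1 - \<tau>)
      + 2304 * \<alpha> ^ 4 * \<delta> * (1 - \<tau>) ^ 2
      + 1215 * \<alpha> ^ 3 * \<delta> ^ 2 * \<tau> ^ 2
      + 2562 * \<alpha> ^ 3 * \<delta> ^ 2 * \<tau> * (1 - \<tau>)
      + 1344 * \<alpha> ^ 3 * \<delta> ^ 2 * (1 - \<tau>) ^ 2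
      + 351 * \<alpha> ^ 2 * \<delta> ^ 3 * \<tau> ^ 2
      + 735 * \<alpha> ^ 2 * \<delta> ^ 3 * \<tau> * (1 - \<tau>)
      + 384 * \<alpha> ^ 2 * \<delta> ^ 3 * (1 - \<tau>) ^ 2
      + 51 * \<alpha> * \<delta> ^ 4 * \<tau> ^ 2
      + 105 * \<alpha> * \<delta> ^ 4 * \<tau> * (1 - \<tau>)
      + 54 * \<alpha> * \<delta> ^ 4 * (1 - \<tau>) ^ 2 + 3 * \<delta> ^ 5 * \<tau> ^ 2
      + 6 * \<delta> ^ 5 * \<tau> * (1 - \<tau>)"
    unfolding c2_def B_def D_def by algebra
  also have "0 < \<dots>"
    by (intro sum_prod_pos) (use a t nn in simp_all)
  finally have p2: "0 < c2" by simp
  have "c3 = \<delta> ^ 6 * (1 - \<tau>) ^ 2 + 2100 * \<alpha> ^ 6 * \<tau> ^ 2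
      + 5088 * \<alpha> ^ 6 * \<tau> * (1 - \<tau>) + 3072 * \<alpha> ^ 6 * (1 - \<tau>) ^ 2
      + 3304 * \<alpha> ^ 5 * \<delta> * \<tau> ^ 2
      + 8032 * \<alpha> ^ 5 * \<delta> * \<tau> * (1 - \<tau>)
      + 4864 * \<alpha> ^ 5 * \<delta> * (1 - \<tau>) ^ 2
      + 2215 * \<alpha> ^ 4 * \<delta> ^ 2 * \<tau> ^ 2
      + 5334 * \<alpha> ^ 4 * \<delta> ^ 2 * \<tau> * (1 - \<tau>)
      + 3200 * \<alpha> ^ 4 * \<delta> ^ 2 * (1 - \<tau>) ^ 2
      + 812 * \<alpha> ^ 3 * \<delta> ^ 3 * \<tau> ^ 2
      + 1911 * \<alpha> ^ 3 * \<delta> ^ 3 * \<tau> * (1 - \<tau>)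
      + 1120 * \<alpha> ^ 3 * \<delta> ^ 3 * (1 - \<tau>) ^ 2
      + 172 * \<alpha> ^ 2 * \<delta> ^ 4 * \<tau> ^ 2
      + 390 * \<alpha> ^ 2 * \<delta> ^ 4 * \<tau> * (1 - \<tau>)
      + 220 * \<alpha> ^ 2 * \<delta> ^ 4 * (1 - \<tau>) ^ 2
      + 20 * \<alpha> * \<delta> ^ 5 * \<tau> ^ 2
      + 43 * \<alpha> * \<delta> ^ 5 * \<tau> * (1 - \<tau>)
      + 23 * \<alpha> * \<delta> ^ 5 * (1 - \<tau>) ^ 2 + \<delta> ^ 6 * \<tau> ^ 2
      + 2 * \<delta> ^ 6 * \<tau> * (1 - \<tau>)"
    unfolding c3_def B_def D_def by algebra
  also have "0 < \<dots>"
    by (intro sum_prod_pos) (use a t nn in simp_all)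
  finally have p3: "0 < c3" by simp
  have "surf_K_num \<alpha> B D y = B ^ 4 * c0 * ((1 - y) ^ 3) + B ^ 2 * c1 * ((1 - y) ^ 2 * y) +
    B * c2 * ((1 - y) * y ^ 2)
      + c3 * (y ^ 3)"
    unfolding surf_K_num_def c0_def c1_def c2_def c3_def unfolding surf_defs by algebra
  also have "0 < \<dots>"
  \<comment> \<open>Strictness comes from the first Bernstein term for \<open>y < 1\<close> and from
    the last one at \<open>y = 1\<close>, where all others vanish.\<close>
  proof (cases "y = 1")
    case True
    then show ?thesis using p3 B by simp
  next
    case False
    then have "0 < 1 - y" using y by simp
    with p0 B have "0 < B ^ 4 * c0 * ((1 - y) ^ 3)" by simp
    moreover have "0 \<le> B ^ 2 * c1 * ((1 - y) ^ 2 * y)" "0 \<le> B * c2 * ((1 - y) * y ^ 2)"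
      "0 \<le> c3 * (y ^ 3)"
      using p1 p2 p3 B y by simp_all
    ultimately show ?thesis by linarith
  qed
  finally show ?thesis unfolding B_def D_def .
qed

text \<open>For \<open>r\<^sup>2 \<le> 3 \<alpha>\<close> write \<open>r\<^sup>2 = (3 - d) \<alpha>\<close>. Then \<open>D / \<alpha>\<close> lies between \<open>d (4 - d) / 3\<close>, the value at
  which the curvature at the poles vanishes, and \<open>2 - d\<close>; \<open>\<tau>\<close> is its position in that interval.\<close>

lemma surf_K_num_pos_near:
  fixes \<alpha> d \<tau> y :: real
  assumes a: "0 < \<alpha>" "0 \<le> d" "d < 1" "0 < \<tau>" "\<tau> < 1" and y: "0 \<le> y" "y \<le> 1"
  shows "0 < surf_K_num \<alpha> (\<alpha> * (4 - d)) (\<alpha> * (d * (4 - d) / 3 * (1 - \<tau>) + (2 - d) * \<tau>)) y"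
proof -
  define B where "B = \<alpha> * (4 - d)"
  define D where "D = \<alpha> * (d * (4 - d) / 3 * (1 - \<tau>) + (2 - d) * \<tau>)"
  have B: "0 < B" using a by (simp add: B_def)
  have t: "0 < 1 - \<tau>" "0 < 1 - d" using a by simp_all
  note nn = less_imp_le[OF a(1)] less_imp_le[OF a(4)] less_imp_le[OF t(1)] less_imp_le[OF t(2)]
  define c0 where "c0 = 3 * \<alpha> * D + B ^ 2 - 4 * \<alpha> * B"
  define c1 where "c1 = 5 * \<alpha> ^ 2 * B * D + 3 * \<alpha> * B ^ 2 * D + 3 * B ^ 4 - 2 * \<alpha> ^ 2 * D ^ 2
      - 9 * \<alpha> * B ^ 3"
  define c2 where "c2 = 9 * \<alpha> ^ 2 * B ^ 2 * D + 3 * B ^ 5 - 3 * \<alpha> ^ 3 * D ^ 2 - 6 * \<alpha> * B ^ 4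
      - 3 * \<alpha> * B ^ 3 * D"
  define c3 where "c3 = \<alpha> ^ 4 * D ^ 2 + 4 * \<alpha> ^ 2 * B ^ 3 * D + 2 * \<alpha> ^ 2 * B ^ 2 * D ^ 2 + B ^ 6
      - \<alpha> ^ 3 * B ^ 2 * D - 3 * \<alpha> ^ 3 * B * D ^ 2 - \<alpha> * B ^ 5
      - 3 * \<alpha> * B ^ 4 * D"
  \<comment> \<open>Every summand carries the factor \<open>\<tau>\<close>: \<open>c0\<close> has
    the sign of the curvature at the poles, which vanishes at \<open>\<tau> = 0\<close>.\<close>
  have "c0 = 6 * \<alpha> ^ 2 * (1 - d) ^ 2 * \<tau> + 5 * \<alpha> ^ 2 * (1 - d) * d * \<tau>"
    unfolding c0_def B_def D_def by algebra
  also have "0 < \<dots>"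
    by (intro sum_prod_pos) (use a t nn in simp_all)
  finally have p0: "0 < c0" by simp
  \<comment> \<open>The multipliers 9, 3 and 9 clear the denominators brought in by
    \<open>d * (4 - d) / 3\<close>.\<close>
  have "9 * c1 = 1728 * \<alpha> ^ 4 * (1 - d) ^ 4 * (1 - \<tau>) ^ 2
      + 2880 * \<alpha> ^ 4 * (1 - d) ^ 4 * \<tau> ^ 2
      + 4680 * \<alpha> ^ 4 * (1 - d) ^ 4 * \<tau> * (1 - \<tau>)
      + 7434 * \<alpha> ^ 4 * (1 - d) ^ 3 * d * \<tau> ^ 2
      + 12258 * \<alpha> ^ 4 * (1 - d) ^ 3 * d * \<tau> * (1 - \<tau>)
      + 4704 * \<alpha> ^ 4 * (1 - d) ^ 3 * d * (1 - \<tau>) ^ 2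
      + 6939 * \<alpha> ^ 4 * (1 - d) ^ 2 * d ^ 2 * \<tau> ^ 2
      + 11769 * \<alpha> ^ 4 * (1 - d) ^ 2 * d ^ 2 * \<tau> * (1 - \<tau>)
      + 4780 * \<alpha> ^ 4 * (1 - d) ^ 2 * d ^ 2 * (1 - \<tau>) ^ 2
      + 2718 * \<alpha> ^ 4 * (1 - d) * d ^ 3 * \<tau> ^ 2
      + 4866 * \<alpha> ^ 4 * (1 - d) * d ^ 3 * \<tau> * (1 - \<tau>)
      + 2148 * \<alpha> ^ 4 * (1 - d) * d ^ 3 * (1 - \<tau>) ^ 2
      + 360 * \<alpha> ^ 4 * d ^ 4 * \<tau> ^ 2
      + 720 * \<alpha> ^ 4 * d ^ 4 * \<tau> * (1 - \<tau>)
      + 360 * \<alpha> ^ 4 * d ^ 4 * (1 - \<tau>) ^ 2"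
    unfolding c1_def B_def D_def by algebra
  also have "0 < \<dots>"
    by (intro sum_prod_pos) (use a t nn in simp_all)
  finally have p1: "0 < c1" by simp
  have "3 * c2 = 4608 * \<alpha> ^ 5 * (1 - d) ^ 5 * (1 - \<tau>) ^ 2
      + 4284 * \<alpha> ^ 5 * (1 - d) ^ 5 * \<tau> ^ 2
      + 8928 * \<alpha> ^ 5 * (1 - d) ^ 5 * \<tau> * (1 - \<tau>)
      + 15120 * \<alpha> ^ 5 * (1 - d) ^ 4 * d * \<tau> ^ 2
      + 31152 * \<alpha> ^ 5 * (1 - d) ^ 4 * d * \<tau> * (1 - \<tau>)
      + 15936 * \<alpha> ^ 5 * (1 - d) ^ 4 * d * (1 - \<tau>) ^ 2
      + 21285 * \<alpha> ^ 5 * (1 - d) ^ 3 * d ^ 2 * \<tau> ^ 2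
      + 43386 * \<alpha> ^ 5 * (1 - d) ^ 3 * d ^ 2 * \<tau> * (1 - \<tau>)
      + 22016 * \<alpha> ^ 5 * (1 - d) ^ 3 * d ^ 2 * (1 - \<tau>) ^ 2
      + 14922 * \<alpha> ^ 5 * (1 - d) ^ 2 * d ^ 3 * \<tau> ^ 2
      + 30135 * \<alpha> ^ 5 * (1 - d) ^ 2 * d ^ 3 * \<tau> * (1 - \<tau>)
      + 15188 * \<alpha> ^ 5 * (1 - d) ^ 2 * d ^ 3 * (1 - \<tau>) ^ 2
      + 5202 * \<alpha> ^ 5 * (1 - d) * d ^ 4 * \<tau> ^ 2
      + 10434 * \<alpha> ^ 5 * (1 - d) * d ^ 4 * \<tau> * (1 - \<tau>)
      + 5232 * \<alpha> ^ 5 * (1 - d) * d ^ 4 * (1 - \<tau>) ^ 2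
      + 720 * \<alpha> ^ 5 * d ^ 5 * \<tau> ^ 2
      + 1440 * \<alpha> ^ 5 * d ^ 5 * \<tau> * (1 - \<tau>)
      + 720 * \<alpha> ^ 5 * d ^ 5 * (1 - \<tau>) ^ 2"
    unfolding c2_def B_def D_def by algebra
  also have "0 < \<dots>"
    by (intro sum_prod_pos) (use a t nn in simp_all)
  finally have p2: "0 < c2" by simp
  have "9 * c3 = 27648 * \<alpha> ^ 6 * (1 - d) ^ 6 * (1 - \<tau>) ^ 2
      + 18900 * \<alpha> ^ 6 * (1 - d) ^ 6 * \<tau> ^ 2
      + 45792 * \<alpha> ^ 6 * (1 - d) ^ 6 * \<tau> * (1 - \<tau>)
      + 83664 * \<alpha> ^ 6 * (1 - d) ^ 5 * d * \<tau> ^ 2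
      + 197136 * \<alpha> ^ 6 * (1 - d) ^ 5 * d * \<tau> * (1 - \<tau>)
      + 115776 * \<alpha> ^ 6 * (1 - d) ^ 5 * d * (1 - \<tau>) ^ 2
      + 154755 * \<alpha> ^ 6 * (1 - d) ^ 4 * d ^ 2 * \<tau> ^ 2
      + 354018 * \<alpha> ^ 6 * (1 - d) ^ 4 * d ^ 2 * \<tau> * (1 - \<tau>)
      + 201888 * \<alpha> ^ 6 * (1 - d) ^ 4 * d ^ 2 * (1 - \<tau>) ^ 2
      + 153072 * \<alpha> ^ 6 * (1 - d) ^ 3 * d ^ 3 * \<tau> ^ 2
      + 339399 * \<alpha> ^ 6 * (1 - d) ^ 3 * d ^ 3 * \<tau> * (1 - \<tau>)
      + 187652 * \<alpha> ^ 6 * (1 - d) ^ 3 * d ^ 3 * (1 - \<tau>) ^ 2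
      + 85374 * \<alpha> ^ 6 * (1 - d) ^ 2 * d ^ 4 * \<tau> ^ 2
      + 183180 * \<alpha> ^ 6 * (1 - d) ^ 2 * d ^ 4 * \<tau> * (1 - \<tau>)
      + 98056 * \<alpha> ^ 6 * (1 - d) ^ 2 * d ^ 4 * (1 - \<tau>) ^ 2
      + 25452 * \<alpha> ^ 6 * (1 - d) * d ^ 5 * \<tau> ^ 2
      + 52764 * \<alpha> ^ 6 * (1 - d) * d ^ 5 * \<tau> * (1 - \<tau>)
      + 27312 * \<alpha> ^ 6 * (1 - d) * d ^ 5 * (1 - \<tau>) ^ 2
      + 3168 * \<alpha> ^ 6 * d ^ 6 * \<tau> ^ 2
      + 6336 * \<alpha> ^ 6 * d ^ 6 * \<tau> * (1 - \<tau>)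
      + 3168 * \<alpha> ^ 6 * d ^ 6 * (1 - \<tau>) ^ 2"
    unfolding c3_def B_def D_def by algebra
  also have "0 < \<dots>"
    by (intro sum_prod_pos) (use a t nn in simp_all)
  finally have p3: "0 < c3" by simp
  have "surf_K_num \<alpha> B D y = B ^ 4 * c0 * ((1 - y) ^ 3) + B ^ 2 * c1 * ((1 - y) ^ 2 * y) +
    B * c2 * ((1 - y) * y ^ 2)
      + c3 * (y ^ 3)"
    unfolding surf_K_num_def c0_def c1_def c2_def c3_def unfolding surf_defs by algebra
  also have "0 < \<dots>"
  proof (cases "y = 1")
    case True
    then show ?thesis using p3 B by simp
  next
    case False
    then have "0 < 1 - y" using y by simp
    with p0 B have "0 < B ^ 4 * c0 * ((1 - y) ^ 3)" by simp
    moreover have "0 \<le> B ^ 2 * c1 * ((1 - y) ^ 2 * y)" "0 \<le> B * c2 * ((1 - y) * y ^ 2)"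
      "0 \<le> c3 * (y ^ 3)"
      using p1 p2 p3 B y by simp_all
    ultimately show ?thesis by linarith
  qed
  finally show ?thesis unfolding B_def D_def .
qed

text \<open>The coefficient \<open>c0\<close> is the same as that of \<open>surf_K_num\<close>: the
  two polynomials agree at the poles, where both principal curvatures coincide.\<close>

lemma surf_W_pos:
  fixes \<alpha> \<delta> \<tau> y :: real
  assumes a: "0 \<le> \<alpha>" "0 < \<delta>" "0 \<le> \<tau>" "\<tau> < 1" and y: "0 \<le> y" "y \<le> 1"
  shows "0 < surf_W \<alpha> (4 * \<alpha> + \<delta>) ((2 * \<alpha> + \<delta>) * \<tau>) y"
proof -
  define B where "B = 4 * \<alpha> + \<delta>"
  define D where "D = (2 * \<alpha> + \<delta>) * \<tau>"
  have B: "0 < B" using a by (simp add: B_def)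
  have t: "0 < 1 - \<tau>" using a by simp
  note nn = less_imp_le[OF a(2)] less_imp_le[OF t]
  define c0 where "c0 = 3 * \<alpha> * D + B ^ 2 - 4 * \<alpha> * B"
  define c1 where "c1 = 6 * \<alpha> ^ 2 * B ^ 2 + 2 * \<alpha> ^ 2 * B * D + 8 * \<alpha> * B ^ 2 * D + 4 * B ^ 4
      - 4 * \<alpha> ^ 2 * D ^ 2 - 16 * \<alpha> * B ^ 3"
  define c2 where "c2 = 4 * \<alpha> ^ 3 * D ^ 2 + 18 * \<alpha> ^ 2 * B ^ 3 + 8 * \<alpha> ^ 2 * B ^ 2 * D
      + 6 * \<alpha> * B ^ 3 * D + 6 * B ^ 5 - 4 * \<alpha> ^ 3 * B ^ 2
      - 6 * \<alpha> ^ 3 * B * D - 8 * \<alpha> ^ 2 * B * D ^ 2 - 24 * \<alpha> * B ^ 4"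
  define c3 where "c3 = \<alpha> ^ 4 * B ^ 2 + 4 * \<alpha> ^ 4 * B * D + 4 * \<alpha> ^ 3 * B * D ^ 2
      + 18 * \<alpha> ^ 2 * B ^ 4 + 10 * \<alpha> ^ 2 * B ^ 3 * D + 4 * B ^ 6
      - \<alpha> ^ 4 * D ^ 2 - 8 * \<alpha> ^ 3 * B ^ 3 - 12 * \<alpha> ^ 3 * B ^ 2 * D
      - 4 * \<alpha> ^ 2 * B ^ 2 * D ^ 2 - 16 * \<alpha> * B ^ 5"
  define c4 where "c4 = \<alpha> ^ 4 * B ^ 2 + 4 * \<alpha> ^ 4 * B * D + 6 * \<alpha> ^ 2 * B ^ 4
      + 4 * \<alpha> ^ 2 * B ^ 3 * D + B ^ 6 - \<alpha> ^ 5 * D - 4 * \<alpha> ^ 3 * B ^ 3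
      - 6 * \<alpha> ^ 3 * B ^ 2 * D - 4 * \<alpha> * B ^ 5 - \<alpha> * B ^ 4 * D"
  have "c0 = \<delta> ^ 2 * (1 - \<tau>) + 6 * \<alpha> ^ 2 * \<tau> + 7 * \<alpha> * \<delta> * \<tau>
      + 4 * \<alpha> * \<delta> * (1 - \<tau>) + \<delta> ^ 2 * \<tau>"
    unfolding c0_def B_def D_def by algebra
  also have "0 < \<dots>"
    by (intro sum_prod_pos) (use a t nn in simp_all)
  finally have p0: "0 < c0" by simp
  have "c1 = 4 * \<delta> ^ 4 * (1 - \<tau>) ^ 2 + 352 * \<alpha> ^ 4 * \<tau> ^ 2
      + 464 * \<alpha> ^ 4 * \<tau> * (1 - \<tau>) + 96 * \<alpha> ^ 4 * (1 - \<tau>) ^ 2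
      + 556 * \<alpha> ^ 3 * \<delta> * \<tau> ^ 2
      + 876 * \<alpha> ^ 3 * \<delta> * \<tau> * (1 - \<tau>)
      + 304 * \<alpha> ^ 3 * \<delta> * (1 - \<tau>) ^ 2
      + 276 * \<alpha> ^ 2 * \<delta> ^ 2 * \<tau> ^ 2
      + 478 * \<alpha> ^ 2 * \<delta> ^ 2 * \<tau> * (1 - \<tau>)
      + 198 * \<alpha> ^ 2 * \<delta> ^ 2 * (1 - \<tau>) ^ 2
      + 56 * \<alpha> * \<delta> ^ 3 * \<tau> ^ 2
      + 104 * \<alpha> * \<delta> ^ 3 * \<tau> * (1 - \<tau>)
      + 48 * \<alpha> * \<delta> ^ 3 * (1 - \<tau>) ^ 2 + 4 * \<delta> ^ 4 * \<tau> ^ 2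
      + 8 * \<delta> ^ 4 * \<tau> * (1 - \<tau>)"
    unfolding c1_def B_def D_def by algebra
  also have "0 < \<dots>"
    by (intro sum_prod_pos) (use a t nn in simp_all)
  finally have p1: "0 < c1" by simp
  have "c2 = 6 * \<delta> ^ 5 * (1 - \<tau>) ^ 2 + 1952 * \<alpha> ^ 5 * \<tau> ^ 2
      + 3152 * \<alpha> ^ 5 * \<tau> * (1 - \<tau>) + 1088 * \<alpha> ^ 5 * (1 - \<tau>) ^ 2
      + 3404 * \<alpha> ^ 4 * \<delta> * \<tau> ^ 2
      + 5916 * \<alpha> ^ 4 * \<delta> * \<tau> * (1 - \<tau>)
      + 2368 * \<alpha> ^ 4 * \<delta> * (1 - \<tau>) ^ 2
      + 2194 * \<alpha> ^ 3 * \<delta> ^ 2 * \<tau> ^ 2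
      + 4002 * \<alpha> ^ 3 * \<delta> ^ 2 * \<tau> * (1 - \<tau>)
      + 1748 * \<alpha> ^ 3 * \<delta> ^ 2 * (1 - \<tau>) ^ 2
      + 678 * \<alpha> ^ 2 * \<delta> ^ 3 * \<tau> ^ 2
      + 1280 * \<alpha> ^ 2 * \<delta> ^ 3 * \<tau> * (1 - \<tau>)
      + 594 * \<alpha> ^ 2 * \<delta> ^ 3 * (1 - \<tau>) ^ 2
      + 102 * \<alpha> * \<delta> ^ 4 * \<tau> ^ 2
      + 198 * \<alpha> * \<delta> ^ 4 * \<tau> * (1 - \<tau>)
      + 96 * \<alpha> * \<delta> ^ 4 * (1 - \<tau>) ^ 2 + 6 * \<delta> ^ 5 * \<tau> ^ 2
      + 12 * \<delta> ^ 5 * \<tau> * (1 - \<tau>)"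
    unfolding c2_def B_def D_def by algebra
  also have "0 < \<dots>"
    by (intro sum_prod_pos) (use a t nn in simp_all)
  finally have p2: "0 < c2" by simp
  have "c3 = 4 * \<delta> ^ 6 * (1 - \<tau>) ^ 2 + 4844 * \<alpha> ^ 6 * \<tau> ^ 2
      + 9152 * \<alpha> ^ 6 * \<tau> * (1 - \<tau>) + 4112 * \<alpha> ^ 6 * (1 - \<tau>) ^ 2
      + 9260 * \<alpha> ^ 5 * \<delta> * \<tau> ^ 2
      + 17896 * \<alpha> ^ 5 * \<delta> * \<tau> * (1 - \<tau>)
      + 8328 * \<alpha> ^ 5 * \<delta> * (1 - \<tau>) ^ 2
      + 7180 * \<alpha> ^ 4 * \<delta> ^ 2 * \<tau> ^ 2
      + 14110 * \<alpha> ^ 4 * \<delta> ^ 2 * \<tau> * (1 - \<tau>)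
      + 6753 * \<alpha> ^ 4 * \<delta> ^ 2 * (1 - \<tau>) ^ 2
      + 2924 * \<alpha> ^ 3 * \<delta> ^ 3 * \<tau> ^ 2
      + 5808 * \<alpha> ^ 3 * \<delta> ^ 3 * \<tau> * (1 - \<tau>)
      + 2840 * \<alpha> ^ 3 * \<delta> ^ 3 * (1 - \<tau>) ^ 2
      + 664 * \<alpha> ^ 2 * \<delta> ^ 4 * \<tau> ^ 2
      + 1326 * \<alpha> ^ 2 * \<delta> ^ 4 * \<tau> * (1 - \<tau>)
      + 658 * \<alpha> ^ 2 * \<delta> ^ 4 * (1 - \<tau>) ^ 2
      + 80 * \<alpha> * \<delta> ^ 5 * \<tau> ^ 2
      + 160 * \<alpha> * \<delta> ^ 5 * \<tau> * (1 - \<tau>)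
      + 80 * \<alpha> * \<delta> ^ 5 * (1 - \<tau>) ^ 2 + 4 * \<delta> ^ 6 * \<tau> ^ 2
      + 8 * \<delta> ^ 6 * \<tau> * (1 - \<tau>)"
    unfolding c3_def B_def D_def by algebra
  also have "0 < \<dots>"
    by (intro sum_prod_pos) (use a t nn in simp_all)
  finally have p3: "0 < c3" by simp
  have "c4 = \<delta> ^ 6 * (1 - \<tau>) + 1134 * \<alpha> ^ 6 * \<tau> + 1296 * \<alpha> ^ 6 * (1 - \<tau>)
      + 2079 * \<alpha> ^ 5 * \<delta> * \<tau> + 2376 * \<alpha> ^ 5 * \<delta> * (1 - \<tau>)
      + 1593 * \<alpha> ^ 4 * \<delta> ^ 2 * \<tau>
      + 1809 * \<alpha> ^ 4 * \<delta> ^ 2 * (1 - \<tau>)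
      + 654 * \<alpha> ^ 3 * \<delta> ^ 3 * \<tau>
      + 732 * \<alpha> ^ 3 * \<delta> ^ 3 * (1 - \<tau>)
      + 152 * \<alpha> ^ 2 * \<delta> ^ 4 * \<tau>
      + 166 * \<alpha> ^ 2 * \<delta> ^ 4 * (1 - \<tau>) + 19 * \<alpha> * \<delta> ^ 5 * \<tau>
      + 20 * \<alpha> * \<delta> ^ 5 * (1 - \<tau>) + \<delta> ^ 6 * \<tau>"
    unfolding c4_def B_def D_def by algebra
  also have "0 < \<dots>"
    by (intro sum_prod_pos) (use a t nn in simp_all)
  finally have p4: "0 < c4" by simp
  have "surf_W \<alpha> B D y = B ^ 4 * c0 * ((1 - y) ^ 4) + B ^ 2 * c1 * ((1 - y) ^ 3 * y) +
    B * c2 * ((1 - y) ^ 2 * y ^ 2)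
      + c3 * ((1 - y) * y ^ 3) + c4 * (y ^ 4)"
    unfolding surf_W_def c0_def c1_def c2_def c3_def c4_def unfolding surf_defs by algebra
  also have "0 < \<dots>"
  proof (cases "y = 1")
    case True
    then show ?thesis using p4 B by simp
  next
    case False
    then have "0 < 1 - y" using y by simp
    with p0 B have "0 < B ^ 4 * c0 * ((1 - y) ^ 4)" by simp
    moreover have "0 \<le> B ^ 2 * c1 * ((1 - y) ^ 3 * y)" "0 \<le> B * c2 * ((1 - y) ^ 2 * y ^ 2)"
      "0 \<le> c3 * ((1 - y) * y ^ 3)" "0 \<le> c4 * (y ^ 4)"
      using p1 p2 p3 p4 B y by simp_all
    ultimately show ?thesis by linarith
  qed
  finally show ?thesis unfolding B_def D_def .
qed

text \<open>The inequality \<open>4 K > k^2\<close> reads \<open>16 K_num > Pr^2 D E^2\<close>, with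
  \<open>Pr\<close> the r-derivative of \<open>P\<close>. Multiplying by
  \<open>r^2 = B - \<alpha>\<close> removes \<open>r\<close> and \<open>m\<close>, because
  \<open>r * Pr\<close> is a polynomial in \<open>\<alpha>\<close>, \<open>B\<close>,
  \<open>D\<close> and \<open>y\<close>.\<close>

lemma surf_G_pos:
  fixes \<alpha> \<delta> \<tau> y :: real
  assumes a: "0 \<le> \<alpha>" "0 < \<delta>" "0 \<le> \<tau>" "\<tau> < 1" and y: "0 \<le> y" "y \<le> 1"
  shows "0 < surf_G \<alpha> (4 * \<alpha> + \<delta>) ((2 * \<alpha> + \<delta>) * \<tau>) y"
proof -
  define B where "B = 4 * \<alpha> + \<delta>"
  define D where "D = (2 * \<alpha> + \<delta>) * \<tau>"
  have B: "0 < B" using a by (simp add: B_def)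
  have t: "0 < 1 - \<tau>" using a by simp
  note nn = less_imp_le[OF a(2)] less_imp_le[OF t]
  define c0 where "c0 = 64 * \<alpha> ^ 2 * B + 80 * \<alpha> * B * D + 16 * B ^ 3 - 64 * \<alpha> ^ 2 * D
      - 80 * \<alpha> * B ^ 2 - 16 * B ^ 2 * D"
  define c1 where "c1 = 32 * \<alpha> ^ 3 * D ^ 2 + 208 * \<alpha> ^ 2 * B ^ 3 + 264 * \<alpha> * B ^ 3 * D
      + 8 * \<alpha> * B ^ 2 * D ^ 2 + 64 * B ^ 5 - 32 * \<alpha> ^ 3 * B * D
      - 168 * \<alpha> ^ 2 * B ^ 2 * D - 40 * \<alpha> ^ 2 * B * D ^ 2 - 272 * \<alpha> * B ^ 4
      - 64 * B ^ 4 * D"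
  define c2 where "c2 = 48 * \<alpha> ^ 4 * D ^ 2 + 4 * \<alpha> ^ 3 * B ^ 2 * D + 4 * \<alpha> ^ 3 * B * D ^ 2
      + 240 * \<alpha> ^ 2 * B ^ 4 + 312 * \<alpha> * B ^ 4 * D + 24 * \<alpha> * B ^ 3 * D ^ 2
      + 96 * B ^ 6 - 52 * \<alpha> ^ 4 * B * D - 169 * \<alpha> ^ 2 * B ^ 3 * D
      - 74 * \<alpha> ^ 2 * B ^ 2 * D ^ 2 - \<alpha> ^ 2 * B * D ^ 3 - 336 * \<alpha> * B ^ 5
      - 96 * B ^ 5 * D"
  define c3 where "c3 = 24 * \<alpha> ^ 5 * B * D + 96 * \<alpha> ^ 4 * B * D ^ 2 + 98 * \<alpha> ^ 3 * B ^ 3 * D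
      + 2 * \<alpha> ^ 3 * B * D ^ 3 + 112 * \<alpha> ^ 2 * B ^ 5 + 152 * \<alpha> * B ^ 5 * D
      + 24 * \<alpha> * B ^ 4 * D ^ 2 + 64 * B ^ 7 - 16 * \<alpha> ^ 5 * D ^ 2
      - 120 * \<alpha> ^ 4 * B ^ 2 * D - 76 * \<alpha> ^ 3 * B ^ 2 * D ^ 2
      - 90 * \<alpha> ^ 2 * B ^ 4 * D - 28 * \<alpha> ^ 2 * B ^ 3 * D ^ 2
      - 2 * \<alpha> ^ 2 * B ^ 2 * D ^ 3 - 176 * \<alpha> * B ^ 6 - 64 * B ^ 6 * D"
  define c4 where "c4 = 28 * \<alpha> ^ 5 * B * D + 46 * \<alpha> ^ 4 * B * D ^ 2 + 62 * \<alpha> ^ 3 * B ^ 3 * D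
      + 2 * \<alpha> ^ 3 * B * D ^ 3 + 16 * \<alpha> ^ 2 * B ^ 5
      + 6 * \<alpha> ^ 2 * B ^ 3 * D ^ 2 + 24 * \<alpha> * B ^ 5 * D
      + 8 * \<alpha> * B ^ 4 * D ^ 2 + 16 * B ^ 7 - 4 * \<alpha> ^ 6 * D
      - 12 * \<alpha> ^ 5 * D ^ 2 - 69 * \<alpha> ^ 4 * B ^ 2 * D - \<alpha> ^ 4 * D ^ 3
      - 48 * \<alpha> ^ 3 * B ^ 2 * D ^ 2 - 25 * \<alpha> ^ 2 * B ^ 4 * D
      - \<alpha> ^ 2 * B ^ 2 * D ^ 3 - 32 * \<alpha> * B ^ 6 - 16 * B ^ 6 * D"
  \<comment> \<open>All summands contain \<open>\<delta>\<close>: at the pole the comparison turns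
    into an equality exactly when \<open>r^2 = 3 \<alpha>\<close>.\<close>
  have "c0 = 16 * \<delta> ^ 3 * (1 - \<tau>) + 96 * \<alpha> ^ 2 * \<delta> * \<tau>
      + 192 * \<alpha> ^ 2 * \<delta> * (1 - \<tau>) + 32 * \<alpha> * \<delta> ^ 2 * \<tau>
      + 112 * \<alpha> * \<delta> ^ 2 * (1 - \<tau>)"
    unfolding c0_def B_def D_def by algebra
  also have "0 < \<dots>"
    by (intro sum_prod_pos) (use a t nn in simp_all)
  finally have p0: "0 < c0" by simp
  have "c1 = 64 * \<delta> ^ 5 * (1 - \<tau>) ^ 2 + 4608 * \<alpha> ^ 5 * \<tau> ^ 2
      + 13824 * \<alpha> ^ 5 * \<tau> * (1 - \<tau>) + 9216 * \<alpha> ^ 5 * (1 - \<tau>) ^ 2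
      + 9888 * \<alpha> ^ 4 * \<delta> * \<tau> ^ 2
      + 32064 * \<alpha> ^ 4 * \<delta> * \<tau> * (1 - \<tau>)
      + 22272 * \<alpha> ^ 4 * \<delta> * (1 - \<tau>) ^ 2
      + 6096 * \<alpha> ^ 3 * \<delta> ^ 2 * \<tau> ^ 2
      + 23312 * \<alpha> ^ 3 * \<delta> ^ 2 * \<tau> * (1 - \<tau>)
      + 17344 * \<alpha> ^ 3 * \<delta> ^ 2 * (1 - \<tau>) ^ 2
      + 1488 * \<alpha> ^ 2 * \<delta> ^ 3 * \<tau> ^ 2
      + 7528 * \<alpha> ^ 2 * \<delta> ^ 3 * \<tau> * (1 - \<tau>)
      + 6096 * \<alpha> ^ 2 * \<delta> ^ 3 * (1 - \<tau>) ^ 2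
      + 128 * \<alpha> * \<delta> ^ 4 * \<tau> ^ 2
      + 1128 * \<alpha> * \<delta> ^ 4 * \<tau> * (1 - \<tau>)
      + 1008 * \<alpha> * \<delta> ^ 4 * (1 - \<tau>) ^ 2
      + 64 * \<delta> ^ 5 * \<tau> * (1 - \<tau>)"
    unfolding c1_def B_def D_def by algebra
  also have "0 < \<dots>"
    by (intro sum_prod_pos) (use a t nn in simp_all)
  finally have p1: "0 < c1" by simp
  have "c2 = 96 * \<delta> ^ 6 * (1 - \<tau>) ^ 3 + 53440 * \<alpha> ^ 6 * \<tau> ^ 3
      + 215872 * \<alpha> ^ 6 * \<tau> ^ 2 * (1 - \<tau>)
      + 272992 * \<alpha> ^ 6 * \<tau> * (1 - \<tau>) ^ 2
      + 110592 * \<alpha> ^ 6 * (1 - \<tau>) ^ 3 + 93376 * \<alpha> ^ 5 * \<delta> * \<tau> ^ 3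
      + 404128 * \<alpha> ^ 5 * \<delta> * \<tau> ^ 2 * (1 - \<tau>)
      + 531880 * \<alpha> ^ 5 * \<delta> * \<tau> * (1 - \<tau>) ^ 2
      + 221184 * \<alpha> ^ 5 * \<delta> * (1 - \<tau>) ^ 3
      + 61968 * \<alpha> ^ 4 * \<delta> ^ 2 * \<tau> ^ 3
      + 297120 * \<alpha> ^ 4 * \<delta> ^ 2 * \<tau> ^ 2 * (1 - \<tau>)
      + 411756 * \<alpha> ^ 4 * \<delta> ^ 2 * \<tau> * (1 - \<tau>) ^ 2
      + 176640 * \<alpha> ^ 4 * \<delta> ^ 2 * (1 - \<tau>) ^ 3
      + 19880 * \<alpha> ^ 3 * \<delta> ^ 3 * \<tau> ^ 3
      + 111224 * \<alpha> ^ 3 * \<delta> ^ 3 * \<tau> ^ 2 * (1 - \<tau>)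
      + 164294 * \<alpha> ^ 3 * \<delta> ^ 3 * \<tau> * (1 - \<tau>) ^ 2
      + 72960 * \<alpha> ^ 3 * \<delta> ^ 3 * (1 - \<tau>) ^ 3
      + 3116 * \<alpha> ^ 2 * \<delta> ^ 4 * \<tau> ^ 3
      + 22484 * \<alpha> ^ 2 * \<delta> ^ 4 * \<tau> ^ 2 * (1 - \<tau>)
      + 35927 * \<alpha> ^ 2 * \<delta> ^ 4 * \<tau> * (1 - \<tau>) ^ 2
      + 16560 * \<alpha> ^ 2 * \<delta> ^ 4 * (1 - \<tau>) ^ 3
      + 192 * \<alpha> * \<delta> ^ 5 * \<tau> ^ 3
      + 2328 * \<alpha> * \<delta> ^ 5 * \<tau> ^ 2 * (1 - \<tau>)
      + 4104 * \<alpha> * \<delta> ^ 5 * \<tau> * (1 - \<tau>) ^ 2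
      + 1968 * \<alpha> * \<delta> ^ 5 * (1 - \<tau>) ^ 3
      + 96 * \<delta> ^ 6 * \<tau> ^ 2 * (1 - \<tau>)
      + 192 * \<delta> ^ 6 * \<tau> * (1 - \<tau>) ^ 2"
    unfolding c2_def B_def D_def by algebra
  also have "0 < \<dots>"
    by (intro sum_prod_pos) (use a t nn in simp_all)
  finally have p2: "0 < c2" by simp
  have "c3 = 64 * \<delta> ^ 7 * (1 - \<tau>) ^ 3 + 206016 * \<alpha> ^ 7 * \<tau> ^ 3
      + 840768 * \<alpha> ^ 7 * \<tau> ^ 2 * (1 - \<tau>)
      + 1076928 * \<alpha> ^ 7 * \<tau> * (1 - \<tau>) ^ 2
      + 442368 * \<alpha> ^ 7 * (1 - \<tau>) ^ 3 + 366848 * \<alpha> ^ 6 * \<delta> * \<tau> ^ 3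
      + 1600352 * \<alpha> ^ 6 * \<delta> * \<tau> ^ 2 * (1 - \<tau>)
      + 2130128 * \<alpha> ^ 6 * \<delta> * \<tau> * (1 - \<tau>) ^ 2
      + 897024 * \<alpha> ^ 6 * \<delta> * (1 - \<tau>) ^ 3
      + 269936 * \<alpha> ^ 5 * \<delta> ^ 2 * \<tau> ^ 3
      + 1284400 * \<alpha> ^ 5 * \<delta> ^ 2 * \<tau> ^ 2 * (1 - \<tau>)
      + 1786232 * \<alpha> ^ 5 * \<delta> ^ 2 * \<tau> * (1 - \<tau>) ^ 2
      + 772096 * \<alpha> ^ 5 * \<delta> ^ 2 * (1 - \<tau>) ^ 3
      + 105280 * \<alpha> ^ 4 * \<delta> ^ 3 * \<tau> ^ 3
      + 563624 * \<alpha> ^ 4 * \<delta> ^ 3 * \<tau> ^ 2 * (1 - \<tau>)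
      + 824292 * \<alpha> ^ 4 * \<delta> ^ 3 * \<tau> * (1 - \<tau>) ^ 2
      + 366080 * \<alpha> ^ 4 * \<delta> ^ 3 * (1 - \<tau>) ^ 3
      + 22984 * \<alpha> ^ 3 * \<delta> ^ 4 * \<tau> ^ 3
      + 145968 * \<alpha> ^ 3 * \<delta> ^ 4 * \<tau> ^ 2 * (1 - \<tau>)
      + 226318 * \<alpha> ^ 3 * \<delta> ^ 4 * \<tau> * (1 - \<tau>) ^ 2
      + 103360 * \<alpha> ^ 3 * \<delta> ^ 4 * (1 - \<tau>) ^ 3
      + 2664 * \<alpha> ^ 2 * \<delta> ^ 5 * \<tau> ^ 3
      + 22272 * \<alpha> ^ 2 * \<delta> ^ 5 * \<tau> ^ 2 * (1 - \<tau>)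
      + 36998 * \<alpha> ^ 2 * \<delta> ^ 5 * \<tau> * (1 - \<tau>) ^ 2
      + 17392 * \<alpha> ^ 2 * \<delta> ^ 5 * (1 - \<tau>) ^ 3
      + 128 * \<alpha> * \<delta> ^ 6 * \<tau> ^ 3
      + 1848 * \<alpha> * \<delta> ^ 6 * \<tau> ^ 2 * (1 - \<tau>)
      + 3336 * \<alpha> * \<delta> ^ 6 * \<tau> * (1 - \<tau>) ^ 2
      + 1616 * \<alpha> * \<delta> ^ 6 * (1 - \<tau>) ^ 3
      + 64 * \<delta> ^ 7 * \<tau> ^ 2 * (1 - \<tau>)
      + 128 * \<delta> ^ 7 * \<tau> * (1 - \<tau>) ^ 2"
    unfolding c3_def B_def D_def by algebra
  also have "0 < \<dots>"
    by (intro sum_prod_pos) (use a t nn in simp_all)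
  finally have p3: "0 < c3" by simp
  have "c4 = 16 * \<delta> ^ 7 * (1 - \<tau>) ^ 3 + 65952 * \<alpha> ^ 7 * \<tau> ^ 3
      + 272160 * \<alpha> ^ 7 * \<tau> ^ 2 * (1 - \<tau>)
      + 353592 * \<alpha> ^ 7 * \<tau> * (1 - \<tau>) ^ 2
      + 147456 * \<alpha> ^ 7 * (1 - \<tau>) ^ 3 + 110352 * \<alpha> ^ 6 * \<delta> * \<tau> ^ 3
      + 488304 * \<alpha> ^ 6 * \<delta> * \<tau> ^ 2 * (1 - \<tau>)
      + 660420 * \<alpha> ^ 6 * \<delta> * \<tau> * (1 - \<tau>) ^ 2
      + 282624 * \<alpha> ^ 6 * \<delta> * (1 - \<tau>) ^ 3
      + 77144 * \<alpha> ^ 5 * \<delta> ^ 2 * \<tau> ^ 3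
      + 372984 * \<alpha> ^ 5 * \<delta> ^ 2 * \<tau> ^ 2 * (1 - \<tau>)
      + 527130 * \<alpha> ^ 5 * \<delta> ^ 2 * \<tau> * (1 - \<tau>) ^ 2
      + 231424 * \<alpha> ^ 5 * \<delta> ^ 2 * (1 - \<tau>) ^ 3
      + 28844 * \<alpha> ^ 4 * \<delta> ^ 3 * \<tau> ^ 3
      + 157060 * \<alpha> ^ 4 * \<delta> ^ 3 * \<tau> ^ 2 * (1 - \<tau>)
      + 233119 * \<alpha> ^ 4 * \<delta> ^ 3 * \<tau> * (1 - \<tau>) ^ 2
      + 104960 * \<alpha> ^ 4 * \<delta> ^ 3 * (1 - \<tau>) ^ 3
      + 6080 * \<alpha> ^ 3 * \<delta> ^ 4 * \<tau> ^ 3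
      + 39304 * \<alpha> ^ 3 * \<delta> ^ 4 * \<tau> ^ 2 * (1 - \<tau>)
      + 61692 * \<alpha> ^ 3 * \<delta> ^ 4 * \<tau> * (1 - \<tau>) ^ 2
      + 28480 * \<alpha> ^ 3 * \<delta> ^ 4 * (1 - \<tau>) ^ 3
      + 684 * \<alpha> ^ 2 * \<delta> ^ 5 * \<tau> ^ 3
      + 5828 * \<alpha> ^ 2 * \<delta> ^ 5 * \<tau> ^ 2 * (1 - \<tau>)
      + 9767 * \<alpha> ^ 2 * \<delta> ^ 5 * \<tau> * (1 - \<tau>) ^ 2
      + 4624 * \<alpha> ^ 2 * \<delta> ^ 5 * (1 - \<tau>) ^ 3
      + 32 * \<alpha> * \<delta> ^ 6 * \<tau> ^ 3
      + 472 * \<alpha> * \<delta> ^ 6 * \<tau> ^ 2 * (1 - \<tau>)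
      + 856 * \<alpha> * \<delta> ^ 6 * \<tau> * (1 - \<tau>) ^ 2
      + 416 * \<alpha> * \<delta> ^ 6 * (1 - \<tau>) ^ 3
      + 16 * \<delta> ^ 7 * \<tau> ^ 2 * (1 - \<tau>)
      + 32 * \<delta> ^ 7 * \<tau> * (1 - \<tau>) ^ 2"
    unfolding c4_def B_def D_def by algebra
  also have "0 < \<dots>"
    by (intro sum_prod_pos) (use a t nn in simp_all)
  finally have p4: "0 < c4" by simp
  have "surf_G \<alpha> B D y = B ^ 4 * c0 * ((1 - y) ^ 4) + B ^ 2 * c1 * ((1 - y) ^ 3 * y) +
    B * c2 * ((1 - y) ^ 2 * y ^ 2)
      + c3 * ((1 - y) * y ^ 3) + c4 * (y ^ 4)"
    unfolding surf_G_def c0_def c1_def c2_def c3_def c4_def unfolding surf_defs by algebra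
  also have "0 < \<dots>"
  proof (cases "y = 1")
    case True
    then show ?thesis using p4 B by simp
  next
    case False
    then have "0 < 1 - y" using y by simp
    with p0 B have "0 < B ^ 4 * c0 * ((1 - y) ^ 4)" by simp
    moreover have "0 \<le> B ^ 2 * c1 * ((1 - y) ^ 3 * y)" "0 \<le> B * c2 * ((1 - y) ^ 2 * y ^ 2)"
      "0 \<le> c3 * ((1 - y) * y ^ 3)" "0 \<le> c4 * (y ^ 4)"
      using p1 p2 p3 p4 B y by simp_all
    ultimately show ?thesis by linarith
  qed
  finally show ?thesis unfolding B_def D_def .
qed

section \<open>Curvature of the constant radius surface\<close>

text \<open>Replaces the limits at the poles by evaluation: it suffices to have a formula that is
  continuous on the closed interval and valid in its interior.\<close>

lemma extend_to_poles_eq: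
  assumes cont: "continuous_on {0..pi} F" and eq: "\<And>\<theta>. \<theta> \<in> {0<..<pi} \<Longrightarrow> f \<theta> = F \<theta>"
    and \<theta>: "\<theta> \<in> {0..pi}"
  shows "extend_to_poles f \<theta> = F \<theta>"
proof (cases "\<theta> = 0 \<or> \<theta> = pi")
  case True
  have lim: "(F \<longlongrightarrow> F \<theta>) (at \<theta> within {0<..<pi})"
    using cont \<theta> by (auto simp: continuous_on_def intro: tendsto_within_subset[of _ _ _ "{0..pi}"])
  have "(f \<longlongrightarrow> F \<theta>) (at \<theta> within {0<..<pi})"
    by (rule Lim_transform_eventually[OF lim]) (auto simp: eventually_at_filter eq)
  moreover have "at \<theta> within {0<..<pi} \<noteq> bot"
    using True \<theta> by (auto simp: at_within_eq_bot_iff islimpt_greaterThanLessThan1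
        islimpt_greaterThanLessThan2 trivial_limit_within)
  ultimately show ?thesis
    using True by (simp add: extend_to_poles_def tendsto_Lim)
next
  case False
  then show ?thesis using eq \<theta> by (auto simp: extend_to_poles_def)
qed

section \<open>Closed forms for K and k outside the horizon\<close>

locale kerr_exterior =
  fixes m a r :: real
  assumes m: "0 < m" and a: "0 \<le> a" "a \<le> m" and r: "kerr_r_plus m a < r"
begin

abbreviation "\<alpha> \<equiv> a\<^sup>2"
abbreviation "B \<equiv> r\<^sup>2 + a\<^sup>2"
abbreviation "D \<equiv> kerr_Delta m a r"
abbreviation "Q \<equiv> \<alpha> * (B - D)"
abbreviation "SE \<equiv> surf_E \<alpha> B"
abbreviation "SP \<equiv> surf_P \<alpha> B D"
abbreviation "H1 \<equiv> surf_H1 \<alpha> B D"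
abbreviation "W \<equiv> surf_W \<alpha> B D"
abbreviation "KN \<equiv> surf_K_num \<alpha> B D"

lemma r_gt_m: "m < r"
  using r a unfolding kerr_r_plus_def by (smt (verit) power_mono real_sqrt_ge_zero)

lemma r_pos: "0 < r" using r_gt_m m by simp

lemma B_minus_D: "B - D = 2 * m * r"
  by (simp add: kerr_Delta_def)

lemma D_pos: "0 < D"
proof -
  have "a\<^sup>2 \<le> m\<^sup>2" using a by (simp add: power_mono)
  moreover have "sqrt (m\<^sup>2 - a\<^sup>2) < r - m" using r by (simp add: kerr_r_plus_def)
  ultimately have "m\<^sup>2 - a\<^sup>2 < (r - m)\<^sup>2"
    using r_gt_m by (metis diff_ge_0_iff_ge real_less_rsqrt real_sqrt_ge_zero real_sqrt_pow2
      power_strict_mono zero_less_numeral)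
  then show ?thesis by (simp add: kerr_Delta_def power2_eq_square algebra_simps)
qed

lemma \<alpha>_less_mr: "\<alpha> < m * r"
proof -
  have "\<alpha> \<le> m * m" using a unfolding power2_eq_square by (intro mult_mono) auto
  also have "\<dots> < m * r" using r_gt_m m by simp
  finally show ?thesis .
qed

text \<open>In terms of \<open>r\<close> this is \<open>D < r^2 - \<alpha>\<close>, which becomes
  the bound \<open>\<tau> < 1\<close> of the polynomial inequalities.\<close>

lemma D_less: "D < B - 2 * \<alpha>"
  using B_minus_D \<alpha>_less_mr by linarith

lemma B_pos: "0 < B" using r_pos by (simp add: add_pos_nonneg)

lemma SE_pos: "0 < SE y" if "y \<le> 1"
proof -
  have "\<alpha> * y \<le> \<alpha> * 1" using that by (intro mult_left_mono) auto
  then show ?thesis using r_pos by (simp add: surf_E_def) (smt (verit) zero_less_power)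
qed

lemma SP_pos: "0 < SP y" if "y \<le> 1"
proof -
  have "D * \<alpha> * y \<le> D * \<alpha> * 1" using that D_pos by (intro mult_left_mono) auto
  also have "\<dots> \<le> B * \<alpha>"
  proof -
    have "D \<le> B" using D_less zero_le_power2[of a] by linarith
    then have "D * \<alpha> \<le> B * \<alpha>" by (rule mult_right_mono) simp
    then show ?thesis by simp
  qed
  also have "\<dots> < B * B" using B_pos r_pos by (intro mult_strict_left_mono) auto
  finally show ?thesis by (simp add: surf_P_def power2_eq_square)
qed

lemma kerr_Sigma2_eq: "kerr_Sigma2 a r \<theta> = SE ((sin \<theta>)\<^sup>2)"
  by (simp add: kerr_Sigma2_def surf_E_def cos_squared_eq algebra_simps)

lemma kerr_H_eq: "kerr_H m a r \<theta> = (sin \<theta>)\<^sup>2 * SP ((sin \<theta>)\<^sup>2) / SE ((sin \<theta>)\<^sup>2)"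
  by (simp add: kerr_H_def kerr_Sigma2_eq surf_P_def)

lemma sin_sq_le [simp]: "(sin (\<theta>::real))\<^sup>2 \<le> 1" by (simp add: abs_square_le_1)

lemma Sigma2_pos: "0 < kerr_Sigma2 a r \<theta>" unfolding kerr_Sigma2_eq by (rule SE_pos) simp

lemma H_pos: "0 < kerr_H m a r \<theta>" if "\<theta> \<in> {0<..<pi}"
  using that sin_gt_zero[of \<theta>] SE_pos[of "(sin \<theta>)\<^sup>2"] SP_pos[of "(sin \<theta>)\<^sup>2"] by (simp add: kerr_H_eq)

definition "Sigma2' \<theta> = - 2 * \<alpha> * sin \<theta> * cos \<theta>"
definition "kH' \<theta> = 2 * sin \<theta> * cos \<theta> * H1 ((sin \<theta>)\<^sup>2) / (SE ((sin \<theta>)\<^sup>2))\<^sup>2"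
definition "kH'' \<theta> = 2 * (1 - 2 * (sin \<theta>)\<^sup>2) * H1 ((sin \<theta>)\<^sup>2) / (SE ((sin \<theta>)\<^sup>2))\<^sup>2
    + 8 * (sin \<theta>)\<^sup>2 * (1 - (sin \<theta>)\<^sup>2) * Q * B\<^sup>2 / (SE ((sin \<theta>)\<^sup>2)) ^ 3"

lemma Sigma2_deriv: "(kerr_Sigma2 a r has_real_derivative Sigma2' \<theta>) (at \<theta>)"
  unfolding kerr_Sigma2_def[abs_def] Sigma2'_def by (auto intro!: derivative_eq_intros)

lemma H_of_sin_sq_deriv:
  assumes "y \<le> 1"
  shows "((\<lambda>y. y * SP y / SE y) has_real_derivative H1 y / (SE y)\<^sup>2) (at y)"
proof -
  have "SE y \<noteq> 0" using SE_pos[OF assms] by simp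
  then show ?thesis
    unfolding surf_P_def surf_E_def surf_H1_def
    by (auto intro!: derivative_eq_intros simp: power2_eq_square) (simp add: algebra_simps)
qed

text \<open>The numerator is constant because \<open>H = y P / E\<close> is a quadratic over a
  linear polynomial in \<open>y\<close>: for \<open>\<alpha> > 0\<close> it is an affine function
  plus a constant over \<open>E\<close>, and only the latter has a second derivative.\<close>

lemma H1_deriv:
  assumes "y \<le> 1"
  shows "((\<lambda>y. H1 y / (SE y)\<^sup>2) has_real_derivative 2 * Q * B\<^sup>2 / (SE y) ^ 3) (at y)"
proof -
  have nz: "SE y \<noteq> 0" using SE_pos[OF assms] by simp
  have d: "(H1 has_real_derivative
      (- 2 * \<alpha> * B * SE y + Q * (SE y + B) - Q * y * \<alpha>)) (at y)"
    unfolding surf_H1_def surf_E_def by (auto intro!: derivative_eq_intros simp: algebra_simps)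
  have e: "((\<lambda>y. (SE y)\<^sup>2) has_real_derivative - 2 * \<alpha> * SE y) (at y)"
    unfolding surf_E_def by (auto intro!: derivative_eq_intros)
  have "((- 2 * \<alpha> * B * SE y + Q * (SE y + B) - Q * y * \<alpha>) * (SE y)\<^sup>2 - H1 y * (- 2 * \<alpha> * SE y))
    * (SE y) ^ 3
     = 2 * Q * B\<^sup>2 * ((SE y)\<^sup>2 * (SE y)\<^sup>2)"
    unfolding surf_H1_def surf_E_def by algebra
  then have eq: "((- 2 * \<alpha> * B * SE y + Q * (SE y + B) - Q * y * \<alpha>)
    * (SE y)\<^sup>2 - H1 y * (- 2 * \<alpha> * SE y))
      / ((SE y)\<^sup>2 * (SE y)\<^sup>2) = 2 * Q * B\<^sup>2 / (SE y) ^ 3"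
    using nz by (subst frac_eq_eq) auto
  show ?thesis
    using DERIV_divide[OF d e] nz unfolding eq by simp
qed

lemma sin_sq_deriv: "((\<lambda>\<theta>. (sin \<theta>)\<^sup>2) has_real_derivative 2 * sin \<theta> * cos \<theta>) (at \<theta>)"
  by (auto intro!: derivative_eq_intros)

lemma H_deriv: "(kerr_H m a r has_real_derivative kH' \<theta>) (at \<theta>)"
  using DERIV_chain2[OF H_of_sin_sq_deriv sin_sq_deriv, of \<theta>]
  by (simp add: kerr_H_eq[abs_def] kH'_def mult_ac)

lemma H_deriv2: "(kH' has_real_derivative kH'' \<theta>) (at \<theta>)"
proof -
  have sc: "((\<lambda>\<theta>. 2 * sin \<theta> * cos \<theta>) has_real_derivative 2 * (1 - 2 * (sin \<theta>)\<^sup>2)) (at \<theta>)"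
  proof (rule DERIV_cong)
    show "((\<lambda>\<theta>. 2 * sin \<theta> * cos \<theta>) has_real_derivative 2 * cos \<theta> * cos \<theta> - 2 * sin \<theta> * sin \<theta>)
      (at \<theta>)"
      by (auto intro!: derivative_eq_intros)
    show "2 * cos \<theta> * cos \<theta> - 2 * sin \<theta> * sin \<theta> = 2 * (1 - 2 * (sin \<theta>)\<^sup>2)"
      using cos_squared_eq[of \<theta>] by algebra
  qed
  have cs: "(cos \<theta>)\<^sup>2 = 1 - (sin \<theta>)\<^sup>2" by (rule cos_squared_eq)
  have "((\<lambda>\<theta>. 2 * sin \<theta> * cos \<theta> * (H1 ((sin \<theta>)\<^sup>2) / (SE ((sin \<theta>)\<^sup>2))\<^sup>2)) has_real_derivative
     2 * (1 - 2 * (sin \<theta>)\<^sup>2) * (H1 ((sin \<theta>)\<^sup>2) / (SE ((sin \<theta>)\<^sup>2))\<^sup>2)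
     + (2 * Q * B\<^sup>2 / (SE ((sin \<theta>)\<^sup>2)) ^ 3 * (2 * sin \<theta> * cos \<theta>)) * (2 * sin \<theta> * cos \<theta>)) (at \<theta>)"
    by (rule DERIV_mult[OF sc DERIV_chain2[OF H1_deriv sin_sq_deriv]]) simp
  also have "(2 * Q * B\<^sup>2 / (SE ((sin \<theta>)\<^sup>2)) ^ 3 * (2 * sin \<theta> * cos \<theta>)) * (2 * sin \<theta> * cos \<theta>)
      = 8 * (sin \<theta>)\<^sup>2 * (cos \<theta>)\<^sup>2 * Q * B\<^sup>2 / (SE ((sin \<theta>)\<^sup>2)) ^ 3"
    by (simp add: power2_eq_square)
  finally show ?thesis
    unfolding cs by (simp add: kH'_def[abs_def] kH''_def)
qed

lemma kH'_sq:
  "(kH' \<theta>)\<^sup>2 = 4 * (sin \<theta>)\<^sup>2 * (1 - (sin \<theta>)\<^sup>2) * (H1 ((sin \<theta>)\<^sup>2))\<^sup>2 / (SE ((sin \<theta>)\<^sup>2)) ^ 4"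
proof -
  have "(2 * x * z * h / e\<^sup>2)\<^sup>2 = 4 * x\<^sup>2 * z\<^sup>2 * h\<^sup>2 / e ^ 4" for x z h e :: real
    by (simp add: power2_eq_square power4_eq_xxxx mult_ac)
  then show ?thesis unfolding kH'_def cos_squared_eq[symmetric] .
qed

definition "Kf y = KN y / (SE y ^ 3 * (SP y)\<^sup>2)"

text \<open>Sine and cosine enter only through \<open>y = sin^2 \<theta>\<close> and the product
  \<open>y * (1 - y)\<close>. The factor \<open>y\<close>, which would make the quotient
  indeterminate at the poles, cancels by \<open>surf_K_num_identity\<close>.\<close>

lemma curvature_formula:
  assumes \<theta>: "\<theta> \<in> {0<..<pi}"
  shows "(- kH'' \<theta> / (2 * kerr_Sigma2 a r \<theta>) + kH' \<theta> * Sigma2' \<theta> / (4 * (kerr_Sigma2 a r \<theta>)\<^sup>2)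
      + (kH' \<theta>)\<^sup>2 / (4 * kerr_Sigma2 a r \<theta> * kerr_H m a r \<theta>)) / kerr_H m a r \<theta> = Kf ((sin \<theta>)\<^sup>2)"
proof -
  define y where "y = (sin \<theta>)\<^sup>2"
  have y: "0 < y" "y \<le> 1" using sin_gt_zero[of \<theta>] \<theta> by (auto simp: y_def)
  define e p h where "e = SE y" and "p = SP y" and "h = H1 y"
  have pos: "0 < e" "0 < p" using SE_pos SP_pos y by (auto simp: e_def p_def)
  have sc: "sin \<theta> * cos \<theta> * (sin \<theta> * cos \<theta>) = y * (1 - y)"
    using cos_squared_eq[of \<theta>] unfolding y_def by algebra
  have 1: "kH' \<theta> * Sigma2' \<theta> = - 4 * \<alpha> * y * (1 - y) * h / e\<^sup>2"
    using sc by (simp add: kH'_def Sigma2'_def y_def[symmetric] h_def e_def)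
  have 2: "(kH' \<theta>)\<^sup>2 = 4 * y * (1 - y) * h\<^sup>2 / e ^ 4"
    unfolding kH'_sq y_def h_def e_def ..
  have K: "y * KN y = h * ((1 - y) * h - (1 - 2 * y) * e * p) - (1 - y) * y * p * (4 * Q * B\<^sup>2 +
    \<alpha> * h)"
    unfolding e_def p_def h_def by (rule surf_K_num_identity)
  have "(- kH'' \<theta> / (2 * kerr_Sigma2 a r \<theta>) + kH' \<theta> * Sigma2' \<theta> / (4 * (kerr_Sigma2 a r \<theta>)\<^sup>2)
      + (kH' \<theta>)\<^sup>2 / (4 * kerr_Sigma2 a r \<theta> * kerr_H m a r \<theta>)) / kerr_H m a r \<theta> =
        y * KN y / (y * (e ^ 3 * p\<^sup>2))"
    unfolding 1 2 K kH''_def kerr_Sigma2_eq kerr_H_eq y_def[symmetric] e_def[symmetric]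
      p_def[symmetric] h_def[symmetric]
    using pos y by (simp add: divide_simps) algebra
  then show ?thesis
    using y by (simp add: Kf_def e_def p_def y_def[symmetric])
qed

lemma continuous_on_surf: "continuous_on A (surf_E \<alpha> B)" "continuous_on A SP" "continuous_on A H1"
  "continuous_on A W" "continuous_on A KN"
  unfolding surf_defs[abs_def] by (intro continuous_intros)+

lemma continuous_on_sin_sq_comp:
  assumes "continuous_on {0..1} f"
  shows "continuous_on {0..pi} (\<lambda>\<theta>. f ((sin \<theta>)\<^sup>2))"
  by (rule continuous_on_compose2[OF assms]) (auto intro!: continuous_intros)

lemma Kf_continuous: "continuous_on {0..1} Kf"
  unfolding Kf_def[abs_def]
  by (intro continuous_intros continuous_on_surf ballI) (use SE_pos SP_pos in force)

lemma surface_K_eq: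
  assumes "\<theta> \<in> {0..pi}"
  shows "surface_K m a t r \<theta> = Kf ((sin \<theta>)\<^sup>2)"
  unfolding surface_K_def
proof (rule extend_to_poles_eq[OF continuous_on_sin_sq_comp[OF Kf_continuous] _ assms])
  fix \<theta> assume \<theta>: "\<theta> \<in> {0<..<pi}"
  have "gauss_curvature (surface_metric m a t r) (vector [\<theta>, 0]) =
    (let e = kerr_Sigma2 a r ((vector [\<theta>, 0] :: real^2) $ 1); e' = Sigma2' ((vector [\<theta>, 0]
      :: real^2) $ 1);
      h = kerr_H m a r ((vector [\<theta>, 0] :: real^2) $ 1); h' = kH' ((vector [\<theta>, 0] :: real^2) $ 1)
     in (- kH'' \<theta> / (2 * e) + h' * e' / (4 * e\<^sup>2) + h'\<^sup>2 / (4 * e * h)) / h)"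
    by (rule gauss_curvature_revolution[where S = "{0<..<pi}"])
       (use \<theta> H_deriv2 in \<open>simp_all add: surface_metric_diag Sigma2_pos H_pos Sigma2_deriv H_deriv\<close>)
  then show "gauss_curvature (surface_metric m a t r) (vector [\<theta>, 0]) = Kf ((sin \<theta>)\<^sup>2)"
    using curvature_formula[OF \<theta>] by (simp add: Let_def)
qed

text \<open>\<open>Pr\<close> is the r-derivative of \<open>SP\<close>. With
  \<open>H \<Sigma>^2 = y P\<close> the mean curvature
  \<open>(H \<Sigma>^2)_r / (2 H \<Sigma>^2 R)\<close> loses its factor \<open>y\<close> and becomes
  \<open>kf\<close>.\<close>

definition "Pr y = 4 * r * B - (2 * r - 2 * m) * \<alpha> * y"
definition "kf y = Pr y / (2 * SP y) / sqrt (SE y / D)"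

lemma kf_continuous: "continuous_on {0..1} kf"
  unfolding kf_def[abs_def] Pr_def
  by (intro continuous_intros continuous_on_surf ballI) (use SE_pos SP_pos D_pos in force)+

lemma surface_k_eq:
  assumes "\<theta> \<in> {0..pi}"
  shows "surface_k m a t r \<theta> = kf ((sin \<theta>)\<^sup>2)"
  unfolding surface_k_def
proof (rule extend_to_poles_eq[OF continuous_on_sin_sq_comp[OF kf_continuous] _ assms])
  fix \<theta> assume \<theta>: "\<theta> \<in> {0<..<pi}"
  define y where "y = (sin \<theta>)\<^sup>2"
  have y: "0 < y" "y \<le> 1" using sin_gt_zero[of \<theta>] \<theta> by (auto simp: y_def)
  have R: "kerr_R m a r \<theta> = sqrt (SE y / D)" "0 < kerr_R m a r \<theta>"
    using SE_pos[OF y(2)] D_pos by (auto simp: kerr_R_def kerr_Sigma2_eq y_def)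
  have S': "((\<lambda>\<rho>. kerr_Sigma2 a \<rho> \<theta>) has_real_derivative 2 * r) (at r)"
    unfolding kerr_Sigma2_def by (auto intro!: derivative_eq_intros)
  have P': "((\<lambda>\<rho>. y * ((\<rho>\<^sup>2 + a\<^sup>2)\<^sup>2 - kerr_Delta m a \<rho> * a\<^sup>2 * y)) has_real_derivative y * Pr y)
    (at r)"
    unfolding kerr_Delta_def Pr_def by (auto intro!: derivative_eq_intros simp: algebra_simps
      power2_eq_square)
  have nz: "kerr_Sigma2 a r \<theta> \<noteq> 0" using Sigma2_pos[of \<theta>] by simp
  have H': "((\<lambda>\<rho>. kerr_H m a \<rho> \<theta>) has_real_derivative
     (y * Pr y * SE y - y * SP y * (2 * r)) / (SE y * SE y)) (at r)"
    using DERIV_divide[OF P' S' nz] by (simp add: kerr_H_def[of m a _ \<theta>] y_def[symmetric]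
      kerr_Sigma2_eq surf_P_def mult_ac)
  have "mean_curvature (slice_metric m a t) (radius_surface r) (surface_normal m a r)
    (vector [\<theta>, 0]) =
     (2 * r / SE y + ((y * Pr y * SE y - y * SP y * (2 * r)) / (SE y * SE y))
       / (y * SP y / SE y)) / (2 * sqrt (SE y / D))"
    using mean_curvature_radius_surface[of m a r "vector [\<theta>, 0]" "2 * r" _ t]
      S' H' R H_pos[OF \<theta>] Sigma2_pos[of \<theta>]
    by (simp add: kerr_Sigma2_eq kerr_H_eq y_def)
  also have "2 * r / SE y + ((y * Pr y * SE y - y * SP y * (2 * r)) / (SE y * SE y))
    / (y * SP y / SE y) = Pr y / SP y"
    using y SE_pos[OF y(2)] SP_pos[OF y(2)] by (simp add: divide_simps)
  finally show "mean_curvature (slice_metric m a t) (radius_surface r) (surface_normal m a r)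
    (vector [\<theta>, 0]) = kf ((sin \<theta>)\<^sup>2)"
    by (simp add: kf_def y_def)
qed

end

section \<open>The cubic and its real root\<close>

text \<open>Cardano's formula: the root is \<open>u - v\<close> with \<open>u * v = a^2 / 3\<close>
  and \<open>u^3 - v^3 = 6 a^2 m\<close>, because
  \<open>(u - v)^3 + 3 u v (u - v) = u^3 - v^3\<close>. For \<open>a = 0\<close> the cube root
  \<open>c\<close> is 0, and the value rests on the convention for division by zero.\<close>

lemma kerr_r_k_root:
  assumes "0 < m" "0 \<le> a"
  shows "(kerr_r_k m a) ^ 3 + a\<^sup>2 * kerr_r_k m a - 6 * a\<^sup>2 * m = 0"
proof (cases "a = 0")
  case True
  then show ?thesis by (simp add: kerr_r_k_def)
next
  case False
  define s where "s = sqrt 3 * sqrt (243 * a ^ 4 * m\<^sup>2 + a ^ 6)"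
  define c where "c = root 3 (27 * a\<^sup>2 * m + s)"
  define u v where "u = c / root 3 9" and "v = a\<^sup>2 / (root 3 3 * c)"
  have s2: "s\<^sup>2 = 3 * (243 * a ^ 4 * m\<^sup>2 + a ^ 6)"
    by (simp add: s_def power_mult_distrib)
  have s0: "0 \<le> s" by (simp add: s_def)
  have c3: "c ^ 3 = 27 * a\<^sup>2 * m + s" unfolding c_def by (rule odd_real_root_pow) simp
  have cpos: "0 < c ^ 3"
    unfolding c3 using assms False s0 by (intro add_pos_nonneg mult_pos_pos) auto
  then have c: "0 < c" by (simp add: zero_less_power_eq)
  have t3: "root 3 3 ^ 3 = (3::real)" and n3: "root 3 9 ^ 3 = (9::real)"
    by (rule odd_real_root_pow; simp)+
  have "root 3 3 * root 3 9 = root 3 (3 * 9 :: real)" by (rule real_root_mult[symmetric])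
  also have "\<dots> = root 3 (3 ^ 3)" by (simp only: power3_eq_cube) simp
  also have "\<dots> = 3" by (rule real_root_power_cancel) simp_all
  finally have tn: "root 3 3 * root 3 9 = (3::real)" .
  have uv: "u * v = a\<^sup>2 / 3"
    using c tn by (simp add: u_def v_def mult_ac)
  have u3: "u ^ 3 = c ^ 3 / 9" by (simp add: u_def power_divide n3)
  have v3: "v ^ 3 = a ^ 6 / (3 * c ^ 3)" by (simp add: v_def power_divide power_mult_distrib t3
    power_mult[symmetric])
  \<comment> \<open>\<open>c ^ 3\<close> solves the resolvent quadratic
    \<open>X^2 - 54 a^2 m X - 3 a^6 = 0\<close>.\<close>
  have "(c ^ 3)\<^sup>2 - 3 * a ^ 6 = 54 * a\<^sup>2 * m * c ^ 3"
    unfolding c3 using s2 by algebra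
  then have d: "u ^ 3 - v ^ 3 = 6 * a\<^sup>2 * m"
    unfolding u3 v3 using cpos by (simp add: field_simps power2_eq_square)
  have x: "kerr_r_k m a = u - v"
    by (simp add: kerr_r_k_def Let_def u_def v_def c_def s_def)
  show ?thesis unfolding x using d uv by algebra
qed

lemma cubic_strict_mono:
  fixes a x y :: real
  assumes "x < y"
  shows "x ^ 3 + a\<^sup>2 * x < y ^ 3 + a\<^sup>2 * y"
proof -
  have "x ^ 3 < y ^ 3"
    using assms by (metis odd_real_root_power_cancel odd_numeral real_root_less_iff
      zero_less_numeral)
  moreover have "a\<^sup>2 * x \<le> a\<^sup>2 * y" by (rule mult_left_mono) (use assms in simp_all)
  ultimately show ?thesis by (rule add_less_le_mono)
qed

lemma cubic_root_iff:
  assumes "0 < m" "0 \<le> a"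
  shows "x ^ 3 + a\<^sup>2 * x - 6 * a\<^sup>2 * m = 0 \<longleftrightarrow> x = kerr_r_k m a"
    and "0 < x ^ 3 + a\<^sup>2 * x - 6 * a\<^sup>2 * m \<longleftrightarrow> kerr_r_k m a < x"
proof -
  define k where "k = kerr_r_k m a"
  have k: "k ^ 3 + a\<^sup>2 * k = 6 * a\<^sup>2 * m" using kerr_r_k_root[OF assms] by (simp add: k_def)
  define p where "p = (\<lambda>x::real. x ^ 3 + a\<^sup>2 * x)"
  have pk: "p k = 6 * a\<^sup>2 * m" using k by (simp add: p_def)
  have mono: "p u < p v" if "u < v" for u v using cubic_strict_mono[OF that] by (simp add: p_def)
  show "x ^ 3 + a\<^sup>2 * x - 6 * a\<^sup>2 * m = 0 \<longleftrightarrow> x = kerr_r_k m a"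
    unfolding k_def[symmetric] p_def[symmetric, THEN fun_cong] pk[symmetric]
    using mono[of x k] mono[of k x] by (cases x k rule: linorder_cases) auto
  show "0 < x ^ 3 + a\<^sup>2 * x - 6 * a\<^sup>2 * m \<longleftrightarrow> kerr_r_k m a < x"
    unfolding k_def[symmetric] p_def[symmetric, THEN fun_cong] pk[symmetric]
    using mono[of x k] mono[of k x] by (cases x k rule: linorder_cases) auto
qed

section \<open>Values at the poles and comparison of the closed forms\<close>

context kerr_exterior
begin

text \<open>Up to the factor \<open>B ^ 4\<close>, the common value of \<open>KN\<close> and
  \<open>W\<close> at the poles. It carries the sign of K there and is \<open>r\<close> times the
  cubic of the theorem.\<close>

definition "pole_num = B\<^sup>2 - 4 * \<alpha> * B + 3 * \<alpha> * D"

lemma pole_num_eq: "pole_num = r * (r ^ 3 + a\<^sup>2 * r - 6 * a\<^sup>2 * m)"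
  unfolding pole_num_def kerr_Delta_def by algebra

lemma pole_num_pos_iff: "0 < pole_num \<longleftrightarrow> kerr_r_k m a < r"
  unfolding pole_num_eq using r_pos cubic_root_iff(2)[OF m a(1)] by (simp add: zero_less_mult_iff)

lemma KN_0: "KN 0 = B ^ 4 * pole_num" and W_0: "W 0 = B ^ 4 * pole_num"
  unfolding pole_num_def surf_defs by algebra+

lemma far_params:
  assumes "3 * \<alpha> < r\<^sup>2"
  obtains \<delta> \<tau> where "0 < \<delta>" "0 \<le> \<tau>" "\<tau> < 1" "B = 4 * \<alpha> + \<delta>" "D = (2 * \<alpha> + \<delta>) * \<tau>"
proof
  show "0 < B - 4 * \<alpha>" using assms by simp
  have "0 < B - 2 * \<alpha>" using D_less D_pos by simp
  then show "0 \<le> D / (B - 2 * \<alpha>)" "D / (B - 2 * \<alpha>) < 1" "D = (2 * \<alpha> + (B - 4 * \<alpha>))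
    * (D / (B - 2 * \<alpha>))"
    using D_less D_pos by (simp_all add: field_simps)
qed simp

lemma W_pos: "0 < W y" if "3 * \<alpha> < r\<^sup>2" "0 \<le> y" "y \<le> 1"
  by (rule far_params[OF that(1)]) (metis surf_W_pos that(2,3) zero_le_power2)

lemma G_pos: "0 < surf_G \<alpha> B D y" if "3 * \<alpha> < r\<^sup>2" "0 \<le> y" "y \<le> 1"
  by (rule far_params[OF that(1)]) (metis surf_G_pos that(2,3) zero_le_power2)

lemma KN_pos_far: "0 < KN y" if "3 * \<alpha> < r\<^sup>2" "0 \<le> y" "y \<le> 1"
  by (rule far_params[OF that(1)]) (metis surf_K_num_pos_far that(2,3) zero_le_power2)

text \<open>Scaling by \<open>\<alpha>\<close> leaves the two ratios
  \<open>B / \<alpha> = 4 - d\<close> and \<open>D / \<alpha> = x\<close>. From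
  \<open>d * (4 - d) <= 3 * x\<close> and \<open>x < 2 - d\<close> follows
  \<open>(1 - d) * (6 - d) > 0\<close>, hence \<open>d < 1\<close>, that is,
  \<open>r^2 > 2 \<alpha>\<close>. The case \<open>pole_num = 0\<close> is included for the
  degenerate limit of \<open>k0f\<close>.\<close>

lemma near_ratios:
  assumes "r\<^sup>2 \<le> 3 * \<alpha>" "0 \<le> pole_num"
  obtains d x where "0 < \<alpha>" "0 \<le> d" "d < 1" "x < 2 - d" "B = \<alpha> * (4 - d)" "D = \<alpha> * x"
    "pole_num = \<alpha>\<^sup>2 * (3 * x - d * (4 - d))"
proof -
  have r2: "0 < r\<^sup>2" using r_pos by simp
  then have \<alpha>: "0 < \<alpha>" using assms by linarith
  define d where "d = 4 - B / \<alpha>"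
  define x where "x = D / \<alpha>"
  have B: "B = \<alpha> * (4 - d)" using \<alpha> by (simp add: d_def)
  have D: "D = \<alpha> * x" using \<alpha> by (simp add: x_def)
  have "\<alpha> * 0 \<le> \<alpha> * d" using assms(1) B by (simp add: algebra_simps)
  then have d0: "0 \<le> d" using \<alpha> by (simp only: mult_le_cancel_left_pos)
  have "\<alpha> * x < \<alpha> * (2 - d)" using D_less D B by (simp add: algebra_simps)
  then have x2: "x < 2 - d" using \<alpha> by (simp only: mult_less_cancel_left_pos)
  have x0: "0 < x" using D_pos \<alpha> by (simp add: x_def)
  have pole_num: "pole_num = \<alpha>\<^sup>2 * (3 * x - d * (4 - d))" unfolding pole_num_def B D by algebra
  then have "d * (4 - d) \<le> 3 * x" using assms(2) \<alpha> by (simp add: zero_le_mult_iff)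
  then have "0 < (1 - d) * (6 - d)" using x2 by (simp add: algebra_simps)
  moreover have "0 < 6 - d" using x0 x2 by simp
  ultimately have d1: "d < 1" by (simp add: zero_less_mult_iff)
  show ?thesis by (rule that[OF \<alpha> d0 d1 x2 B D pole_num])
qed

lemma near_params:
  assumes "r\<^sup>2 \<le> 3 * \<alpha>" "0 < pole_num"
  obtains d \<tau> where "0 < \<alpha>" "0 \<le> d" "d < 1" "0 < \<tau>" "\<tau> < 1" "B = \<alpha> * (4 - d)"
    "D = \<alpha> * (d * (4 - d) / 3 * (1 - \<tau>) + (2 - d) * \<tau>)"
proof -
  obtain d x where d: "0 < \<alpha>" "0 \<le> d" "d < 1" "x < 2 - d" "B = \<alpha> * (4 - d)" "D = \<alpha> * x"
    and pole_num: "pole_num = \<alpha>\<^sup>2 * (3 * x - d * (4 - d))"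
    using near_ratios[OF assms(1) less_imp_le[OF assms(2)]] .
  have k: "0 < x - d * (4 - d) / 3" using assms(2) d(1)
    unfolding pole_num by (simp add: zero_less_mult_iff)
  define l where "l = d * (4 - d) / 3"
  have l: "l < x" "0 < (2 - d) - l" using k d(4) by (simp_all add: l_def)
  define \<tau> where "\<tau> = (x - l) / ((2 - d) - l)"
  have \<tau>: "0 < \<tau>" "\<tau> < 1" using l d(4) by (simp_all add: \<tau>_def)
  have x: "x = l * (1 - \<tau>) + (2 - d) * \<tau>"
  proof -
    have "\<tau> * ((2 - d) - l) = x - l" using l(2) by (simp add: \<tau>_def)
    then show ?thesis by (simp add: algebra_simps)
  qed
  show ?thesis by (rule that[OF d(1-3) \<tau> d(5) d(6)[unfolded x l_def]])
qed

lemma KN_pos: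
  assumes "0 < pole_num" "0 \<le> y" "y \<le> 1"
  shows "0 < KN y"
proof (cases "3 * \<alpha> < r\<^sup>2")
  case False
  then have R: "r\<^sup>2 \<le> 3 * \<alpha>" by simp
  obtain d \<tau> where d: "0 < \<alpha>" "0 \<le> d" "d < 1" "0 < \<tau>" "\<tau> < 1" and B: "B = \<alpha> * (4 - d)"
    and D: "D = \<alpha> * (d * (4 - d) / 3 * (1 - \<tau>) + (2 - d) * \<tau>)"
    using near_params[OF R assms(1)] .
  show ?thesis unfolding B D by (rule surf_K_num_pos_near[OF d assms(2,3)])
qed (rule KN_pos_far[OF _ assms(2,3)])

lemma Kf_0: "Kf 0 = pole_num / B ^ 3"
proof -
  have "B ^ 4 * pole_num / (B ^ 3 * (B\<^sup>2)\<^sup>2) = pole_num / B ^ 3"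
    using B_pos by (simp add: power2_eq_square power4_eq_xxxx)
  then show ?thesis by (simp add: Kf_def KN_0 surf_E_def surf_P_def)
qed

text \<open>The poles decide: once the curvature is positive there, the Bernstein coefficients make
  it positive on the whole surface.\<close>

lemma surface_K_pos_iff: "(\<forall>\<theta>\<in>{0..pi}. 0 < surface_K m a t r \<theta>) \<longleftrightarrow> 0 < pole_num"
proof
  assume "\<forall>\<theta>\<in>{0..pi}. 0 < surface_K m a t r \<theta>"
  then have "0 < Kf 0" using surface_K_eq[of 0 t] by force
  then show "0 < pole_num"
    using zero_less_power[OF B_pos, of 3] by (simp add: Kf_0 zero_less_divide_iff)
next
  assume "0 < pole_num"
  then show "\<forall>\<theta>\<in>{0..pi}. 0 < surface_K m a t r \<theta>"
    by (auto simp: surface_K_eq Kf_def intro!: divide_pos_pos mult_pos_pos zero_less_power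
      SE_pos SP_pos KN_pos
        simp del: zero_less_power2)
qed

text \<open>This is \<open>\<kappa> + K / \<kappa>\<close> for \<open>\<kappa> = sqrt (W / (E\<^sup>3 P\<^sup>2))\<close>.\<close>

definition "k0f y = (W y + KN y) / (sqrt (W y) * sqrt (SE y ^ 3) * SP y)"

lemma k0f_continuous: "continuous_on {0..1} k0f" if "3 * \<alpha> < r\<^sup>2"
  unfolding k0f_def[abs_def]
  by (intro continuous_intros continuous_on_surf ballI) (use SE_pos SP_pos W_pos[OF that] in force)

lemma r_times_Pr: "r * Pr y = 4 * (B - \<alpha>) * B - (B - 2 * \<alpha> + D) * \<alpha> * y"
  unfolding Pr_def kerr_Delta_def by algebra

lemma Pr_pos: "0 < Pr y" if "0 \<le> y" "y \<le> 1"
proof -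
  have "(2 * r - 2 * m) * \<alpha> * y \<le> (2 * r - 2 * m) * \<alpha> * 1"
    using that r_gt_m by (intro mult_left_mono) auto
  also have "\<dots> \<le> 2 * r * \<alpha>" using m by (simp add: mult_right_mono)
  also have "\<dots> < 4 * r * B"
  proof -
    have "\<alpha> < B" using r_pos by simp
    also have "B < 2 * B" using B_pos by simp
    finally have "\<alpha> < 2 * B" .
    then have "2 * r * \<alpha> < 2 * r * (2 * B)" using r_pos by (intro mult_strict_left_mono) auto
    also have "\<dots> = 4 * r * B" by algebra
    finally show ?thesis .
  qed
  finally show ?thesis by (simp add: Pr_def)
qed

lemma kf_sq: "(kf y)\<^sup>2 = (Pr y)\<^sup>2 * D / (4 * (SP y)\<^sup>2 * SE y)" if "y \<le> 1"
  using SE_pos[OF that] SP_pos[OF that] D_pos by (simp add: kf_def power_divide power_mult_distrib)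

lemma kf_less_k0f: "kf y < k0f y" if R: "3 * \<alpha> < r\<^sup>2" and y: "0 \<le> y" "y \<le> 1"
proof (rule power2_less_imp_less)
  note pos = SE_pos[OF y(2)] SP_pos[OF y(2)] W_pos[OF R y] KN_pos_far[OF R y]
  show "0 \<le> k0f y" using pos by (simp add: k0f_def)
  have F: "(k0f y)\<^sup>2 = (W y + KN y)\<^sup>2 / (W y * SE y ^ 3 * (SP y)\<^sup>2)"
    using pos by (simp add: k0f_def power_divide power_mult_distrib)
  \<comment> \<open>AM-GM: \<open>k\<^sub>0\<^sup>2 \<ge> 4 K\<close>\<close>
  have "4 * W y * KN y \<le> (W y + KN y)\<^sup>2"
    using zero_le_power2[of "W y - KN y"] by (simp add: power2_eq_square algebra_simps)
  then have "4 * W y * KN y / (W y * SE y ^ 3 * (SP y)\<^sup>2) \<le> (k0f y)\<^sup>2"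
    unfolding F using pos by (intro divide_right_mono) auto
  then have ge: "4 * KN y / (SE y ^ 3 * (SP y)\<^sup>2) \<le> (k0f y)\<^sup>2" using pos by simp
  \<comment> \<open>With \<open>r * Pr\<close> in place of the polynomial inside
    \<open>surf_G\<close>, the positive factor \<open>r\<^sup>2\<close> comes out and can be
    cancelled.\<close>
  have "surf_G \<alpha> B D y = r\<^sup>2 * (16 * KN y - (Pr y)\<^sup>2 * D * (SE y)\<^sup>2)"
    unfolding surf_G_def r_times_Pr[symmetric] by algebra
  then have "(Pr y)\<^sup>2 * D * (SE y)\<^sup>2 < 16 * KN y"
    using G_pos[OF R y] by (simp add: zero_less_mult_iff)
  then have "(Pr y)\<^sup>2 * D * (SE y)\<^sup>2 / (4 * (SE y ^ 3 * (SP y)\<^sup>2))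
    < 16 * KN y / (4 * (SE y ^ 3 * (SP y)\<^sup>2))"
    using pos by (intro divide_strict_right_mono) auto
  also have "\<dots> = 4 * KN y / (SE y ^ 3 * (SP y)\<^sup>2)" by simp
  also have "(Pr y)\<^sup>2 * D * (SE y)\<^sup>2 / (4 * (SE y ^ 3 * (SP y)\<^sup>2)) = (kf y)\<^sup>2"
  proof -
    have "x * e\<^sup>2 / (4 * (e ^ 3 * p)) = x / (4 * p * e)" if "e \<noteq> 0" for x e p :: real
      using that by (simp add: power2_eq_square power3_eq_cube)
    then show ?thesis unfolding kf_sq[OF y(2)] using pos(1) by simp
  qed
  finally show "(kf y)\<^sup>2 < (k0f y)\<^sup>2" using ge by simp
qed

lemma pole_bound:
  assumes "r\<^sup>2 \<le> 3 * \<alpha>" "0 \<le> pole_num"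
  shows "2 * sqrt (Kf 0) \<le> kf 0" "0 < kf 0"
proof -
  show k: "0 < kf 0" using Pr_pos[of 0] SP_pos[of 0] SE_pos[of 0] D_pos by (simp add: kf_def)
  show "2 * sqrt (Kf 0) \<le> kf 0"
  proof (rule power2_le_imp_le[OF _ less_imp_le[OF k]])
    \<comment> \<open>The left side is \<open>B ^ 3 * (K - k^2 / 4)\<close> at the pole.\<close>
    have "pole_num - r\<^sup>2 * D = (r\<^sup>2 - 3 * \<alpha>) * (B - D)" unfolding pole_num_def by algebra
    also have "\<dots> \<le> 0" unfolding B_minus_D using assms m r_pos by (intro mult_nonpos_nonneg) auto
    finally have "pole_num / B ^ 3 \<le> r\<^sup>2 * D / B ^ 3" using B_pos by (intro divide_right_mono) auto
    moreover have "(kf 0)\<^sup>2 = 4 * (r\<^sup>2 * D / B ^ 3)"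
    proof -
      have "(4 * r * b)\<^sup>2 * D / (4 * (b\<^sup>2)\<^sup>2 * b) = 4 * (r\<^sup>2 * D / b ^ 3)" if "0 < b" for b
        using that by (simp add: power2_eq_square power3_eq_cube)
      from this[OF B_pos] show ?thesis
        by (simp add: kf_sq Pr_def surf_E_def surf_P_def)
    qed
    moreover have "(2 * sqrt (Kf 0))\<^sup>2 = 4 * (pole_num / B ^ 3)"
      using assms B_pos by (simp add: Kf_0 power_mult_distrib)
    ultimately show "(2 * sqrt (Kf 0))\<^sup>2 \<le> (kf 0)\<^sup>2" by linarith
  qed
qed

text \<open>Rules out an embedding when K is negative at the pole: the squared height derivative of
  its profile would be negative nearby.\<close>

lemma W_neg_near_pole:
  assumes "pole_num < 0"
  shows "\<forall>\<^sub>F y in at_right 0. W y < 0"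
proof -
  have "(W \<longlongrightarrow> W 0) (at_right 0)"
    using continuous_on_surf(4)[of UNIV] by (auto simp: continuous_on_def intro:
      tendsto_within_subset)
  moreover have "W 0 < 0" unfolding W_0 by (rule mult_pos_neg[OF zero_less_power[OF B_pos] assms])
  ultimately show ?thesis by (rule order_tendstoD)
qed

text \<open>If \<open>pole_num > 0\<close>, the limit is the value at 0, where \<open>W\<close> and
  \<open>KN\<close> agree. If \<open>pole_num = 0\<close>, then \<open>k0f\<close> is of the form 0
  / 0; writing \<open>sqrt (W y)\<close> as \<open>sqrt y * sqrt (W y / y)\<close> shows that it
  behaves like \<open>sqrt y * (W' + K')\<close> divided by a positive constant. So it tends to 0,
  which is then the value of \<open>2 * sqrt (Kf 0)\<close>.\<close>

lemma k0f_at_pole: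
  assumes pole_num: "0 \<le> pole_num" and R: "r\<^sup>2 \<le> 3 * \<alpha>"
  shows "(k0f \<longlongrightarrow> 2 * sqrt (Kf 0)) (at_right 0)" "\<forall>\<^sub>F y in at_right 0. 0 < W y"
proof -
  have tend: "(f \<longlongrightarrow> f 0) (at_right 0)" if "continuous_on UNIV f" for f :: "real \<Rightarrow> real"
    using that by (auto simp: continuous_on_def intro: tendsto_within_subset)
  note tW = tend[OF continuous_on_surf(4)] and tK = tend[OF continuous_on_surf(5)]
    and tE = tend[OF continuous_on_surf(1)] and tP = tend[OF continuous_on_surf(2)]
  have EP: "SE 0 = B" "SP 0 = B\<^sup>2" by (simp_all add: surf_E_def surf_P_def)
  have "(k0f \<longlongrightarrow> 2 * sqrt (Kf 0)) (at_right 0) \<and> (\<forall>\<^sub>F y in at_right 0. 0 < W y)"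
  proof (cases "pole_num = 0")
    case False
    then have k: "0 < pole_num" using pole_num by simp
    have W0: "0 < W 0" unfolding W_0 by (rule mult_pos_pos[OF zero_less_power[OF B_pos] k])
    have "(k0f \<longlongrightarrow> (W 0 + KN 0) / (sqrt (W 0) * sqrt (SE 0 ^ 3) * SP 0)) (at_right 0)"
      unfolding k0f_def[abs_def] using W0 B_pos by (intro tendsto_intros tW tK tE tP)
        (auto simp: EP)
    also have "(W 0 + KN 0) / (sqrt (W 0) * sqrt (SE 0 ^ 3) * SP 0) = 2 * sqrt (Kf 0)"
    proof -
      have "2 * (s * s) / (s * x * p) = 2 * (s / (x * p))" if "s \<noteq> 0" for s x p :: real
        using that by simp
      moreover have "W 0 + KN 0 = 2 * (sqrt (W 0) * sqrt (W 0))" "sqrt (W 0) \<noteq> 0"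
        using W0 by (simp add: W_0 KN_0) (use W0 in simp)
      ultimately have "(W 0 + KN 0) / (sqrt (W 0) * sqrt (SE 0 ^ 3) * SP 0) = 2 * (sqrt (W 0)
        / (sqrt (SE 0 ^ 3) * SP 0))"
        by metis
      also have "sqrt (W 0) / (sqrt (SE 0 ^ 3) * SP 0) = sqrt (Kf 0)"
        using SP_pos[of 0] by (simp add: Kf_def W_0 KN_0 real_sqrt_divide real_sqrt_mult)
      finally show ?thesis .
    qed
    finally show ?thesis using order_tendstoD(1)[OF tW W0] by blast
  next
    case True
    then have z: "W 0 = 0" "KN 0 = 0" by (simp_all add: W_0 KN_0)
    \<comment> \<open>Derivative at 0 of the Bernstein form in \<open>surf_W_pos\<close>:
      \<open>B^2\<close> times its second coefficient minus \<open>4 B^4\<close> times its first,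
      which is \<open>pole_num\<close>.\<close>
    define W' where "W' = B\<^sup>2 * (6 * \<alpha>\<^sup>2 * B\<^sup>2 + 2 * \<alpha>\<^sup>2 * B * D - 4 * \<alpha>\<^sup>2 * D\<^sup>2
      - 16 * \<alpha> * B ^ 3 + 8 * \<alpha> * B\<^sup>2 * D + 4 * B ^ 4) - 4 * B ^ 4 * pole_num"
    have dW: "(W has_real_derivative W') (at 0)"
      unfolding surf_W_def[abs_def] surf_H1_def surf_E_def W'_def pole_num_def
      by (rule derivative_eq_intros refl)+ (simp, algebra)
    \<comment> \<open>Only the existence of this derivative matters: in the limit it is multiplied
      by \<open>sqrt 0\<close>.\<close>
    obtain K' where dK: "(KN has_real_derivative K') (at 0)"
      unfolding surf_K_num_def[abs_def] surf_H1_def surf_E_def surf_P_def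
      by (atomize_elim, rule exI, (rule derivative_eq_intros refl)+)
    \<comment> \<open>Here \<open>W\<close> and \<open>K\<close> both vanish at the pole; \<open>W' > 0\<close> makes \<open>K / \<kappa>\<close> tend to 0.\<close>
    have W'pos: "0 < W'"
    proof -
      obtain d x where d: "0 < \<alpha>" "0 \<le> d" "d < 1" and B: "B = \<alpha> * (4 - d)" and D: "D = \<alpha> * x"
        and k: "pole_num = \<alpha>\<^sup>2 * (3 * x - d * (4 - d))"
        using near_ratios[OF R pole_num] .
      \<comment> \<open>The vanishing of \<open>pole_num\<close> determines \<open>D\<close>. What
        remains of \<open>W'\<close> is a polynomial in \<open>d\<close>, which has positive
        coefficients once expanded in \<open>1 - d\<close> and \<open>d\<close>.\<close>
      have x: "x = d * (4 - d) / 3" using True d(1) unfolding k by simp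
      have "9 * W' = 2 * B\<^sup>2 * \<alpha> ^ 4 * (432 * (1 - d) ^ 4 + 1176 * (1 - d) ^ 3 * d
          + 1195 * (1 - d)\<^sup>2 * d\<^sup>2 + 537 * (1 - d) * d ^ 3 + 90 * d ^ 4)"
        unfolding W'_def True B D x by (simp add: field_simps) algebra
      also have "0 < \<dots>" using B_pos d by (intro mult_pos_pos add_pos_nonneg) auto
      finally show ?thesis by simp
    qed
    have qW: "((\<lambda>y. W y / y) \<longlongrightarrow> W') (at_right 0)"
      using dW z by (auto simp: has_field_derivative_iff intro: tendsto_within_subset)
    have qK: "((\<lambda>y. KN y / y) \<longlongrightarrow> K') (at_right 0)"
      using dK z by (auto simp: has_field_derivative_iff intro: tendsto_within_subset)
    have ty: "((\<lambda>y::real. y) \<longlongrightarrow> 0) (at_right 0)" by (rule tendsto_ident_at)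
    have "((\<lambda>y. sqrt y * (W y / y + KN y / y) / (sqrt (W y / y) * sqrt (SE y ^ 3) * SP y))
       \<longlongrightarrow> sqrt 0 * (W' + K') / (sqrt W' * sqrt (SE 0 ^ 3) * SP 0)) (at_right 0)"
      using W'pos B_pos by (intro tendsto_intros qW qK tE tP ty) (auto simp: EP)
    moreover have "\<forall>\<^sub>F y in at_right 0.
      sqrt y * (W y / y + KN y / y) / (sqrt (W y / y) * sqrt (SE y ^ 3) * SP y) = k0f y"
    proof (rule eventually_mono[OF eventually_at_right_less[of 0]])
      fix y :: real assume "0 < y"
      then have s: "sqrt y \<noteq> 0" "y = sqrt y * sqrt y" by simp_all
      have "s * (w / (s * s) + k / (s * s)) / (q / s * e * p) = (w + k) / (q * e * p)"
        if "s \<noteq> 0" for s w k q e p :: real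
        using that by (simp add: add_divide_distrib[symmetric])
      from this[OF s(1), folded s(2)]
      show "sqrt y * (W y / y + KN y / y) / (sqrt (W y / y) * sqrt (SE y ^ 3) * SP y) = k0f y"
        by (simp only: k0f_def real_sqrt_divide)
    qed
    ultimately have "(k0f \<longlongrightarrow> 0) (at_right 0)"
      by (simp add: tendsto_cong)
    moreover have "\<forall>\<^sub>F y in at_right 0. 0 < W y"
      using order_tendstoD(1)[OF qW W'pos] eventually_at_right_less[of 0]
      by eventually_elim (simp add: zero_less_divide_iff)
    ultimately show ?thesis by (simp add: Kf_0 True)
  qed
  then show "(k0f \<longlongrightarrow> 2 * sqrt (Kf 0)) (at_right 0)" "\<forall>\<^sub>F y in at_right 0. 0 < W y" by auto
qed

end

section \<open>Mean curvature of an arbitrary embedding\<close>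

lemma has_vector_derivative_chain_partial:
  fixes f :: "real^'n::finite \<Rightarrow> 'b::real_normed_vector"
  assumes f: "f differentiable (at (\<gamma> t))" and \<gamma>: "(\<gamma> has_vector_derivative v) (at t)"
  shows "((\<lambda>s. f (\<gamma> s)) has_vector_derivative (\<Sum>i\<in>UNIV. (v $ i) *\<^sub>R partial_deriv i f (\<gamma> t))) (at t)"
proof -
  have "(f has_derivative (\<lambda>h. \<Sum>i\<in>UNIV. (h $ i) *\<^sub>R partial_deriv i f (\<gamma> t))) (at (\<gamma> t)
    within range \<gamma>)"
    using differentiable_imp_partial[OF f] by (rule has_derivative_at_withinI)
  from vector_derivative_diff_chain_within[OF \<gamma> this] show ?thesis
    by (simp add: o_def)
qed

definition meridian :: "real \<Rightarrow> real^3"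
  where "meridian \<theta> = vector [sin \<theta>, 0, cos \<theta>]"

lemma meridian_nth [simp]: "meridian \<theta> $ 1 = sin \<theta>" "meridian \<theta> $ 2 = 0" "meridian \<theta> $ 3 = cos \<theta>"
  by (simp_all add: meridian_def)

lemma meridian_in_sphere: "meridian \<theta> \<in> sphere 0 1"
  by (simp add: norm_eq_1 inner_vec_def sum_3 power2_eq_square[symmetric])

lemma spherical_coords_eq: "spherical_coords p = rotate_axis (p $ 2) (meridian (p $ 1))"
  by (simp add: spherical_coords_def vec_eq_iff forall_3 mult.commute)

lemma meridian_deriv: "(meridian has_vector_derivative vector [cos \<theta>, 0, - sin \<theta>]) (at \<theta>)"
  unfolding has_vector_derivative_vec_iff by (auto simp: forall_3 intro!: derivative_eq_intros)

lemma profile_twice_differentiable: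
  fixes e :: "real^3 \<Rightarrow> real^3"
  assumes U: "open U" "sphere 0 1 \<subseteq> U" and C: "\<And>k. C_k_on k U e"
  obtains c' c'' where "\<And>\<theta>. ((\<lambda>\<theta>. e (meridian \<theta>)) has_vector_derivative c' \<theta>) (at \<theta>)"
    "\<And>\<theta>. (c' has_vector_derivative c'' \<theta>) (at \<theta>)"
proof -
  have mU: "meridian \<theta> \<in> U" for \<theta> using U(2) meridian_in_sphere by blast
  have d: "e differentiable (at (meridian \<theta>))" "partial_deriv i e differentiable (at (meridian
    \<theta>))" for i \<theta>
    using C[of 2] mU by (auto simp: numeral_2_eq_2)
  define c' where "c' \<theta> = cos \<theta> *\<^sub>R partial_deriv 1 e (meridian \<theta>)
    - sin \<theta> *\<^sub>R partial_deriv 3 e (meridian \<theta>)" for \<theta>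
  have 1: "((\<lambda>\<theta>. e (meridian \<theta>)) has_vector_derivative c' \<theta>) (at \<theta>)" for \<theta>
    using has_vector_derivative_chain_partial[OF d(1) meridian_deriv, of \<theta>]
    by (simp add: sum_3 c'_def)
  have "\<exists>D. (c' has_vector_derivative D) (at \<theta>)" for \<theta>
  proof -
    note p1 = has_vector_derivative_chain_partial[OF d(2)[of 1] meridian_deriv, of \<theta>]
      and p3 = has_vector_derivative_chain_partial[OF d(2)[of 3] meridian_deriv, of \<theta>]
    show ?thesis unfolding c'_def[abs_def]
      by (rule exI has_vector_derivative_diff has_vector_derivative_scaleR p1 p3 DERIV_cos
        DERIV_sin)+
  qed
  then obtain c'' where "\<And>\<theta>. (c' has_vector_derivative c'' \<theta>) (at \<theta>)" by metis
  with 1 show ?thesis by (rule that)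
qed

text \<open>Used to differentiate the isometry equations: \<open>f\<close> is an expression in the
  profile curve, \<open>g\<close> a metric coefficient with known derivative.\<close>

lemma DERIV_eq_on_open:
  fixes f g :: "real \<Rightarrow> real"
  assumes "open S" "x \<in> S" "\<And>u. u \<in> S \<Longrightarrow> f u = g u"
    and "(f has_real_derivative D) (at x)" "(g has_real_derivative D') (at x)"
  shows "D = D'"
  using has_field_derivative_transform_within_open[OF assms(4,1,2,3)] assms(5)
    by (rule DERIV_unique)

context kerr_exterior
begin

lemma W_formula:
  assumes \<theta>: "\<theta> \<in> {0<..<pi}"
  shows "kerr_Sigma2 a r \<theta> - (kH' \<theta>)\<^sup>2 / (4 * kerr_H m a r \<theta>) =
    (sin \<theta>)\<^sup>2 * W ((sin \<theta>)\<^sup>2) / (SE ((sin \<theta>)\<^sup>2) ^ 3 * SP ((sin \<theta>)\<^sup>2))"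
proof -
  define y where "y = (sin \<theta>)\<^sup>2"
  have y: "0 < y" "y \<le> 1" using sin_gt_zero[of \<theta>] \<theta> by (auto simp: y_def)
  define e p h where "e = SE y" and "p = SP y" and "h = H1 y"
  have pos: "0 < e" "0 < p" using SE_pos SP_pos y by (auto simp: e_def p_def)
  have 2: "(kH' \<theta>)\<^sup>2 = 4 * y * (1 - y) * h\<^sup>2 / e ^ 4"
    unfolding kH'_sq y_def h_def e_def ..
  have W: "y * W y = e ^ 4 * p - (1 - y) * h\<^sup>2"
    using surf_W_identity[of y \<alpha> B D] by (simp add: e_def p_def h_def)
  show ?thesis
    unfolding 2 kerr_Sigma2_eq kerr_H_eq y_def[symmetric] W
    unfolding e_def[symmetric] p_def[symmetric]
    using pos y by (simp add: divide_simps power2_eq_square power3_eq_cube power4_eq_xxxx)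
qed

end

locale kerr_embedding = kerr_exterior +
  fixes t :: real and e \<nu> :: "real^3 \<Rightarrow> real^3"
  assumes e: "axisymmetric_isometric_embedding (surface_metric m a t r) e"
    and \<nu>: "outward_unit_normal e \<nu>"
begin

text \<open>\<open>\<kappa>\<close> is the principal curvature along the parallels.\<close>

definition "c \<theta> = e (meridian \<theta>)"
definition "n \<theta> = \<nu> (meridian \<theta>)"
definition "mc \<theta> = mean_curvature euclidean_metric (e \<circ> spherical_coords) (\<nu> \<circ> spherical_coords)
  (vector [\<theta>, 0])"
definition "\<kappa> \<theta> = (n \<theta> $ 1 * c \<theta> $ 1 + n \<theta> $ 2 * c \<theta> $ 2) / kerr_H m a r \<theta>"

lemma e_spherical: "e \<circ> spherical_coords = (\<lambda>p::real^2. rotate_axis (p $ 2) (c (p $ 1)))"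
  using e meridian_in_sphere
  by (auto simp: axisymmetric_isometric_embedding_def spherical_coords_eq c_def)

text \<open>By axial symmetry everything is determined by the image of one meridian. The isometry
  equations and their derivatives are the hypotheses of
  \<open>revolution_curvature_identities\<close>. Its first identity turns
  \<open>y * W y / (SE y ^ 3 * SP y)\<close> into the square of the height derivative; where
  \<open>W\<close> is positive, that derivative is nonzero and the Gauss equation can be divided by
  \<open>\<kappa>\<close>. The metric fixes \<open>\<kappa>\<close> only up to sign, hence the
  factor \<open>sgn\<close>.\<close>

lemma curvature_data:
  assumes \<theta>: "\<theta> \<in> {0<..<pi}"
  shows "0 \<le> W ((sin \<theta>)\<^sup>2)"
    and "0 < W ((sin \<theta>)\<^sup>2) \<Longrightarrow> \<kappa> \<theta> \<noteq> 0"
    and "0 < W ((sin \<theta>)\<^sup>2) \<Longrightarrow> mc \<theta> = sgn (\<kappa> \<theta>) * k0f ((sin \<theta>)\<^sup>2)"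
proof -
  obtain U where U: "open U" "sphere 0 1 \<subseteq> U" and C: "\<And>k. C_k_on k U e"
    using e by (auto simp: axisymmetric_isometric_embedding_def)
  obtain c' c'' where c': "\<And>\<theta>. (c has_vector_derivative c' \<theta>) (at \<theta>)"
    and c'': "\<And>\<theta>. (c' has_vector_derivative c'' \<theta>) (at \<theta>)"
    using profile_twice_differentiable[OF U C] unfolding c_def[symmetric, abs_def] by metis
  note dc = c'[unfolded has_vector_derivative_vec_iff, rule_format]
    and dc' = c''[unfolded has_vector_derivative_vec_iff, rule_format]
  have met: "induced_metric euclidean_metric (\<lambda>p::real^2. rotate_axis (p $ 2) (c (p $ 1)))
    (vector [\<theta>, 0])
    = diag_matrix (\<lambda>i. if i = 1 then kerr_Sigma2 a r \<theta> else kerr_H m a r \<theta>)" if "\<theta> \<in> {0<..<pi}"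
      for \<theta>
    using e that unfolding axisymmetric_isometric_embedding_def e_spherical surface_metric_diag
      by (simp cong: if_cong)
  have met': "(\<chi> i j. (if i = (1::2) then c' \<theta> else rot90 (c \<theta>)) \<bullet> (if j = (1::2)
    then c' \<theta> else rot90 (c \<theta>)))
    = diag_matrix (\<lambda>i. if i = 1 then kerr_Sigma2 a r \<theta> else kerr_H m a r \<theta>)" if "\<theta> \<in> {0<..<pi}"
      for \<theta>
    using met[OF that] induced_metric_revolution[of c "c' \<theta>" "vector [\<theta>, 0]"]
      c' by (simp cong: if_cong)
  have g11: "(c' \<theta> $ 1)\<^sup>2 + (c' \<theta> $ 2)\<^sup>2 + (c' \<theta> $ 3)\<^sup>2 = kerr_Sigma2 a r \<theta>"
    and g12: "c \<theta> $ 1 * c' \<theta> $ 2 = c \<theta> $ 2 * c' \<theta> $ 1"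
    and g22: "(c \<theta> $ 1)\<^sup>2 + (c \<theta> $ 2)\<^sup>2 = kerr_H m a r \<theta>" if "\<theta> \<in> {0<..<pi}" for \<theta>
    using met'[OF that] by (auto simp: vec_eq_iff forall_2 inner_vec_def sum_3 power2_eq_square
      algebra_simps)
  have S: "open {0<..<pi}" by simp
  have h': "c \<theta> $ 1 * c' \<theta> $ 1 + c \<theta> $ 2 * c' \<theta> $ 2 = kH' \<theta> / 2" if "\<theta> \<in> {0<..<pi}" for \<theta>
  proof -
    have "2 * (c \<theta> $ 1 * c' \<theta> $ 1 + c \<theta> $ 2 * c' \<theta> $ 2) = kH' \<theta>"
      by (rule DERIV_eq_on_open[OF S that g22 _ H_deriv])
         (auto intro!: derivative_eq_intros dc simp: power2_eq_square algebra_simps)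
    then show ?thesis by simp
  qed
  have h'': "(c' \<theta> $ 1)\<^sup>2 + (c' \<theta> $ 2)\<^sup>2 + c \<theta> $ 1 * c'' \<theta> $ 1 + c \<theta> $ 2 * c'' \<theta> $ 2 = kH'' \<theta> / 2"
    by (rule DERIV_eq_on_open[OF S \<theta> h' _ DERIV_cdivide[OF H_deriv2]])
       (auto intro!: derivative_eq_intros dc dc' simp: power2_eq_square algebra_simps)
  have e': "c' \<theta> $ 1 * c'' \<theta> $ 1 + c' \<theta> $ 2 * c'' \<theta> $ 2 + c' \<theta> $ 3 * c'' \<theta> $ 3 = Sigma2' \<theta> / 2"
  proof -
    have "2 * (c' \<theta> $ 1 * c'' \<theta> $ 1 + c' \<theta> $ 2 * c'' \<theta> $ 2 + c' \<theta> $ 3 * c'' \<theta> $ 3) = Sigma2' \<theta>"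
      by (rule DERIV_eq_on_open[OF S \<theta> g11 _ Sigma2_deriv])
         (auto intro!: derivative_eq_intros dc' simp: power2_eq_square algebra_simps)
    then show ?thesis by simp
  qed
  have sph: "spherical_coords (vector [\<theta>, 0]) = meridian \<theta>" by (simp add: spherical_coords_eq)
  have orth: "partial_deriv i (\<lambda>p::real^2. rotate_axis (p $ 2) (c (p $ 1))) (vector [\<theta>, 0])
    \<bullet> n \<theta> = 0" for i
  proof -
    have "partial_deriv i (\<lambda>p::real^2. rotate_axis (p $ 2) (c (p $ 1))) (vector [\<theta>, 0])
        \<bullet> \<nu> (spherical_coords (vector [\<theta>, 0])) = 0"
      using \<nu> \<theta> unfolding outward_unit_normal_def e_spherical by blast
    then show ?thesis by (simp add: sph n_def)
  qed
  have n1: "c' \<theta> \<bullet> n \<theta> = 0"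
    using orth[of 1] partial_deriv_revolution[of c "c' \<theta>" "vector [\<theta>, 0]"]
      c' by (simp cong: if_cong)
  have n2: "rot90 (c \<theta>) \<bullet> n \<theta> = 0"
    using orth[of 2] partial_deriv_revolution_angle[of c "vector [\<theta>, 0]"] by simp
  have n3: "n \<theta> \<bullet> n \<theta> = 1"
    using \<nu> meridian_in_sphere by (auto simp: outward_unit_normal_def n_def norm_eq_1)
  note ids = revolution_curvature_identities[OF g22[OF \<theta>] H_pos[OF \<theta>] g11[OF \<theta>]
    Sigma2_pos h'[OF \<theta>] h'' e' g12[OF \<theta>],
      of "n \<theta> $ 1" "n \<theta> $ 2" "n \<theta> $ 3"]
  have nn: "(n \<theta> $ 1)\<^sup>2 + (n \<theta> $ 2)\<^sup>2 + (n \<theta> $ 3)\<^sup>2 = 1"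
    "n \<theta> $ 2 * c \<theta> $ 1 = n \<theta> $ 1 * c \<theta> $ 2"
    "n \<theta> $ 1 * c' \<theta> $ 1 + n \<theta> $ 2 * c' \<theta> $ 2 + n \<theta> $ 3 * c' \<theta> $ 3 = 0"
    using n1 n2 n3 by (simp_all add: inner_vec_def sum_3 power2_eq_square algebra_simps)
  note ids = ids[OF nn]
  define y where "y = (sin \<theta>)\<^sup>2"
  have y: "0 < y" "y \<le> 1" using sin_gt_zero[of \<theta>] \<theta> by (auto simp: y_def)
  note pos = SE_pos[OF y(2)] SP_pos[OF y(2)]
  have d3: "y * W y / (SE y ^ 3 * SP y) = (c' \<theta> $ 3)\<^sup>2"
    using ids(1) W_formula[OF \<theta>] by (simp add: y_def)
  then have "0 \<le> y * W y / (SE y ^ 3 * SP y)" by simp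
  moreover have den: "0 < SE y ^ 3 * SP y" by (intro mult_pos_pos zero_less_power pos)
  ultimately have "0 \<le> y * W y" by (simp only: pos_le_divide_eq[OF den] mult_zero_left)
  then show "0 \<le> W ((sin \<theta>)\<^sup>2)"
    using y by (simp add: y_def[symmetric] zero_le_mult_iff)
  have \<kappa>2: "(\<kappa> \<theta>)\<^sup>2 = W y / (SE y ^ 3 * (SP y)\<^sup>2)"
  proof -
    have "(\<kappa> \<theta>)\<^sup>2 * kerr_H m a r \<theta> * kerr_Sigma2 a r \<theta> = y * W y / (SE y ^ 3 * SP y)"
      using ids(2) d3 by (simp add: \<kappa>_def)
    moreover have "kerr_H m a r \<theta> * kerr_Sigma2 a r \<theta> = y * SP y"
      using pos by (simp add: kerr_H_eq kerr_Sigma2_eq y_def[symmetric])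
    ultimately have "(\<kappa> \<theta>)\<^sup>2 * (y * SP y) = y * W y / (SE y ^ 3 * SP y)" by (simp add: mult.assoc)
    then show ?thesis using y pos by (simp add: field_simps power2_eq_square)
  qed
  assume W: "0 < W ((sin \<theta>)\<^sup>2)"
  then have Wy: "0 < W y" by (simp add: y_def)
  have "0 < (\<kappa> \<theta>)\<^sup>2" unfolding \<kappa>2 using Wy pos by (intro divide_pos_pos mult_pos_pos zero_less_power)
  then show nz: "\<kappa> \<theta> \<noteq> 0" by simp
  have "0 < y * W y / (SE y ^ 3 * SP y)" using Wy pos y by (intro divide_pos_pos mult_pos_pos
    zero_less_power)
  then have "c' \<theta> $ 3 \<noteq> 0" unfolding d3 by simp
  from ids(3)[OF this]
  have M\<kappa>: "(- (n \<theta> \<bullet> c'' \<theta>) / kerr_Sigma2 a r \<theta> + \<kappa> \<theta>) * \<kappa> \<theta> = (\<kappa> \<theta>)\<^sup>2 + Kf y"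
    unfolding curvature_formula[OF \<theta>] y_def \<kappa>_def by (simp add: inner_vec_def sum_3)
  have M: "mc \<theta> = - (n \<theta> \<bullet> c'' \<theta>) / kerr_Sigma2 a r \<theta> + \<kappa> \<theta>"
  proof -
    have "mc \<theta> = - (c'' \<theta> \<bullet> n \<theta>) / kerr_Sigma2 a r \<theta> - (rot90 (rot90 (c \<theta>)) \<bullet> n \<theta>) / kerr_H m a r \<theta>"
      unfolding mc_def e_spherical
      using mean_curvature_revolution[OF open_UNIV, of "vector [\<theta>, 0]" c c' "c'' \<theta>",
        OF _ c' _ met[OF \<theta>] Sigma2_pos H_pos[OF \<theta>]]
        c'' sph by (simp add: n_def o_def)
    moreover have "rot90 (rot90 (c \<theta>)) \<bullet> n \<theta> = - (n \<theta> $ 1 * c \<theta> $ 1 + n \<theta> $ 2 * c \<theta> $ 2)"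
      by (simp add: inner_vec_def sum_3 algebra_simps)
    then have "(rot90 (rot90 (c \<theta>)) \<bullet> n \<theta>) / kerr_H m a r \<theta> = - \<kappa> \<theta>"
      unfolding \<kappa>_def by (simp only: minus_divide_left)
    ultimately show ?thesis by (simp add: inner_commute)
  qed
  have abs: "\<bar>\<kappa> \<theta>\<bar> = sqrt (W y) / (sqrt (SE y ^ 3) * SP y)"
  proof -
    have "\<bar>\<kappa> \<theta>\<bar> = sqrt ((\<kappa> \<theta>)\<^sup>2)" by simp
    then show ?thesis unfolding \<kappa>2 using pos by (simp add: real_sqrt_divide real_sqrt_mult)
  qed
  have F: "\<bar>\<kappa> \<theta>\<bar> * k0f y = (\<kappa> \<theta>)\<^sup>2 + Kf y"
  proof -
    have "\<bar>\<kappa> \<theta>\<bar> * k0f y = (W y + KN y) / (sqrt (SE y ^ 3) * SP y * (sqrt (SE y ^ 3) * SP y))"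
      unfolding abs k0f_def using Wy by simp
    also have "sqrt (SE y ^ 3) * SP y * (sqrt (SE y ^ 3) * SP y) = SE y ^ 3 * (SP y)\<^sup>2"
      using pos by (simp add: power2_eq_square mult_ac)
    finally show ?thesis unfolding \<kappa>2 Kf_def by (simp add: add_divide_distrib)
  qed
  have "mc \<theta> * \<kappa> \<theta> = \<bar>\<kappa> \<theta>\<bar> * k0f y" using M M\<kappa> F by simp
  also have "\<dots> = (sgn (\<kappa> \<theta>) * k0f y) * \<kappa> \<theta>" by (simp add: abs_sgn)
  finally show "mc \<theta> = sgn (\<kappa> \<theta>) * k0f ((sin \<theta>)\<^sup>2)" using nz by (simp add: y_def)
qed

end

section \<open>The sign of the curvature along the parallels and the limit of k_0 at a pole\<close>

context kerr_embedding
begin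

text \<open>Serves to show that \<open>\<kappa>\<close> keeps its sign on an interval on which
  \<open>W\<close> is positive.\<close>

lemma \<kappa>_continuous: "continuous_on {0<..<pi} \<kappa>"
proof -
  obtain U where U: "open U" "sphere 0 1 \<subseteq> U" and C: "\<And>k. C_k_on k U e"
    using e by (auto simp: axisymmetric_isometric_embedding_def)
  have mer: "continuous_on {0<..<pi} meridian"
    using meridian_deriv by (auto intro!: continuous_at_imp_continuous_on
      has_vector_derivative_continuous)
  have sub: "meridian ` {0<..<pi} \<subseteq> sphere 0 1" using meridian_in_sphere by auto
  have "continuous_on U e"
    using C[of 1] by (auto intro!: continuous_at_imp_continuous_on
      differentiable_imp_continuous_within)
  then have "continuous_on {0<..<pi} c"
    unfolding c_def[abs_def] by (rule continuous_on_compose2[OF _ mer]) (use sub U(2) in blast)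
  moreover have "continuous_on (sphere 0 1) \<nu>" using \<nu> by (simp add: outward_unit_normal_def)
  then have "continuous_on {0<..<pi} n"
    unfolding n_def[abs_def] by (rule continuous_on_compose2[OF _ mer sub])
  moreover have "continuous_on {0<..<pi} (kerr_H m a r)"
    using H_deriv by (auto intro!: continuous_at_imp_continuous_on DERIV_isCont)
  ultimately show ?thesis
    unfolding \<kappa>_def[abs_def]
    by (intro continuous_intros ballI) (assumption | rule less_imp_neq[THEN not_sym, OF H_pos])+
qed

lemma filterlim_sin_sq: "filterlim (\<lambda>\<theta>::real. (sin \<theta>)\<^sup>2) (at_right 0) (at_right 0)"
proof -
  have "((\<lambda>\<theta>::real. (sin \<theta>)\<^sup>2) \<longlongrightarrow> (sin 0)\<^sup>2) (at_right 0)"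
    by (intro tendsto_intros)
  moreover have "\<forall>\<^sub>F \<theta>::real in at_right 0. 0 < (sin \<theta>)\<^sup>2"
    using eventually_at_right_less[of "0::real"] eventually_at_right_real[OF pi_gt_zero]
    by eventually_elim (use sin_gt_zero in force)
  ultimately show ?thesis by (simp add: tendsto_imp_filterlim_at_right)
qed

text \<open>Near the pole \<open>W\<close> is positive, so \<open>\<kappa>\<close> is continuous
  without zeros and has a constant sign \<open>\<sigma>\<close>. Thus \<open>k_0\<close> tends to
  \<open>\<sigma> * (2 * sqrt (Kf 0))\<close>, and for either value of \<open>\<sigma>\<close> this
  respects the bound.\<close>

lemma k0_at_pole:
  assumes R: "r\<^sup>2 \<le> 3 * \<alpha>"
  shows "0 \<le> pole_num" and "embedding_k0 e \<nu> 0 \<le> 2 * sqrt (Kf 0)"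
proof -
  have ev: "\<forall>\<^sub>F \<theta> in at_right 0. P ((sin \<theta>)\<^sup>2)" if "\<forall>\<^sub>F y in at_right 0. P y" for P :: "real \<Rightarrow> bool"
    using filterlim_sin_sq that by (simp add: filterlim_iff)
  have evpi: "\<forall>\<^sub>F \<theta> in at_right 0. \<theta> \<in> {0<..<pi}" by (rule eventually_at_right_real) simp
  show pole_num: "0 \<le> pole_num"
  proof (rule ccontr)
    assume "\<not> 0 \<le> pole_num"
    then have "\<forall>\<^sub>F \<theta> in at_right 0. W ((sin \<theta>)\<^sup>2) < 0" by (intro ev W_neg_near_pole) simp
    with evpi have "\<forall>\<^sub>F \<theta>::real in at_right 0. False"
      by eventually_elim (use curvature_data(1) in force)
    then show False by simp
  qed
  note F = k0f_at_pole[OF pole_num R]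
  have "\<forall>\<^sub>F \<theta> in at_right 0. 0 < W ((sin \<theta>)\<^sup>2) \<and> \<theta> \<in> {0<..<pi}"
    using ev[OF F(2)] evpi by eventually_elim auto
  then obtain b where b: "0 < b" and W: "\<And>\<theta>. 0 < \<theta> \<Longrightarrow> \<theta> < b \<Longrightarrow> 0 < W ((sin \<theta>)\<^sup>2) \<and> \<theta> \<in> {0<..<pi}"
    unfolding eventually_at_right_field by blast
  have "\<exists>\<sigma>. (\<sigma> = 1 \<or> \<sigma> = - 1) \<and> (\<forall>\<theta>\<in>{0<..<b}. sgn (\<kappa> \<theta>) = \<sigma>)"
  proof -
    have cont: "continuous_on {0<..<b} \<kappa>" by (rule continuous_on_subset[OF \<kappa>_continuous])
      (use W in auto)
    then have conn: "connected (\<kappa> ` {0<..<b})" by (intro connected_continuous_image) auto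
    have nz: "0 \<notin> \<kappa> ` {0<..<b}" using W curvature_data(2) by fastforce
    have "\<not> (\<kappa> x < 0 \<and> 0 < \<kappa> y)" if "x \<in> {0<..<b}" "y \<in> {0<..<b}" for x y
      using connectedD_interval[OF conn, of "\<kappa> x" "\<kappa> y" 0] nz that by (metis imageI less_imp_le)
    then have "(\<forall>\<theta>\<in>{0<..<b}. 0 < \<kappa> \<theta>) \<or> (\<forall>\<theta>\<in>{0<..<b}. \<kappa> \<theta> < 0)"
      using nz by (metis imageI linorder_neqE_linordered_idom)
    then show ?thesis by (metis sgn_neg sgn_pos)
  qed
  then obtain \<sigma> where \<sigma>: "\<sigma> = 1 \<or> \<sigma> = - 1" "\<And>\<theta>. \<theta> \<in> {0<..<b} \<Longrightarrow> sgn (\<kappa> \<theta>) = \<sigma>" by blast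
  have "((\<lambda>\<theta>. \<sigma> * k0f ((sin \<theta>)\<^sup>2)) \<longlongrightarrow> \<sigma> * (2 * sqrt (Kf 0))) (at_right 0)"
    by (intro tendsto_intros filterlim_compose[OF F(1) filterlim_sin_sq])
  moreover have "\<forall>\<^sub>F \<theta> in at_right 0. \<sigma> * k0f ((sin \<theta>)\<^sup>2) = mc \<theta>"
    using eventually_at_right_real[OF b] by eventually_elim (use W \<sigma>(2) curvature_data(3) in auto)
  ultimately have "(mc \<longlongrightarrow> \<sigma> * (2 * sqrt (Kf 0))) (at_right 0)"
    by (rule Lim_transform_eventually)
  moreover have "at 0 within {0<..<pi} = at_right 0"
    by (rule at_within_nhd[of _ "{..<pi}"]) auto
  ultimately have "Lim (at 0 within {0<..<pi}) mc = \<sigma> * (2 * sqrt (Kf 0))"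
    by (simp add: tendsto_Lim)
  then have "embedding_k0 e \<nu> 0 = \<sigma> * (2 * sqrt (Kf 0))"
    by (simp add: embedding_k0_def extend_to_poles_def mc_def[abs_def])
  moreover have "0 \<le> Kf 0" using pole_num B_pos by (simp add: Kf_0 zero_le_divide_iff)
  ultimately show "embedding_k0 e \<nu> 0 \<le> 2 * sqrt (Kf 0)" using \<sigma>(1) by auto
qed

lemma k0_gt_k_imp:
  assumes "\<forall>\<theta>\<in>{0..pi}. embedding_k0 e \<nu> \<theta> - surface_k m a t r \<theta> > 0"
  shows "3 * \<alpha> < r\<^sup>2"
proof (rule ccontr)
  assume "\<not> 3 * \<alpha> < r\<^sup>2"
  then have R: "r\<^sup>2 \<le> 3 * \<alpha>" by simp
  have "embedding_k0 e \<nu> 0 \<le> kf 0"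
    using k0_at_pole[OF R] pole_bound[OF R] by linarith
  moreover have "kf 0 < embedding_k0 e \<nu> 0" using bspec[OF assms, of 0] by (simp add: surface_k_eq)
  ultimately show False by simp
qed

text \<open>Positivity of \<open>\<kappa>\<close> settles the sign in \<open>curvature_data\<close>;
  the explicit embedding and normal constructed below have it by design.\<close>

lemma k0_gt_k:
  assumes R: "3 * \<alpha> < r\<^sup>2" and pos: "\<And>\<theta>. \<theta> \<in> {0<..<pi} \<Longrightarrow> 0 < \<kappa> \<theta>" and \<theta>: "\<theta> \<in> {0..pi}"
  shows "embedding_k0 e \<nu> \<theta> - surface_k m a t r \<theta> > 0"
proof -
  have "embedding_k0 e \<nu> \<theta> = k0f ((sin \<theta>)\<^sup>2)"
    unfolding embedding_k0_def mc_def[symmetric]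
  proof (rule extend_to_poles_eq[OF continuous_on_sin_sq_comp[OF k0f_continuous[OF R]] _ \<theta>])
    fix \<theta> assume "\<theta> \<in> {0<..<pi}"
    then show "mc \<theta> = k0f ((sin \<theta>)\<^sup>2)"
      using curvature_data(3)[of \<theta>] pos[of \<theta>] W_pos[OF R] by simp
  qed
  then show ?thesis using kf_less_k0f[OF R, of "(sin \<theta>)\<^sup>2"] \<theta> by (simp add: surface_k_eq)
qed

end

section \<open>Smoothness of axially symmetric maps\<close>

text \<open>Existence of \<open>n\<close> successive derivatives on \<open>I\<close>, with the
  derivative as an existential witness so that closure properties follow from the differentiation
  rules. At 0 nothing is required, not even continuity; this is why \<open>C_k_on k\<close> below is
  derived from \<open>smooth_real (Suc k)\<close>.\<close>

primrec smooth_real :: "nat \<Rightarrow> real set \<Rightarrow> (real \<Rightarrow> real) \<Rightarrow> bool"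
  where
    "smooth_real 0 I f \<longleftrightarrow> True"
  | "smooth_real (Suc n) I f \<longleftrightarrow>
       (\<exists>f'. (\<forall>x\<in>I. (f has_real_derivative f' x) (at x)) \<and> smooth_real n I f')"

lemma smooth_realI:
  "(\<And>x. x \<in> I \<Longrightarrow> (f has_real_derivative f' x) (at x)) \<Longrightarrow> smooth_real n I f' \<Longrightarrow> smooth_real (Suc n) I f"
  by auto

lemma smooth_real_Suc_imp: "smooth_real (Suc n) I f \<Longrightarrow> smooth_real n I f"
  by (induction n arbitrary: f) auto

lemma smooth_real_const: "smooth_real n I (\<lambda>x. c)"
proof (induction n arbitrary: c)
  case (Suc n)
  show ?case by (rule smooth_realI[OF _ Suc.IH[of 0]]) simp
qed simp

lemma smooth_real_ident: "smooth_real n I (\<lambda>x. x)"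
proof (cases n)
  case (Suc k)
  show ?thesis unfolding Suc by (rule smooth_realI[OF _ smooth_real_const[of _ _ 1]]) simp
qed simp

lemma smooth_real_add:
  "smooth_real n I f \<Longrightarrow> smooth_real n I g \<Longrightarrow> smooth_real n I (\<lambda>x. f x + g x)"
proof (induction n arbitrary: f g)
  case (Suc n)
  obtain f' g' where "\<And>x. x \<in> I \<Longrightarrow> (f has_real_derivative f' x) (at x)" "smooth_real n I f'"
    "\<And>x. x \<in> I \<Longrightarrow> (g has_real_derivative g' x) (at x)" "smooth_real n I g'"
    using Suc.prems by auto
  then show ?case by (intro smooth_realI[OF DERIV_add Suc.IH])
qed simp

lemma smooth_real_mult:
  "smooth_real n I f \<Longrightarrow> smooth_real n I g \<Longrightarrow> smooth_real n I (\<lambda>x. f x * g x)"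
proof (induction n arbitrary: f g)
  case (Suc n)
  obtain f' g' where "\<And>x. x \<in> I \<Longrightarrow> (f has_real_derivative f' x) (at x)" "smooth_real n I f'"
    "\<And>x. x \<in> I \<Longrightarrow> (g has_real_derivative g' x) (at x)" "smooth_real n I g'"
    using Suc.prems by auto
  then show ?case
    by (intro smooth_realI[OF DERIV_mult smooth_real_add]
      Suc.IH smooth_real_Suc_imp[OF Suc.prems(1)]
        smooth_real_Suc_imp[OF Suc.prems(2)])
qed simp

lemma smooth_real_diff:
  "smooth_real n I f \<Longrightarrow> smooth_real n I g \<Longrightarrow> smooth_real n I (\<lambda>x. f x - g x)"
  using smooth_real_add[of n I f "\<lambda>x. - 1 * g x"] smooth_real_mult[OF smooth_real_const[of n I
    "- 1"]]
  by simp

lemma smooth_real_power: "smooth_real n I f \<Longrightarrow> smooth_real n I (\<lambda>x. f x ^ k)"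
  by (induction k) (auto intro: smooth_real_const smooth_real_mult)

text \<open>The derivative of \<open>inverse f\<close> is built from \<open>f'\<close> and
  \<open>inverse f\<close> itself, and the latter is covered at the lower order by the induction
  hypothesis. The square root is treated in the same way.\<close>

lemma smooth_real_inverse:
  assumes "smooth_real n I f" "\<And>x. x \<in> I \<Longrightarrow> f x \<noteq> 0"
  shows "smooth_real n I (\<lambda>x. inverse (f x))"
  using assms
proof (induction n arbitrary: f)
  case (Suc n)
  obtain f' where f': "\<And>x. x \<in> I \<Longrightarrow> (f has_real_derivative f' x) (at x)" "smooth_real n I f'"
    using Suc.prems by auto
  have "smooth_real n I (\<lambda>x. inverse (f x))"
    using Suc.IH[OF smooth_real_Suc_imp[OF Suc.prems(1)] Suc.prems(2)] .
  then have "smooth_real n I (\<lambda>x. - 1 * (inverse (f x) * f' x * inverse (f x)))"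
    by (intro smooth_real_mult smooth_real_const f'(2))
  moreover have "((\<lambda>x. inverse (f x)) has_real_derivative - 1 * (inverse (f x)
    * f' x * inverse (f x))) (at x)"
    if "x \<in> I" for x
    using DERIV_inverse'[OF f'(1)[OF that] Suc.prems(2)[OF that]] by simp
  ultimately show ?case by (rule smooth_realI[rotated])
qed simp

lemma smooth_real_divide:
  "smooth_real n I f \<Longrightarrow> smooth_real n I g \<Longrightarrow> (\<And>x. x \<in> I \<Longrightarrow> g x \<noteq> 0) \<Longrightarrow> smooth_real n I (\<lambda>x. f x / g x)"
  unfolding divide_inverse by (intro smooth_real_mult smooth_real_inverse)

lemma smooth_real_sqrt:
  assumes "smooth_real n I f" "\<And>x. x \<in> I \<Longrightarrow> 0 < f x"
  shows "smooth_real n I (\<lambda>x. sqrt (f x))"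
  using assms
proof (induction n arbitrary: f)
  case (Suc n)
  obtain f' where f': "\<And>x. x \<in> I \<Longrightarrow> (f has_real_derivative f' x) (at x)" "smooth_real n I f'"
    using Suc.prems by auto
  have s: "smooth_real n I (\<lambda>x. 2 * sqrt (f x))"
    by (rule smooth_real_mult[OF smooth_real_const Suc.IH[OF smooth_real_Suc_imp[OF
      Suc.prems(1)] Suc.prems(2)]])
  have "2 * sqrt (f x) \<noteq> 0" if "x \<in> I" for x using Suc.prems(2)[OF that] by simp
  from smooth_real_divide[OF f'(2) s this]
  have "smooth_real n I (\<lambda>x. f' x / (2 * sqrt (f x)))" .
  moreover have "((\<lambda>x. sqrt (f x)) has_real_derivative f' x / (2 * sqrt (f x))) (at x)"
    if "x \<in> I" for x
    using f'(1)[OF that] Suc.prems(2)[OF that]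
    by (auto intro!: derivative_eq_intros simp: divide_simps)
  ultimately show ?case by (rule smooth_realI[rotated])
qed simp

lemma C_k_on_cong:
  assumes U: "open U" and eq: "\<And>x. x \<in> U \<Longrightarrow> f x = g x"
  shows "C_k_on k U f \<Longrightarrow> C_k_on k U g"
  using eq
proof (induction k arbitrary: f g)
  case 0
  then show ?case using continuous_on_cong[of U U f g] by simp
next
  case (Suc k)
  have "g differentiable (at x)" if x: "x \<in> U" for x
  proof -
    obtain D where "(f has_derivative D) (at x)" using Suc.prems(1)
      x by (auto simp: differentiable_def)
    then have "(g has_derivative D) (at x)"
      by (rule has_derivative_transform_within_open[OF _ U x Suc.prems(2)])
    then show ?thesis by (auto simp: differentiable_def)
  qed
  moreover have "C_k_on k U (partial_deriv i g)" for i
  proof (rule Suc.IH)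
    show "C_k_on k U (partial_deriv i f)" using Suc.prems by simp
    show "partial_deriv i f x = partial_deriv i g x" if "x \<in> U" for x
      by (rule partial_deriv_cong) (use Suc.prems U that in \<open>auto simp: eventually_nhds\<close>)
  qed
  ultimately show ?case by simp
qed

lemma vector_3_axis: "(vector [x, y, z] :: real^3) = x *\<^sub>R axis 1 1 + y *\<^sub>R axis 2 1 + z *\<^sub>R axis 3 1"
  by (simp add: vec_eq_iff forall_3 axis_def)

text \<open>An axially symmetric map has \<open>f1 = f3\<close> and \<open>f2 = f4 = 0\<close>, but
  its partial derivatives in the horizontal directions lose that symmetry. The family with five
  functions is closed under all three partial derivatives, so smoothness can be proved by induction
  within it.\<close>

lemma partial_deriv_axial:
  fixes x :: "real^3"
  assumes "(f1 has_real_derivative d1) (at (x $ 3))" "(f2 has_real_derivative d2) (at (x $ 3))"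
    "(f3 has_real_derivative d3) (at (x $ 3))" "(f4 has_real_derivative d4) (at (x $ 3))"
    "(f5 has_real_derivative d5) (at (x $ 3))"
  defines "F \<equiv> \<lambda>x::real^3. (vector [x $ 1 * f1 (x $ 3) + f2 (x $ 3), x $ 2 * f3 (x $ 3) +
    f4 (x $ 3), f5 (x $ 3)] :: real^3)"
  shows "partial_deriv 1 F x = vector [f1 (x $ 3), 0, 0]"
    and "partial_deriv 2 F x = vector [0, f3 (x $ 3), 0]"
    and "partial_deriv 3 F x = vector [x $ 1 * d1 + d2, x $ 2 * d3 + d4, d5]"
    and "F differentiable (at x)"
proof -
  have sh: "((\<lambda>s. f (x $ 3 + s)) has_real_derivative d) (at 0)"
    if "(f has_real_derivative d) (at (x $ 3))" for f d
    using that DERIV_shift[of f d 0 "x $ 3"] by (simp add: add.commute)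
  show "partial_deriv 1 F x = vector [f1 (x $ 3), 0, 0]"
    unfolding F_def by (rule partial_deriv_eqI)
      (auto simp: has_vector_derivative_vec_iff forall_3 axis_def intro!: derivative_eq_intros)
  show "partial_deriv 2 F x = vector [0, f3 (x $ 3), 0]"
    unfolding F_def by (rule partial_deriv_eqI)
      (auto simp: has_vector_derivative_vec_iff forall_3 axis_def intro!: derivative_eq_intros)
  show "partial_deriv 3 F x = vector [x $ 1 * d1 + d2, x $ 2 * d3 + d4, d5]"
    unfolding F_def by (rule partial_deriv_eqI)
      (auto simp: has_vector_derivative_vec_iff forall_3 axis_def intro!: derivative_eq_intros
        sh[OF assms(1)]
        sh[OF assms(2)] sh[OF assms(3)] sh[OF assms(4)] sh[OF assms(5)])
  have nth: "((\<lambda>x::real^3. x $ i) has_derivative (\<lambda>h. h $ i)) (at x)" for i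
    by (rule bounded_linear.has_derivative[OF bounded_linear_vec_nth has_derivative_ident])
  have comp: "(\<lambda>x::real^3. f (x $ 3)) differentiable (at x)"
    if "(f has_real_derivative d) (at (x $ 3))" for f d
    using DERIV_compose_FDERIV[OF that nth] by (auto simp: differentiable_def)
  have nthd: "(\<lambda>x::real^3. x $ i) differentiable (at x)" for i
    using nth by (auto simp: differentiable_def)
  show "F differentiable (at x)"
    unfolding F_def vector_3_axis
    by (intro differentiable_add differentiable_scaleR differentiable_mult differentiable_const nthd
        comp[OF assms(1)] comp[OF assms(2)] comp[OF assms(3)] comp[OF assms(4)] comp[OF assms(5)])
qed

lemma C_k_on_axial:
  assumes I: "open I"
    and "smooth_real (Suc k) I f1" "smooth_real (Suc k) I f2" "smooth_real (Suc k) I f3"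
      "smooth_real (Suc k) I f4" "smooth_real (Suc k) I f5"
  shows "C_k_on k {x. x $ 3 \<in> I}
    (\<lambda>x::real^3. (vector [x $ 1 * f1 (x $ 3) + f2 (x $ 3), x $ 2 * f3 (x $ 3) + f4 (x $ 3),
      f5 (x $ 3)] :: real^3))"
  using assms(2-)
proof (induction k arbitrary: f1 f2 f3 f4 f5)
  case 0
  then obtain d1 d2 d3 d4 d5 where d: "\<And>u. u \<in> I \<Longrightarrow> (f1 has_real_derivative d1 u) (at u)"
    "\<And>u. u \<in> I \<Longrightarrow> (f2 has_real_derivative d2 u) (at u)"
    "\<And>u. u \<in> I \<Longrightarrow> (f3 has_real_derivative d3 u) (at u)"
    "\<And>u. u \<in> I \<Longrightarrow> (f4 has_real_derivative d4 u) (at u)"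
    "\<And>u. u \<in> I \<Longrightarrow> (f5 has_real_derivative d5 u) (at u)"
    unfolding smooth_real.simps(2) by metis
  show ?case
    unfolding C_k_on.simps
    by (intro continuous_at_imp_continuous_on ballI differentiable_imp_continuous_within
        partial_deriv_axial(4)[OF d]) simp_all
next
  case (Suc k)
  let ?F = "\<lambda>f1 f2 f3 f4 f5. \<lambda>x::real^3.
    (vector [x $ 1 * f1 (x $ 3) + f2 (x $ 3), x $ 2 * f3 (x $ 3) + f4 (x $ 3), f5 (x $ 3)]
      :: real^3)"
  let ?U = "{x :: real^3. x $ 3 \<in> I}"
  obtain d1 d2 d3 d4 d5 where d: "\<And>u. u \<in> I \<Longrightarrow> (f1 has_real_derivative d1 u) (at u)"
    "\<And>u. u \<in> I \<Longrightarrow> (f2 has_real_derivative d2 u) (at u)"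
    "\<And>u. u \<in> I \<Longrightarrow> (f3 has_real_derivative d3 u) (at u)"
    "\<And>u. u \<in> I \<Longrightarrow> (f4 has_real_derivative d4 u) (at u)"
    "\<And>u. u \<in> I \<Longrightarrow> (f5 has_real_derivative d5 u) (at u)"
    and sd: "smooth_real (Suc k) I d1" "smooth_real (Suc k) I d2" "smooth_real (Suc k) I d3"
      "smooth_real (Suc k) I d4" "smooth_real (Suc k) I d5"
    using Suc.prems unfolding smooth_real.simps(2)[of "Suc k"] by metis
  note sf = Suc.prems[THEN smooth_real_Suc_imp]
  have U: "open ?U"
    using open_vimage_vec_nth[OF I, of 3] by (simp add: vimage_def)
  note z = smooth_real_const[of "Suc k" I 0]
  have "C_k_on k ?U (partial_deriv i (?F f1 f2 f3 f4 f5))" for i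
  proof -
    consider "i = 1" | "i = 2" | "i = 3" using exhaust_3[of i] by blast
    then show ?thesis
    proof cases
      case 1
      show ?thesis unfolding 1
        by (rule C_k_on_cong[OF U _ Suc.IH[OF z sf(1) z z z]])
          (simp add: partial_deriv_axial(1)[OF d])
    next
      case 2
      show ?thesis unfolding 2
        by (rule C_k_on_cong[OF U _ Suc.IH[OF z z z sf(3) z]])
          (simp add: partial_deriv_axial(2)[OF d])
    next
      case 3
      show ?thesis unfolding 3
        by (rule C_k_on_cong[OF U _ Suc.IH[OF sd]]) (simp add: partial_deriv_axial(3)[OF d])
    qed
  qed
  then show ?case by (simp add: partial_deriv_axial(4)[OF d])
qed

text \<open>The ray is connected and unbounded, so it forces the component of \<open>p\<close> in
  the complement to be unbounded.\<close>

lemma ray_subset_imp_outside: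
  fixes p d :: "'a::real_normed_vector"
  assumes d: "d \<noteq> 0" and ray: "\<And>k. 0 \<le> k \<Longrightarrow> p + k *\<^sub>R d \<notin> S"
  shows "p \<in> outside S"
proof -
  let ?R = "(\<lambda>k. p + k *\<^sub>R d) ` {0..}"
  have "connected ?R" by (intro connected_continuous_image continuous_intros) simp
  moreover have "p \<in> ?R" by (rule image_eqI[of _ _ 0]) simp_all
  moreover have "?R \<subseteq> - S" using ray by auto
  ultimately have sub: "?R \<subseteq> connected_component_set (- S) p"
    by (intro connected_component_maximal)
  have "\<not> bounded ?R"
  proof
    assume "bounded ?R"
    then obtain M where M: "\<And>k. 0 \<le> k \<Longrightarrow> norm (p + k *\<^sub>R d) \<le> M" by (auto simp: bounded_iff)
    define k where "k = (\<bar>M\<bar> + norm p + 1) / norm d"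
    have k: "0 \<le> k" "k * norm d = \<bar>M\<bar> + norm p + 1" using d by (simp_all add: k_def)
    have "norm (k *\<^sub>R d) \<le> norm (p + k *\<^sub>R d) + norm p"
      using norm_triangle_ineq4[of "p + k *\<^sub>R d" p] by simp
    then show False using M[OF k(1)] k by simp
  qed
  then have "\<not> bounded (connected_component_set (- S) p)" using sub bounded_subset by blast
  moreover have "p \<notin> S" using ray[of 0] by simp
  ultimately show ?thesis by (simp add: outside_def)
qed

section \<open>Construction of the embedding\<close>

locale kerr_far = kerr_exterior +
  assumes far: "3 * a\<^sup>2 < r\<^sup>2"
begin

text \<open>In terms of \<open>z = cos \<theta>\<close> the embedded sphere has the profile \<open>(sin \<theta> * prof z, height z)\<close>,
  which is smooth
  across the poles because \<open>prof\<close> and \<open>height\<close> are smooth near \<open>[-1, 1]\<close>. The antiderivative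
  \<open>height\<close> is taken on \<open>(-2, 2)\<close> only to have room around \<open>[-1, 1]\<close>.\<close>

definition "prof z = sqrt (SP (1 - z\<^sup>2) / SE (1 - z\<^sup>2))"
definition "slope z = sqrt (W (1 - z\<^sup>2) / (SE (1 - z\<^sup>2) ^ 3 * SP (1 - z\<^sup>2)))"
definition "height = (SOME f. \<forall>z\<in>{-2<..<2}. (f has_real_derivative slope z) (at z))"
text \<open>\<open>curv\<close> is the positive root of the value that the metric imposes on
  \<open>\<kappa>\<^sup>2\<close>; the horizontal part of the unit normal is the profile radius
  times it. \<open>n_axis\<close> is then the axial component solved from orthogonality to the
  meridian. \<open>W\<close> cancels in this quotient.\<close>

definition "curv z = sqrt (W (1 - z\<^sup>2)) / (sqrt (SE (1 - z\<^sup>2) ^ 3) * SP (1 - z\<^sup>2))"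
definition "n_axis z = z * H1 (1 - z\<^sup>2) / ((SE (1 - z\<^sup>2))\<^sup>2 * sqrt (SP (1 - z\<^sup>2)))"
definition emb :: "real^3 \<Rightarrow> real^3"
  where "emb q = vector [q $ 1 * prof (q $ 3), q $ 2 * prof (q $ 3), height (q $ 3)]"
definition nrm :: "real^3 \<Rightarrow> real^3"
  where "nrm q = vector [q $ 1 * (prof (q $ 3) * curv (q $ 3)), q $ 2 * (prof (q $ 3)
    * curv (q $ 3)), n_axis (q $ 3)]"

lemma pos: "0 < SE (1 - z\<^sup>2)" "0 < SP (1 - z\<^sup>2)"
  using SE_pos[of "1 - z\<^sup>2"] SP_pos[of "1 - z\<^sup>2"] by simp_all

lemma den_pos: "0 < SE (1 - z\<^sup>2) ^ 3 * SP (1 - z\<^sup>2)"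
  using pos by (intro mult_pos_pos zero_less_power)

lemma W_pos': "0 < W (1 - z\<^sup>2)" if "z \<in> {-1..1}"
  using that by (intro W_pos[OF far]) (auto simp: abs_square_le_1)

lemma prof_pos: "0 < prof z" unfolding prof_def using pos by simp

lemma prof_sq: "(prof z)\<^sup>2 = SP (1 - z\<^sup>2) / SE (1 - z\<^sup>2)"
  unfolding prof_def using pos[of z] by (simp add: less_imp_le)

lemma slope_pos: "0 < slope z" if "z \<in> {-1..1}"
  unfolding slope_def using W_pos'[OF that] den_pos by simp

lemma curv_pos: "0 < curv z" if "z \<in> {-1..1}"
  unfolding curv_def using W_pos'[OF that] pos[of z] by simp

lemma continuous_on_surf_comp: "continuous_on A (\<lambda>z. SE (1 - z\<^sup>2))"
  "continuous_on A (\<lambda>z. SP (1 - z\<^sup>2))"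
  "continuous_on A (\<lambda>z. H1 (1 - z\<^sup>2))" "continuous_on A (\<lambda>z. W (1 - z\<^sup>2))"
  unfolding surf_defs[abs_def] by (intro continuous_intros)+

lemma pos_neq: "SE (1 - z\<^sup>2) \<noteq> 0" "SP (1 - z\<^sup>2) \<noteq> 0" using pos[of z] by simp_all

lemma continuous_profile: "continuous_on A prof" "continuous_on A slope" "continuous_on A curv"
  "continuous_on A n_axis"
  unfolding prof_def[abs_def] slope_def[abs_def] curv_def[abs_def] n_axis_def[abs_def]
  by (intro continuous_intros continuous_on_surf_comp ballI; simp add: pos_neq)+

lemma height_deriv: "(height has_real_derivative slope z) (at z)" if "z \<in> {-2<..<2}"
proof -
  obtain g where g: "\<And>x. x \<in> {-2..2} \<Longrightarrow> (g has_vector_derivative slope x) (at x within {-2..2})"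
    using antiderivative_continuous[OF continuous_profile(2), of "-2" 2] by blast
  have "(g has_real_derivative slope z) (at z)" if z: "z \<in> {-2<..<2}" for z
    using g[of z] z at_within_Icc_at[of "-2" z 2]
    by (simp add: has_real_derivative_iff_has_vector_derivative)
  then have "\<exists>f. \<forall>z\<in>{-2<..<2}. (f has_real_derivative slope z) (at z)" by blast
  from someI_ex[OF this] show ?thesis using that unfolding height_def by blast
qed

lemma smooth_SE: "smooth_real n I (\<lambda>z. SE (1 - z\<^sup>2))"
  and smooth_SP: "smooth_real n I (\<lambda>z. SP (1 - z\<^sup>2))"
  unfolding surf_E_def surf_P_def
  by (intro smooth_real_diff smooth_real_mult smooth_real_const smooth_real_power
    smooth_real_ident)+

lemma smooth_W: "smooth_real n I (\<lambda>z. W (1 - z\<^sup>2))"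
  unfolding surf_W_def surf_H1_def surf_E_def
  by (intro smooth_real_diff smooth_real_add smooth_real_mult smooth_real_const
    smooth_real_power smooth_real_ident)

lemma emb_smooth: "\<exists>U. open U \<and> sphere 0 1 \<subseteq> U \<and> (\<forall>k. C_k_on k U emb)"
proof -
  \<comment> \<open>Positivity of \<open>W\<close> is known for \<open>z\<close> in
    \<open>[-1, 1]\<close> only. By continuity it persists on an open set around that interval, and
    there the square root in \<open>slope\<close> is smooth.\<close>
  define I where "I = {-2<..<2} \<inter> {z. 0 < W (1 - z\<^sup>2)}"
  have "open {z. 0 < W (1 - z\<^sup>2)}"
    by (intro open_Collect_less continuous_on_surf_comp continuous_on_const)
  then have I: "open I" unfolding I_def by (intro open_Int) auto
  have prof: "smooth_real k I prof" for k
    unfolding prof_def[abs_def]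
    by (intro smooth_real_sqrt smooth_real_divide smooth_SE smooth_SP divide_pos_pos pos pos_neq)
  have slope: "smooth_real k I slope" for k
    unfolding slope_def[abs_def]
    by (intro smooth_real_sqrt smooth_real_divide smooth_real_mult smooth_real_power smooth_W
      smooth_SE smooth_SP)
       (use den_pos in \<open>auto simp: I_def pos_neq intro!: divide_pos_pos\<close>)
  have height: "smooth_real (Suc k) I height" for k
    by (rule smooth_realI[OF _ slope]) (auto simp: I_def intro: height_deriv)
  have "C_k_on k {x. x $ 3 \<in> I} emb" for k
    using C_k_on_axial[OF I prof smooth_real_const[of _ _ 0] prof smooth_real_const[of _ _ 0]
      height, of k]
    by (simp add: emb_def[abs_def])
  moreover have "open {x :: real^3. x $ 3 \<in> I}"
    using open_vimage_vec_nth[OF I, of 3] by (simp add: vimage_def)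
  moreover have "sphere 0 1 \<subseteq> {x :: real^3. x $ 3 \<in> I}"
  proof
    fix x :: "real^3" assume "x \<in> sphere 0 1"
    then have "\<bar>x $ 3\<bar> \<le> 1" using component_le_norm_cart[of x 3] by simp
    then have "x $ 3 \<in> {-1..1}" by auto
    then show "x \<in> {x :: real^3. x $ 3 \<in> I}" using W_pos' by (auto simp: I_def)
  qed
  ultimately show ?thesis by blast
qed

lemma sphere_sq: "(q $ 1)\<^sup>2 + (q $ 2)\<^sup>2 = 1 - (q $ 3)\<^sup>2" and sphere_3: "q $ 3 \<in> {-1..1}"
  if "q \<in> sphere 0 1" for q :: "real^3"
proof -
  have "q \<bullet> q = 1" using that by (simp add: norm_eq_1)
  then show "(q $ 1)\<^sup>2 + (q $ 2)\<^sup>2 = 1 - (q $ 3)\<^sup>2" by (simp add: inner_vec_def sum_3 power2_eq_square)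
  show "q $ 3 \<in> {-1..1}" using that component_le_norm_cart[of q 3] by auto
qed

lemma height_strict_mono: "height u < height v" if "-1 \<le> u" "u < v" "v \<le> 1"
  by (rule DERIV_pos_imp_increasing[OF that(2)]) (use that in \<open>auto intro!: height_deriv
    slope_pos exI\<close>)

lemma height_eq_iff: "height u = height v \<longleftrightarrow> u = v" if "u \<in> {-1..1}" "v \<in> {-1..1}"
  using height_strict_mono[of u v] height_strict_mono[of v u]
    that by (cases u v rule: linorder_cases) auto

lemma emb_inj: "inj_on emb (sphere 0 1)"
proof (rule inj_onI)
  fix p q assume pq: "p \<in> sphere 0 1" "q \<in> sphere 0 1" and eq: "emb p = emb q"
  have "emb p $ i = emb q $ i" for i using eq by simp
  from this[of 1] this[of 2] this[of 3]
  have e: "p $ 1 * prof (p $ 3) = q $ 1 * prof (q $ 3)" "p $ 2 * prof (p $ 3) =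
    q $ 2 * prof (q $ 3)"
    "height (p $ 3) = height (q $ 3)" by (simp_all add: emb_def)
  then have "p $ 3 = q $ 3" using height_eq_iff sphere_3 pq by blast
  with e prof_pos[of "q $ 3"] show "p = q" by (simp add: vec_eq_iff forall_3)
qed

lemma emb_rotate: "emb (rotate_axis \<phi> q) = rotate_axis \<phi> (emb q)"
  by (simp add: emb_def vec_eq_iff forall_3 algebra_simps)

lemma nrm_rotate: "nrm (rotate_axis \<phi> q) = rotate_axis \<phi> (nrm q)"
  by (simp add: nrm_def vec_eq_iff forall_3 algebra_simps)

lemma cos_sq_le: "1 - (cos (\<theta>::real))\<^sup>2 = (sin \<theta>)\<^sup>2" by (simp add: cos_squared_eq)

lemma profile_eq: "sin \<theta> * prof (cos \<theta>) = sqrt (kerr_H m a r \<theta>)" if "\<theta> \<in> {0<..<pi}"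
  using sin_gt_zero[of \<theta>] that by (simp add: prof_def cos_sq_le kerr_H_eq real_sqrt_mult
    real_sqrt_divide)

definition "tangent \<theta> = (vector [kH' \<theta> / (2 * sqrt (kerr_H m a r \<theta>)), 0,
  - (sin \<theta> * slope (cos \<theta>))] :: real^3)"

lemma profile_deriv: "((\<lambda>\<theta>. emb (meridian \<theta>)) has_vector_derivative tangent \<theta>) (at \<theta>)"
  if \<theta>: "\<theta> \<in> {0<..<pi}"
proof -
  have "((\<lambda>\<theta>. sqrt (kerr_H m a r \<theta>)) has_real_derivative kH' \<theta> / (2 * sqrt (kerr_H m a r \<theta>)))
    (at \<theta>)"
    using H_deriv[of \<theta>] H_pos[OF \<theta>] by (auto intro!: derivative_eq_intros simp: divide_simps)
  then have 1: "((\<lambda>\<theta>. sin \<theta> * prof (cos \<theta>)) has_real_derivative kH' \<theta> / (2 * sqrt (kerr_H m a r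
    \<theta>))) (at \<theta>)"
    by (rule has_field_derivative_transform_within_open[of _ _ _ "{0<..<pi}"])
      (use \<theta> profile_eq in auto)
  have "-2 < cos \<theta>" "cos \<theta> < 2"
    by (rule less_le_trans[OF _ cos_ge_minus_one], simp) (rule le_less_trans[OF cos_le_one], simp)
  then have "cos \<theta> \<in> {-2<..<2}" by simp
  then have 3: "((\<lambda>\<theta>. height (cos \<theta>)) has_real_derivative - (sin \<theta> * slope (cos \<theta>))) (at \<theta>)"
    using DERIV_chain2[OF height_deriv DERIV_cos[of \<theta>]] by (simp add: mult.commute)
  show ?thesis
    unfolding has_vector_derivative_vec_iff using 1 3 by (simp add: forall_3 emb_def tangent_def)
qed

lemma slope_sq: "(slope (cos \<theta>))\<^sup>2 = W ((sin \<theta>)\<^sup>2) / (SE ((sin \<theta>)\<^sup>2) ^ 3 * SP ((sin \<theta>)\<^sup>2))"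
  using slope_pos[of "cos \<theta>"] by (simp add: slope_def cos_sq_le)

lemma emb_metric:
  assumes \<theta>: "\<theta> \<in> {0<..<pi}"
  shows "induced_metric euclidean_metric (emb \<circ> spherical_coords) (vector [\<theta>, \<phi>]) =
    surface_metric m a t r (vector [\<theta>, \<phi>])"
proof -
  have e: "emb \<circ> spherical_coords = (\<lambda>p::real^2. rotate_axis (p $ 2) (emb (meridian (p $ 1))))"
    by (auto simp: spherical_coords_eq emb_rotate)
  have H: "0 < kerr_H m a r \<theta>" by (rule H_pos[OF \<theta>])
  have "tangent \<theta> \<bullet> tangent \<theta> = (kH' \<theta>)\<^sup>2 / (4 * kerr_H m a r \<theta>) + (sin \<theta>)\<^sup>2 * (slope (cos \<theta>))\<^sup>2"
    using H by (simp add: tangent_def inner_vec_def sum_3 power2_eq_square)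
  also have "\<dots> = kerr_Sigma2 a r \<theta>"
    unfolding slope_sq using W_formula[OF \<theta>] by simp
  finally have 1: "tangent \<theta> \<bullet> tangent \<theta> = kerr_Sigma2 a r \<theta>" .
  have 2: "rot90 (emb (meridian \<theta>)) \<bullet> rot90 (emb (meridian \<theta>)) = kerr_H m a r \<theta>"
    using H by (simp add: emb_def inner_vec_def sum_3 profile_eq[OF \<theta>])
  have 3: "tangent \<theta> \<bullet> rot90 (emb (meridian \<theta>)) = 0"
    by (simp add: tangent_def emb_def inner_vec_def sum_3)
  then have 4: "rot90 (emb (meridian \<theta>)) \<bullet> tangent \<theta> = 0" by (simp only: inner_commute)
  have "((\<lambda>\<theta>. emb (meridian \<theta>)) has_vector_derivative tangent \<theta>) (at ((vector [\<theta>, \<phi>] :: real^2)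
    $ 1))"
    using profile_deriv[OF \<theta>] by simp
  from induced_metric_revolution[OF this] show ?thesis
    unfolding e surface_metric_diag vec_eq_iff forall_2 by (simp add: 1 2 3 4)
qed

lemma emb_embedding: "axisymmetric_isometric_embedding (surface_metric m a t r) emb"
  unfolding axisymmetric_isometric_embedding_def
  using emb_smooth emb_inj emb_rotate emb_metric by auto

lemma curv_sq: "(curv z)\<^sup>2 = W (1 - z\<^sup>2) / (SE (1 - z\<^sup>2) ^ 3 * (SP (1 - z\<^sup>2))\<^sup>2)" if "z \<in> {-1..1}"
  unfolding curv_def using W_pos'[OF that] pos[of z] by (simp add: power_divide power_mult_distrib)

text \<open>The squared length is \<open>y * W y + (1 - y) * (H1 y)\<^sup>2\<close> over
  \<open>E ^ 4 * P\<close>, which \<open>surf_W_identity\<close> evaluates to 1.\<close>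

lemma nrm_norm: "norm (nrm q) = 1" if q: "q \<in> sphere 0 1"
proof -
  define y where "y = 1 - (q $ 3)\<^sup>2"
  define E P where "E = SE y" and "P = SP y"
  have EP: "0 < E" "0 < P" using pos[of "q $ 3"] by (simp_all add: E_def P_def y_def)
  have "nrm q \<bullet> nrm q = y * ((prof (q $ 3))\<^sup>2 * (curv (q $ 3))\<^sup>2) + (n_axis (q $ 3))\<^sup>2"
    unfolding y_def sphere_sq[OF q, symmetric]
    by (simp add: nrm_def inner_vec_def sum_3 power2_eq_square algebra_simps)
  also have "(prof (q $ 3))\<^sup>2 * (curv (q $ 3))\<^sup>2 = W y / (E ^ 4 * P)"
    unfolding prof_sq curv_sq[OF sphere_3[OF q]] y_def[symmetric] E_def[symmetric] P_def[symmetric]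
    using EP by (simp add: power2_eq_square power3_eq_cube power4_eq_xxxx)
  also have "(n_axis (q $ 3))\<^sup>2 = (1 - y) * (H1 y)\<^sup>2 / (E ^ 4 * P)"
    unfolding n_axis_def y_def[symmetric] E_def[symmetric] P_def[symmetric]
    using EP by (simp add: power_divide power_mult_distrib y_def power_mult[symmetric])
  also have "y * (W y / (E ^ 4 * P)) + (1 - y) * (H1 y)\<^sup>2 / (E ^ 4 * P) = (y * W y + (1 - y)
    * (H1 y)\<^sup>2) / (E ^ 4 * P)"
    by (simp add: add_divide_distrib)
  also have "\<dots> = 1" unfolding surf_W_identity using EP by (simp add: E_def P_def)
  finally show ?thesis by (simp add: norm_eq_1)
qed

lemma nrm_orthogonal:
  assumes \<theta>: "\<theta> \<in> {0<..<pi}"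
  shows "partial_deriv i (emb \<circ> spherical_coords) (vector [\<theta>, \<phi>])
    \<bullet> nrm (spherical_coords (vector [\<theta>, \<phi>])) = 0"
proof -
  have e: "emb \<circ> spherical_coords = (\<lambda>p::real^2. rotate_axis (p $ 2) (emb (meridian (p $ 1))))"
    by (auto simp: spherical_coords_eq emb_rotate)
  define y where "y = (sin \<theta>)\<^sup>2"
  define E P where "E = SE y" and "P = SP y"
  have cy: "1 - (cos \<theta>)\<^sup>2 = y" by (simp add: y_def cos_sq_le)
  have EP: "0 < E" "0 < P" using pos[of "cos \<theta>"] by (simp_all add: E_def P_def cy)
  have H: "0 < kerr_H m a r \<theta>" by (rule H_pos[OF \<theta>])
  have "tangent \<theta> \<bullet> nrm (meridian \<theta>) = kH' \<theta> / 2 * curv (cos \<theta>) - sin \<theta> * slope (cos \<theta>)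
    * n_axis (cos \<theta>)"
    using H by (simp add: tangent_def nrm_def inner_vec_def sum_3 mult.assoc[symmetric]
      profile_eq[OF \<theta>])
  also have "\<dots> = 0"
  proof -
    have "kH' \<theta> / 2 * curv (cos \<theta>) = sin \<theta> * cos \<theta> * H1 y / E\<^sup>2 * (sqrt (W y) / (sqrt (E ^ 3) * P))"
      by (simp add: kH'_def curv_def cy y_def[symmetric] E_def P_def)
    moreover have "sin \<theta> * slope (cos \<theta>) * n_axis (cos \<theta>)
        = sin \<theta> * (sqrt (W y) / (sqrt (E ^ 3) * sqrt P)) * (cos \<theta> * H1 y / (E\<^sup>2 * sqrt P))"
      by (simp add: slope_def n_axis_def cy E_def P_def real_sqrt_divide real_sqrt_mult)
    moreover have "\<dots> = sin \<theta> * cos \<theta> * H1 y / E\<^sup>2 * (sqrt (W y) / (sqrt (E ^ 3)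
      * (sqrt P * sqrt P)))"
    proof -
      have "s * (w / (x * p)) * (c * h / (e * p)) = s * c * h / e * (w / (x * (p * p)))"
        for s w x p c h e :: real
        by (simp add: mult_ac)
      then show ?thesis .
    qed
    ultimately show ?thesis using EP by simp
  qed
  finally have 1: "tangent \<theta> \<bullet> nrm (meridian \<theta>) = 0" .
  have 2: "rot90 (emb (meridian \<theta>)) \<bullet> nrm (meridian \<theta>) = 0"
    by (simp add: emb_def nrm_def inner_vec_def sum_3)
  have "i = 1 \<or> i = 2" using exhaust_2 by blast
  then show ?thesis
    unfolding e using partial_deriv_revolution[of "\<lambda>\<theta>. emb (meridian \<theta>)" "tangent \<theta>" "vector [\<theta>,
      \<phi>]"] profile_deriv[OF \<theta>]
      partial_deriv_revolution_angle[of "\<lambda>\<theta>. emb (meridian \<theta>)" "vector [\<theta>, \<phi>]"]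
    by (auto simp: spherical_coords_eq nrm_rotate 1 2)
qed

lemma nrm_continuous: "continuous_on A nrm"
proof -
  have nth: "continuous_on A (\<lambda>q::real^3. q $ i)" for i by (intro continuous_intros)
  have comp: "continuous_on A (\<lambda>q::real^3. f (q $ 3))" if "continuous_on UNIV f"
    for f :: "real \<Rightarrow> real"
    by (rule continuous_on_compose2[OF that nth]) simp
  show ?thesis
    unfolding nrm_def[abs_def] vector_3_axis
    by (intro continuous_intros nth comp[OF continuous_profile(1)]
      comp[OF continuous_profile(3)] comp[OF continuous_profile(4)])
qed

end

section \<open>The side of the embedded sphere to which the normal points\<close>

context kerr_far
begin

definition "radius_sq z = (1 - z\<^sup>2) * (prof z)\<^sup>2"

lemma radius_sq_deriv: "(radius_sq has_real_derivative - (2 * z * H1 (1 - z\<^sup>2) / (SE (1 - z\<^sup>2))\<^sup>2))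
  (at z)"
proof -
  have d: "((\<lambda>z. 1 - z\<^sup>2) has_real_derivative - 2 * z) (at z)"
    by (auto intro!: derivative_eq_intros)
  have "((\<lambda>z. (1 - z\<^sup>2) * SP (1 - z\<^sup>2) / SE (1 - z\<^sup>2)) has_real_derivative
      H1 (1 - z\<^sup>2) / (SE (1 - z\<^sup>2))\<^sup>2 * (- 2 * z)) (at z)"
    by (rule DERIV_chain2[OF H_of_sin_sq_deriv d]) simp
  then show ?thesis by (simp add: radius_sq_def[abs_def] prof_sq mult_ac)
qed

lemma emb_image:
  assumes "z \<in> emb ` sphere 0 1"
  obtains v where "v \<in> {-1..1}" "z $ 3 = height v" "(z $ 1)\<^sup>2 + (z $ 2)\<^sup>2 = radius_sq v"
proof -
  obtain q where q: "q \<in> sphere 0 1" "z = emb q" using assms by auto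
  have "(z $ 1)\<^sup>2 + (z $ 2)\<^sup>2 = ((q $ 1)\<^sup>2 + (q $ 2)\<^sup>2) * (prof (q $ 3))\<^sup>2"
    unfolding q(2) by (simp add: emb_def power_mult_distrib algebra_simps)
  also have "\<dots> = radius_sq (q $ 3)" unfolding sphere_sq[OF q(1)] radius_sq_def ..
  finally show ?thesis using that[of "q $ 3"] sphere_3[OF q(1)] q(2) by (simp add: emb_def)
qed

lemma height_inverse_deriv:
  assumes u: "-1 < u" "u < 1"
  shows "(inv_into {-1..1} height has_real_derivative inverse (slope u)) (at (height u))"
proof -
  let ?g = "inv_into {-1..1} height"
  have inj: "inj_on height {-1..1}" by (intro inj_onI) (simp add: height_eq_iff)
  then have g: "?g (height z) = z" if "z \<in> {-1..1}" for z using that by (rule inv_into_f_f)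
  have cont: "continuous_on {-1..1} height"
    by (intro continuous_at_imp_continuous_on ballI DERIV_isCont[OF height_deriv]) auto
  have onto: "height (?g y) = y" if y: "height (-1) < y" "y < height 1" for y
  proof -
    obtain x where "-1 \<le> x" "x \<le> 1" "height x = y"
      using IVT'[of height "-1" y 1] cont y by auto
    then show ?thesis by (intro f_inv_into_f) auto
  qed
  have "isCont ?g (height u)"
  proof (rule isCont_inverse_function[where d = "min (u + 1) (1 - u)" and f = height and x = u])
    show "0 < min (u + 1) (1 - u)" using u by simp
    show "?g (height z) = z" if "\<bar>z - u\<bar> \<le> min (u + 1) (1 - u)" for z
      using that u by (intro g) auto
    show "isCont height z" if "\<bar>z - u\<bar> \<le> min (u + 1) (1 - u)" for z
      using that u by (intro DERIV_isCont[OF height_deriv]) auto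
  qed
  moreover have "(height has_real_derivative slope u) (at (?g (height u)))"
    using height_deriv[of u] u by (simp add: g)
  moreover have "slope u \<noteq> 0" using slope_pos[of u] u by simp
  ultimately show ?thesis
    using height_strict_mono[of "-1" u] height_strict_mono[of u 1] u onto
    by (intro DERIV_inverse_function[where a = "height (-1)" and b = "height 1"]) auto
qed

text \<open>A point pushed along the normal lies farther from the axis than the part of the surface
  at its new height. To first order the difference \<open>\<Phi>\<close> of squared radii grows by
  \<open>2 * curv u * radius_sq u\<close> from the horizontal motion. The vertical motion adds a
  nonnegative amount, because \<open>n_axis u\<close> and the derivative of \<open>radius_sq\<close>
  at \<open>u\<close> never have the same strict sign. If no \<open>v\<close> has the new height,
  there is nothing to compare.\<close>

lemma radius_sq_less:
  assumes u: "-1 < u" "u < 1"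
  shows "\<forall>\<^sub>F s in at_right 0. \<forall>v\<in>{-1..1}. height v = height u + s * n_axis u \<longrightarrow>
    radius_sq v < radius_sq u * (1 + s * curv u)\<^sup>2"
proof -
  let ?g = "inv_into {-1..1} height"
  have inj: "inj_on height {-1..1}" by (intro inj_onI) (simp add: height_eq_iff)
  then have g: "?g (height z) = z" if "z \<in> {-1..1}" for z using that by (rule inv_into_f_f)
  define y where "y = 1 - u\<^sup>2"
  define E P where "E = SE y" and "P = SP y"
  have y: "0 < y" using u by (simp add: y_def abs_square_less_1)
  have EP: "0 < E" "0 < P" using pos[of u] by (simp_all add: E_def P_def y_def)
  have sl: "0 < slope u" and cu: "0 < curv u" using slope_pos curv_pos u by auto
  define \<Phi> where "\<Phi> s = radius_sq u * (1 + s * curv u)\<^sup>2 - radius_sq (?g (height u +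
    s * n_axis u))" for s
  have d1: "((\<lambda>s. height u + s * n_axis u) has_real_derivative n_axis u) (at 0)"
    by (auto intro!: derivative_eq_intros)
  have "(?g has_real_derivative inverse (slope u)) (at (height u + 0 * n_axis u))"
    using height_inverse_deriv[OF u] by simp
  note d2 = DERIV_chain2[OF this d1]
  have "(radius_sq has_real_derivative - (2 * u * H1 y / E\<^sup>2)) (at (?g (height u + 0 * n_axis u)))"
    using radius_sq_deriv[of u] u by (simp add: g y_def E_def)
  note d3 = DERIV_chain2[OF this d2]
  have "((\<lambda>s. radius_sq u * (1 + s * curv u)\<^sup>2) has_real_derivative 2 * curv u * radius_sq u) (at 0)"
    by (auto intro!: derivative_eq_intros)
  from DERIV_diff[OF this d3]
  have d\<Phi>: "(\<Phi> has_real_derivative 2 * curv u * radius_sq u +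
    2 * u * H1 y / E\<^sup>2 * (n_axis u / slope u)) (at 0)"
    by (simp add: \<Phi>_def[abs_def] divide_inverse mult_ac)
  have n: "n_axis u = u * H1 y / (E\<^sup>2 * sqrt P)" by (simp add: n_axis_def y_def E_def P_def)
  have "2 * u * H1 y / E\<^sup>2 * (n_axis u / slope u) = 2 * (u * H1 y / E\<^sup>2)\<^sup>2 / (sqrt P * slope u)"
    unfolding n by (simp add: power2_eq_square mult_ac)
  also have "0 \<le> \<dots>" using sl EP by (intro divide_nonneg_nonneg mult_nonneg_nonneg) auto
  finally have "0 \<le> 2 * u * H1 y / E\<^sup>2 * (n_axis u / slope u)" .
  moreover have "0 < 2 * curv u * radius_sq u"
    unfolding radius_sq_def using cu y prof_pos[of u] by (simp add: y_def[symmetric])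
  ultimately have "0 < 2 * curv u * radius_sq u + 2 * u * H1 y / E\<^sup>2 * (n_axis u / slope u)"
    by linarith
  from DERIV_pos_inc_right[OF d\<Phi> this]
  obtain \<delta> where \<delta>: "0 < \<delta>" "\<And>s. 0 < s \<Longrightarrow> s < \<delta> \<Longrightarrow> \<Phi> 0 < \<Phi> s" by auto
  have "\<Phi> 0 = 0" using u by (simp add: \<Phi>_def g)
  show ?thesis
    unfolding eventually_at_right_field
  proof (intro exI conjI allI impI ballI)
    show "0 < \<delta>" by fact
    fix s v assume s: "0 < s" "s < \<delta>" and v: "v \<in> {-1..1}" "height v = height u + s * n_axis u"
    have "?g (height u + s * n_axis u) = v" unfolding v(2)[symmetric] by (rule g[OF v(1)])
    then show "radius_sq v < radius_sq u * (1 + s * curv u)\<^sup>2"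
      using \<delta>(2)[OF s] \<open>\<Phi> 0 = 0\<close> by (simp add: \<Phi>_def)
  qed
qed

lemma n_axis_pole: "n_axis 1 = 1" "n_axis (- 1) = - 1"
proof -
  have "H1 0 = B ^ 3" "SE 0 = B" "SP 0 = B\<^sup>2" by (simp_all add: surf_H1_def surf_E_def surf_P_def
    power2_eq_square power3_eq_cube)
  moreover have "sqrt (B\<^sup>2) = B" using B_pos by (intro real_sqrt_unique) auto
  moreover have "b ^ 3 / (b\<^sup>2 * b) = 1" if "0 < b" for b :: real
    using that by (simp add: power2_eq_square power3_eq_cube)
  note this[OF B_pos]
  ultimately show "n_axis 1 = 1" "n_axis (- 1) = - 1"
    by (simp_all add: n_axis_def)
qed

text \<open>From \<open>emb q + s *\<^sub>R nrm q\<close> one escapes to infinity horizontally,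
  or along the axis if \<open>q\<close> is a pole.\<close>

lemma nrm_outward:
  assumes q: "q \<in> sphere 0 1"
  shows "\<forall>\<^sub>F s in at_right 0. emb q + s *\<^sub>R nrm q \<in> outside (emb ` sphere 0 1)"
proof (cases "q $ 3 = 1 \<or> q $ 3 = - 1")
  case True
  then have "(q $ 1)\<^sup>2 + (q $ 2)\<^sup>2 = 0" using sphere_sq[OF q] by auto
  then have q12: "q $ 1 = 0" "q $ 2 = 0" by (simp_all add: sum_power2_eq_zero_iff)
  have na: "n_axis (q $ 3) = q $ 3" using True n_axis_pole by auto
  have "emb q + s *\<^sub>R nrm q \<in> outside (emb ` sphere 0 1)" if s: "0 < s" for s
  \<comment> \<open>At a pole \<open>q\<close> is itself the direction of the axis, and the ray
    stays strictly beyond the extreme height of the surface.\<close>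
  proof (rule ray_subset_imp_outside[of q])
    show "q \<noteq> 0" using q by auto
    fix k :: real assume k: "0 \<le> k"
    show "emb q + s *\<^sub>R nrm q + k *\<^sub>R q \<notin> emb ` sphere 0 1"
    proof
      assume "emb q + s *\<^sub>R nrm q + k *\<^sub>R q \<in> emb ` sphere 0 1"
      then obtain v where v: "v \<in> {-1..1}" "(emb q + s *\<^sub>R nrm q + k *\<^sub>R q) $ 3 = height v"
        by (rule emb_image)
      then have e: "height (q $ 3) + (s + k) * q $ 3 = height v"
        by (simp add: emb_def nrm_def na algebra_simps)
      have "height (- 1) \<le> height v" "height v \<le> height 1"
        using height_strict_mono[of "-1" v] height_strict_mono[of v 1] v(1) by (cases "v =
          -1"; cases "v = 1"; force)+
      then show False using True e s k by auto
    qed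
  qed
  then show ?thesis using eventually_at_right_less[of "0::real"] by (auto elim: eventually_mono)
next
  case False
  define u where "u = q $ 3"
  have u: "-1 < u" "u < 1" using False sphere_3[OF q] by (auto simp: u_def)
  \<comment> \<open>Horizontal radial direction: along this ray the height stays that of the
    displaced point, where \<open>radius_sq_less\<close> applies, and the distance to the axis only
    grows.\<close>
  define d :: "real^3" where "d = vector [q $ 1, q $ 2, 0]"
  have y: "(q $ 1)\<^sup>2 + (q $ 2)\<^sup>2 = 1 - u\<^sup>2" using sphere_sq[OF q] by (simp add: u_def)
  have y0: "0 < 1 - u\<^sup>2" using u by (simp add: abs_square_less_1)
  have "q $ 1 \<noteq> 0 \<or> q $ 2 \<noteq> 0" using y y0 by auto
  then have d: "d \<noteq> 0" by (auto simp: d_def vec_eq_iff forall_3)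
  have cu: "0 < curv u" using curv_pos u by simp
  show ?thesis
    using radius_sq_less[OF u] eventually_at_right_less[of "0::real"]
  proof eventually_elim
    case (elim s)
    show ?case
    proof (rule ray_subset_imp_outside[OF d])
      fix k :: real assume k: "0 \<le> k"
      show "emb q + s *\<^sub>R nrm q + k *\<^sub>R d \<notin> emb ` sphere 0 1"
      proof
        let ?z = "emb q + s *\<^sub>R nrm q + k *\<^sub>R d"
        assume "?z \<in> emb ` sphere 0 1"
        then obtain v where v: "v \<in> {-1..1}" "?z $ 3 = height v" "(?z $ 1)\<^sup>2 + (?z $ 2)\<^sup>2 =
          radius_sq v"
          by (rule emb_image)
        have "height v = height u + s * n_axis u" using v(2)
          by (simp add: emb_def nrm_def d_def u_def)
        with elim(1) v(1) have less: "radius_sq v < radius_sq u * (1 + s * curv u)\<^sup>2" by blast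
        have z: "?z $ 1 = q $ 1 * (prof u * (1 + s * curv u) + k)" "?z $ 2 =
          q $ 2 * (prof u * (1 + s * curv u) + k)"
          by (simp_all add: emb_def nrm_def d_def u_def algebra_simps)
        have "(?z $ 1)\<^sup>2 + (?z $ 2)\<^sup>2 = ((q $ 1)\<^sup>2 + (q $ 2)\<^sup>2) * (prof u * (1 + s * curv u) + k)\<^sup>2"
          unfolding z by algebra
        also have "\<dots> = (1 - u\<^sup>2) * (prof u * (1 + s * curv u) + k)\<^sup>2" unfolding y ..
        also have "\<dots> \<ge> (1 - u\<^sup>2) * (prof u * (1 + s * curv u))\<^sup>2"
          using y0 k cu elim(2) prof_pos[of u] by (intro mult_left_mono power_mono) auto
        also have "(1 - u\<^sup>2) * (prof u * (1 + s * curv u))\<^sup>2 = radius_sq u * (1 + s * curv u)\<^sup>2"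
          by (simp add: radius_sq_def power_mult_distrib)
        finally show False using less v(3) by simp
      qed
    qed
  qed
qed

lemma nrm_outward_unit_normal: "outward_unit_normal emb nrm"
  unfolding outward_unit_normal_def
  using nrm_continuous nrm_norm nrm_outward nrm_orthogonal by auto

lemma exists_embedding_k0_gt_k:
  "\<exists>e \<nu>. axisymmetric_isometric_embedding (surface_metric m a t r) e \<and> outward_unit_normal e \<nu> \<and>
    (\<forall>\<theta>\<in>{0..pi}. embedding_k0 e \<nu> \<theta> - surface_k m a t r \<theta> > 0)"
proof -
  interpret kerr_embedding m a r t emb nrm
    by unfold_locales (rule emb_embedding nrm_outward_unit_normal)+
  have "0 < \<kappa> \<theta>" if \<theta>: "\<theta> \<in> {0<..<pi}" for \<theta>
  proof -
    \<comment> \<open>The squared profile radius is \<open>H\<close>, so this quotient is just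
      \<open>curv (cos \<theta>)\<close>.\<close>
    have "\<kappa> \<theta> = (sin \<theta> * prof (cos \<theta>))\<^sup>2 * curv (cos \<theta>) / kerr_H m a r \<theta>"
      by (simp add: \<kappa>_def n_def c_def emb_def nrm_def power2_eq_square mult_ac)
    moreover have "0 < curv (cos \<theta>)" by (rule curv_pos) simp
    ultimately show ?thesis unfolding profile_eq[OF \<theta>] using H_pos[OF \<theta>] by simp
  qed
  then show ?thesis using k0_gt_k[OF far] emb_embedding nrm_outward_unit_normal by blast
qed

end

theorem theorem2p1:
  fixes m a r t :: real
  assumes "m > 0" and "0 \<le> a" and "a \<le> m" and "r > kerr_r_plus m a"
  shows "(\<forall>x::real. x^3 + a\<^sup>2 * x - 6 * a\<^sup>2 * m = 0 \<longleftrightarrow> x = kerr_r_k m a) \<and>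
    ((\<forall>\<theta>\<in>{0..pi}. surface_K m a t r \<theta> > 0) \<longleftrightarrow> r > kerr_r_k m a) \<and>
    ((\<exists>e \<nu>. axisymmetric_isometric_embedding (surface_metric m a t r) e \<and>
            outward_unit_normal e \<nu> \<and>
            (\<forall>\<theta>\<in>{0..pi}. embedding_k0 e \<nu> \<theta> - surface_k m a t r \<theta> > 0))
      \<longleftrightarrow> r > sqrt 3 * a)"
proof -
  interpret kerr_exterior m a r using assms by unfold_locales
  have far_iff: "3 * a\<^sup>2 < r\<^sup>2 \<longleftrightarrow> sqrt 3 * a < r"
  proof -
    have "(sqrt 3 * a)\<^sup>2 = 3 * a\<^sup>2" by (simp add: power_mult_distrib)
    moreover have "sqrt 3 * a < r \<longleftrightarrow> (sqrt 3 * a)\<^sup>2 < r\<^sup>2"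
      using assms(2) r_pos power_mono_iff[of r "sqrt 3 * a" 2] by (auto simp: not_le[symmetric])
    ultimately show ?thesis by simp
  qed
  have "3 * a\<^sup>2 < r\<^sup>2"
    if "axisymmetric_isometric_embedding (surface_metric m a t r) e" "outward_unit_normal e \<nu>"
      "\<forall>\<theta>\<in>{0..pi}. embedding_k0 e \<nu> \<theta> - surface_k m a t r \<theta> > 0" for e \<nu>
  proof -
    interpret kerr_embedding m a r t e \<nu> using that(1,2) by unfold_locales
    show ?thesis by (rule k0_gt_k_imp[OF that(3)])
  qed
  moreover have "\<exists>e \<nu>. axisymmetric_isometric_embedding (surface_metric m a t r) e \<and>
    outward_unit_normal e \<nu> \<and>
      (\<forall>\<theta>\<in>{0..pi}. embedding_k0 e \<nu> \<theta> - surface_k m a t r \<theta> > 0)" if "3 * a\<^sup>2 < r\<^sup>2"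
  proof -
    interpret kerr_far m a r using that by unfold_locales
    show ?thesis by (rule exists_embedding_k0_gt_k)
  qed
  ultimately show ?thesis
    using cubic_root_iff(1)[OF assms(1,2)] surface_K_pos_iff pole_num_pos_iff far_iff by blast
qed

end
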